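(* Let $T:\mathbb{S}^1\to\mathbb{S}^1$ be a piecewise affine, eventually expanding circle map such that the matching condition holds. Then $T$ preserves an absolutely continuous invariant probability measure $d\mu = h\,dx$, and the density $h$ is constant on the elements of the prematching partition.
   Context: Piecewise affine means that there is a finite partition of $\mathbb{S}^1$ into intervals such that $T$ is affine on each partition element. Eventually expanding means that some iterate $T^m$ satisfies $\inf |(T^m)'|>1$ (where the derivative is defined). For a piecewise continuous map $T$ and a point $c$, the upper/lower orbits are $T^k(c^+):=\lim_{x\to c^+}T^k(x)$ and $T^k(c^-):=\lim_{x\to c^-}T^k(x)$, $k\in\mathbb{N}$; $(T^k)'(c^{\pm})$ denote the corresponding one-sided derivatives (one-sided limits of $(T^k)'$). Matching condition: for every discontinuity point $c$ (either of $T$ or of $T'$) there exist positive integers $\kappa_c^{\pm}$ (the matching exponents of $c$) such that $T^{\kappa_c^-}(c^-)=T^{\kappa_c^+}(c^+)$ and $(T^{\kappa_c^-})'(c^-)=(T^{\kappa_c^+})'(c^+)$. Prematching set: $PM:=\bigcup_c\Big(\bigcup_{j=1}^{\kappa_c^--1}\{T^j(c^-)\}\cup\bigcup_{j=1}^{\kappa_c^+-1}\{T^j(c^+)\}\Big)$, the union being over all discontinuity points $c$ of $T$ or $T'$. The prematching partition consists of the complementary intervals (connected components of the complement) of $PM$. Densities are understood up to modification on Lebesgue null sets. *)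

theory Defs
  imports "HOL-Probability.Probability"
begin

text \<open>
  The circle is the unit circle of the complex plane, parametrised by
  the angle coordinate in \<open>\<real>/\<int>\<close>: the class of \<open>t\<close> is
  the point \<open>circle_pt t\<close>.  A circle map is a function on complex numbers of which only
  the restriction to the unit circle matters.
\<close>

abbreviation S1 :: "complex set" where
  "S1 \<equiv> sphere 0 1"

definition circle_pt :: "real \<Rightarrow> complex" where
  "circle_pt t = cis (2 * pi * t)"

definition circle_lebesgue :: "complex measure" where
  "circle_lebesgue = distr (restrict_space lborel {0..<1}) (restrict_space borel S1) circle_pt"

text \<open>One-sided approach to \<open>c\<close>: the positive direction is that of increasing angle.\<close>

definition circle_at_right :: "complex \<Rightarrow> complex filter" where
  "circle_at_right c = filtermap (\<lambda>u. c * circle_pt u) (at_right 0)"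

definition circle_at_left :: "complex \<Rightarrow> complex filter" where
  "circle_at_left c = filtermap (\<lambda>u. c * circle_pt u) (at_left 0)"

text \<open>
  The derivative in the angle coordinate.  If \<open>f (circle_pt t) = circle_pt (F t)\<close> for a lift
  \<open>F\<close> of \<open>f\<close>, then the curve below has velocity \<open>2 \<pi> \<i> F' (t) f (z)\<close> at \<open>z = circle_pt t\<close>,
  and the derivative of \<open>f\<close> at \<open>z\<close> is the real number \<open>F' (t)\<close>.
\<close>

definition circle_has_deriv :: "(complex \<Rightarrow> complex) \<Rightarrow> real \<Rightarrow> complex \<Rightarrow> bool" where
  "circle_has_deriv f s z \<longleftrightarrow>
     ((\<lambda>u. f (z * circle_pt u)) has_vector_derivative (2 * pi * \<i> * s * f z)) (at 0)"

definition circle_differentiable :: "(complex \<Rightarrow> complex) \<Rightarrow> complex \<Rightarrow> bool" where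
  "circle_differentiable f z \<longleftrightarrow> (\<exists>s. circle_has_deriv f s z)"

definition circle_deriv :: "(complex \<Rightarrow> complex) \<Rightarrow> complex \<Rightarrow> real" where
  "circle_deriv f z = (THE s. circle_has_deriv f s z)"

text \<open>
  Affine pieces: \<open>J\<close> is a real interval (open, closed, half-open or a single point) which the
  parametrisation maps bijectively onto the arc \<open>I\<close>.  The slope need not be an integer.
\<close>

definition affine_on_arc :: "(complex \<Rightarrow> complex) \<Rightarrow> complex set \<Rightarrow> bool" where
  "affine_on_arc T I \<longleftrightarrow>
     (\<exists>J a b. is_interval J \<and> bij_betw circle_pt J I \<and>
        (\<forall>t\<in>J. T (circle_pt t) = circle_pt (a * t + b)))"

definition piecewise_affine :: "(complex \<Rightarrow> complex) \<Rightarrow> bool" where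
  "piecewise_affine T \<longleftrightarrow>
     (\<exists>P. finite P \<and> partition_on S1 P \<and> (\<forall>I\<in>P. affine_on_arc T I))"

definition eventually_expanding :: "(complex \<Rightarrow> complex) \<Rightarrow> bool" where
  "eventually_expanding T \<longleftrightarrow>
     (\<exists>m\<ge>1. (INF z\<in>{z \<in> S1. circle_differentiable (T ^^ m) z}. \<bar>circle_deriv (T ^^ m) z\<bar>) > 1)"

text \<open>
  Points at which \<open>T'\<close> does not exist count as discontinuity points of \<open>T'\<close>.
\<close>

definition discontinuities :: "(complex \<Rightarrow> complex) \<Rightarrow> complex set" where
  "discontinuities T =
     {c \<in> S1. \<not> continuous (at c within S1) T \<or>
              \<not> (circle_differentiable T c \<and> continuous (at c within S1) (circle_deriv T))}"

definition upper_orbit :: "(complex \<Rightarrow> complex) \<Rightarrow> nat \<Rightarrow> complex \<Rightarrow> complex" where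
  "upper_orbit T k c = Lim (circle_at_right c) (T ^^ k)"

definition lower_orbit :: "(complex \<Rightarrow> complex) \<Rightarrow> nat \<Rightarrow> complex \<Rightarrow> complex" where
  "lower_orbit T k c = Lim (circle_at_left c) (T ^^ k)"

definition upper_deriv :: "(complex \<Rightarrow> complex) \<Rightarrow> nat \<Rightarrow> complex \<Rightarrow> real" where
  "upper_deriv T k c = Lim (circle_at_right c) (circle_deriv (T ^^ k))"

definition lower_deriv :: "(complex \<Rightarrow> complex) \<Rightarrow> nat \<Rightarrow> complex \<Rightarrow> real" where
  "lower_deriv T k c = Lim (circle_at_left c) (circle_deriv (T ^^ k))"

text \<open>
  The matching exponents \<open>\<kappa>m c\<close> (lower) and \<open>\<kappa>p c\<close> (upper) are not required to be minimal;
  the prematching set depends on their choice.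
\<close>

definition matching ::
  "(complex \<Rightarrow> complex) \<Rightarrow> (complex \<Rightarrow> nat) \<Rightarrow> (complex \<Rightarrow> nat) \<Rightarrow> bool" where
  "matching T \<kappa>m \<kappa>p \<longleftrightarrow>
     (\<forall>c\<in>discontinuities T. \<kappa>m c \<ge> 1 \<and> \<kappa>p c \<ge> 1 \<and>
        lower_orbit T (\<kappa>m c) c = upper_orbit T (\<kappa>p c) c \<and>
        lower_deriv T (\<kappa>m c) c = upper_deriv T (\<kappa>p c) c)"

definition prematching_set ::
  "(complex \<Rightarrow> complex) \<Rightarrow> (complex \<Rightarrow> nat) \<Rightarrow> (complex \<Rightarrow> nat) \<Rightarrow> complex set" where
  "prematching_set T \<kappa>m \<kappa>p =
     (\<Union>c\<in>discontinuities T.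
        (\<Union>j\<in>{1..<\<kappa>m c}. {lower_orbit T j c}) \<union> (\<Union>j\<in>{1..<\<kappa>p c}. {upper_orbit T j c}))"

definition prematching_partition ::
  "(complex \<Rightarrow> complex) \<Rightarrow> (complex \<Rightarrow> nat) \<Rightarrow> (complex \<Rightarrow> nat) \<Rightarrow> complex set set" where
  "prematching_partition T \<kappa>m \<kappa>p = components (S1 - prematching_set T \<kappa>m \<kappa>p)"

definition acip :: "(complex \<Rightarrow> complex) \<Rightarrow> complex measure \<Rightarrow> bool" where
  "acip T \<mu> \<longleftrightarrow>
     prob_space \<mu> \<and> sets \<mu> = sets circle_lebesgue \<and> absolutely_continuous circle_lebesgue \<mu> \<and>
     T \<in> measurable \<mu> \<mu> \<and> distr \<mu> \<mu> T = \<mu>"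

end

theory Submission imports Defs
begin


text \<open>
  The invariant measure is a limit of the averages \<open>1/N \<Sum>n<N. (T^n)\<^sub>* \<lambda>\<close> of push-forwards of Lebesgue
  measure \<open>\<lambda>\<close>, and all of these averages are computed explicitly.

  Let \<open>\<Phi>\<close> be the function \<open>\<Phi> (z) = \<lambda> (E \<inter> [1,z)) - angle z * \<lambda> E\<close> on the circle, a primitive of
  \<open>1\<^sub>E - \<lambda> E\<close>. On an interval where \<open>T^n\<close> is affine with slope \<open>s\<close>, the measure of \<open>T^-n E\<close> is
  \<open>\<lambda> E\<close> times the length plus \<open>1/s\<close> times the difference of \<open>\<Phi> \<circ> T^n\<close> at the two ends. Summing over
  the intervals and regrouping by end points gives (\<open>measure_iterate_vimage\<close>, \<open>defect_cells\<close>)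

    \<open>\<lambda> (T^-n E) = \<lambda> E - \<Sum>x. (\<Phi> (T^n (x+)) / (T^n)' (x+) - \<Phi> (T^n (x-)) / (T^n)' (x-))\<close>.

  The two germs \<open>x+\<close> and \<open>x-\<close> of a point contribute with opposite signs, so only break points of \<open>T^n\<close>
  count. If the contributions of one germ are summed over all \<open>n\<close>, expansion makes the series
  converge; call the sum over both germs of \<open>x\<close> the resolvent jump at \<open>x\<close>.

  The matching condition enters as follows. At a discontinuity \<open>c\<close> the orbits of \<open>c+\<close> and \<open>c-\<close> reach, after
  \<open>\<kappa>p c\<close> and \<open>\<kappa>m c\<close> steps, the same point with the same slope, hence from opposite sides. So the resolvent jump at
  \<open>c\<close> is a sum of values of \<open>\<Phi>\<close> on the prematching set plus a multiple of the resolvent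
  jump at the meeting point, the multiplier being the reciprocal of the modulus of the derivative
  (\<open>jump_resolvent_transport\<close>). At every other point the same holds with a single step
  and no values of \<open>\<Phi>\<close>. If \<open>\<Phi>\<close> vanishes on the prematching set, a resolvent jump is therefore
  a bounded quantity times an arbitrarily small factor, that is, zero
  (\<open>jump_resolvent_eq_0\<close>). By linearity the resolvent jumps depend on \<open>\<Phi>\<close> only
  through its values on the prematching set (\<open>jump_resolvent_on_prematching_set\<close>).

  It follows that the \<open>N\<close>-th average gives \<open>E\<close> the mass \<open>\<lambda> E + \<Sum>p. \<alpha>\<^sub>N p * \<Phi> p\<close>, with \<open>p\<close> in the
  finite prematching set, up to an error of order \<open>1/N\<close>. The error and the coefficients are
  controlled because the sum of \<open>1 / \<bar>(T^n)'\<bar>\<close> over the intervals of affinity is bounded in \<open>n\<close>, which is the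
  Lasota--Yorke inequality in its simplest form (\<open>total_weight_bounded\<close>). Along a
  subsequence the coefficients converge (\<open>averages_converge\<close>). The limit measure has a step
  density which jumps only at the prematching set: besides the jumps at the points \<open>p\<close> there could
  be one at angle \<open>0\<close>, of height \<open>\<Sum>p. \<alpha> p\<close>, but this sum is zero, as the constant function
  \<open>\<Phi> = 1\<close> shows. The convergence holds for every Borel set, so positivity and invariance pass
  to the limit at once (\<open>invariant_density\<close>).
\<close>

section \<open>The circle and its angle coordinate\<close>

lemma circle_pt_0 [simp]: "circle_pt 0 = 1"
  by (simp add: circle_pt_def)

lemma circle_pt_add: "circle_pt (x + y) = circle_pt x * circle_pt y"
  by (simp add: circle_pt_def cis_mult algebra_simps)

lemma norm_circle_pt [simp]: "norm (circle_pt x) = 1"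
  by (simp add: circle_pt_def)

lemma circle_pt_in_S1 [simp]: "circle_pt x \<in> S1"
  by simp

lemma circle_pt_nonzero [simp]: "circle_pt x \<noteq> 0"
  by (metis norm_circle_pt norm_zero zero_neq_one)

lemma circle_pt_eq_iff: "circle_pt x = circle_pt y \<longleftrightarrow> x - y \<in> \<int>"
proof -
  have "circle_pt x = circle_pt y \<longleftrightarrow> cis (2 * pi * (x - y)) = 1"
    by (simp add: circle_pt_def right_diff_distrib cis_divide [symmetric])
  also have "\<dots> \<longleftrightarrow> cos (2 * pi * (x - y)) = 1"
    by (auto simp: complex_eq_iff cos_one_sin_zero)
  also have "\<dots> \<longleftrightarrow> (\<exists>n::int. x - y = of_int n)"
  proof -
    have "2 * pi * (x - y) = of_int n * 2 * pi \<longleftrightarrow> x - y = of_int n" for n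
    proof -
      have "2 * pi * (x - y) - of_int n * 2 * pi = 2 * pi * ((x - y) - of_int n)"
        by (simp add: algebra_simps)
      then show ?thesis by (metis eq_iff_diff_eq_0 mult_eq_0_iff pi_neq_zero zero_neq_numeral)
    qed
    then show ?thesis by (simp only: cos_one_2pi_int)
  qed
  finally show ?thesis
    by (auto simp: Ints_def)
qed

lemma circle_pt_add_int [simp]: "circle_pt (x + of_int k) = circle_pt x"
  by (simp add: circle_pt_eq_iff)

lemma circle_pt_add_1 [simp]: "circle_pt (x + 1) = circle_pt x"
  by (simp add: circle_pt_eq_iff)

lemma circle_pt_1 [simp]: "circle_pt 1 = 1"
  using circle_pt_add_1[of 0] by simp

lemma circle_pt_eqD: "circle_pt x = circle_pt y \<Longrightarrow> \<bar>x - y\<bar> < 1 \<Longrightarrow> x = y"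
  by (metis Ints_nonzero_abs_less1 circle_pt_eq_iff eq_iff_diff_eq_0)

lemma inj_on_circle_pt: "inj_on circle_pt {0..<1}"
  by (intro inj_onI circle_pt_eqD) auto

lemma circle_ptE:
  assumes "z \<in> S1"
  obtains t where "0 \<le> t" "t < 1" "circle_pt t = z"
proof
  define s where "s = Arg z / (2 * pi)"
  have "z \<noteq> 0" using assms by auto
  then have "circle_pt s = z"
    using assms by (simp add: circle_pt_def s_def cis_Arg sgn_eq)
  moreover have "circle_pt (frac s) = circle_pt s"
    by (simp add: circle_pt_eq_iff frac_def)
  ultimately show "circle_pt (frac s) = z" by simp
qed (auto simp: frac_lt_1)

lemma continuous_on_circle_pt [continuous_intros]:
  "continuous_on S f \<Longrightarrow> continuous_on S (\<lambda>x. circle_pt (f x))"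
  unfolding circle_pt_def by (intro continuous_intros)

lemma tendsto_circle_pt [tendsto_intros]:
  "(f \<longlongrightarrow> a) F \<Longrightarrow> ((\<lambda>x. circle_pt (f x)) \<longlongrightarrow> circle_pt a) F"
proof -
  have "isCont circle_pt a"
    using continuous_on_circle_pt[of UNIV "\<lambda>x. x"] by (simp add: continuous_on_eq_continuous_at)
  then show "(f \<longlongrightarrow> a) F \<Longrightarrow> ((\<lambda>x. circle_pt (f x)) \<longlongrightarrow> circle_pt a) F"
    by (rule isCont_tendsto_compose)
qed

lemma dist_circle_pt_le: "dist (circle_pt x) (circle_pt y) \<le> 2 * pi * \<bar>x - y\<bar>"
proof -
  have "norm (circle_pt x - circle_pt y) \<le> (2 * pi) * norm (x - y)"
  proof (rule differentiable_bound[where S = UNIV and f' = "\<lambda>x u. u *\<^sub>R (2 * pi * \<i> * circle_pt x)"])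
    show "convex (UNIV :: real set)" by simp
    fix x :: real
    show "(circle_pt has_derivative (\<lambda>u. u *\<^sub>R (2 * pi * \<i> * circle_pt x))) (at x within UNIV)"
      unfolding circle_pt_def
      by (auto intro!: derivative_eq_intros simp: scaleR_conv_of_real algebra_simps)
    show "onorm (\<lambda>u. u *\<^sub>R (2 * pi * \<i> * circle_pt x)) \<le> 2 * pi"
      by (rule onorm_bound) (auto simp: norm_mult)
  qed auto
  then show ?thesis by (simp add: dist_norm)
qed

lemma circle_pt_has_vector_derivative:
  "((\<lambda>u. circle_pt (s * u)) has_vector_derivative (2 * pi * \<i> * s * circle_pt (s * u))) (at u within S)"
  unfolding circle_pt_def has_vector_derivative_def
  by (auto intro!: derivative_eq_intros simp: scaleR_conv_of_real algebra_simps)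

text \<open>
  Multiplication by \<open>circle_pt u\<close> with small \<open>u\<close> reaches a whole neighbourhood of \<open>z\<close> in the circle,
  because the principal argument is continuous at \<open>1\<close>. This turns statements in the angle
  coordinate into statements about limits within \<open>S1\<close>.
\<close>

lemma circle_pt_local_surj:
  assumes z: "z \<in> S1" and "\<delta> > 0"
  obtains \<epsilon> where "\<epsilon> > 0" "\<And>w. w \<in> S1 \<Longrightarrow> dist w z < \<epsilon> \<Longrightarrow> \<exists>u. \<bar>u\<bar> < \<delta> \<and> w = z * circle_pt u"
proof -
  have nz: "z \<noteq> 0" using z by auto
  have "((\<lambda>w. w / z) \<longlongrightarrow> 1) (nhds z)"
    using nz tendsto_divide[OF filterlim_ident tendsto_const, of z z] by simp
  then have "((\<lambda>w. Arg (w / z)) \<longlongrightarrow> Arg 1) (nhds z)"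
    by (rule isCont_tendsto_compose[OF continuous_at_Arg, rotated]) (auto simp: complex_nonpos_Reals_iff)
  then have "((\<lambda>w. Arg (w / z)) \<longlongrightarrow> 0) (nhds z)"
    using nz by simp
  then have "\<forall>\<^sub>F w in nhds z. dist (Arg (w / z)) 0 < 2 * pi * \<delta>"
    using \<open>\<delta> > 0\<close> by (intro tendstoD) auto
  then obtain \<epsilon> where \<epsilon>: "\<epsilon> > 0" "\<And>w. dist w z < \<epsilon> \<Longrightarrow> \<bar>Arg (w / z)\<bar> < 2 * pi * \<delta>"
    by (auto simp: eventually_nhds_metric)
  show thesis
  proof (rule that[OF \<epsilon>(1)])
    fix w assume w: "w \<in> S1" "dist w z < \<epsilon>"
    define u where "u = Arg (w / z) / (2 * pi)"
    have "w / z \<noteq> 0" using w nz by auto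
    then have "circle_pt u = w / z"
      using w z by (simp add: circle_pt_def u_def cis_Arg sgn_eq norm_divide)
    then have "w = z * circle_pt u" using nz by simp
    moreover have "\<bar>u\<bar> < \<delta>"
      using \<epsilon>(2)[OF w(2)] by (simp add: u_def abs_divide field_simps)
    ultimately show "\<exists>u. \<bar>u\<bar> < \<delta> \<and> w = z * circle_pt u" by blast
  qed
qed

lemma finite_angles_isolated:
  assumes "finite A"
  obtains \<delta> where "\<delta> > 0" "\<And>x. 0 < \<bar>x - t\<bar> \<Longrightarrow> \<bar>x - t\<bar> < \<delta> \<Longrightarrow> circle_pt x \<notin> A"
proof -
  have "open (- (A - {circle_pt t}))"
    using assms by (intro open_Compl finite_imp_closed) auto
  then have "\<forall>\<^sub>F x in nhds t. circle_pt x \<in> - (A - {circle_pt t})"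
    by (intro topological_tendstoD[OF tendsto_circle_pt[OF filterlim_ident]]) auto
  then obtain \<epsilon> where \<epsilon>: "\<epsilon> > 0" "\<And>x. dist x t < \<epsilon> \<Longrightarrow> circle_pt x \<notin> A - {circle_pt t}"
    by (auto simp: eventually_nhds_metric)
  show thesis
  proof (rule that[of "min \<epsilon> 1"])
    fix x assume x: "0 < \<bar>x - t\<bar>" "\<bar>x - t\<bar> < min \<epsilon> 1"
    then have "circle_pt x \<noteq> circle_pt t" using circle_pt_eqD[of x t] by auto
    then show "circle_pt x \<notin> A" using \<epsilon>(2)[of x] x by (auto simp: dist_real_def)
  qed (use \<epsilon> in auto)
qed

text \<open>
  The angles over a finite set are periodic, so they are uniformly separated on the whole line:
  angles over distinct points by the Lipschitz bound for \<open>circle_pt\<close>, angles over one point by \<open>1\<close>.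
\<close>

lemma finite_angles_separated:
  assumes "finite A"
  obtains \<eta> where "\<eta> > 0" "\<And>x y. circle_pt x \<in> A \<Longrightarrow> circle_pt y \<in> A \<Longrightarrow> x \<noteq> y \<Longrightarrow> \<eta> \<le> \<bar>x - y\<bar>"
proof -
  define D where "D = insert 1 ((\<lambda>(z,w). dist z w) ` {(z,w) \<in> A \<times> A. z \<noteq> w})"
  have "finite {(z,w) \<in> A \<times> A. z \<noteq> w}"
    using assms by (auto intro: finite_subset[of _ "A \<times> A"])
  then have fin: "finite D" by (simp add: D_def)
  have pos: "d > 0" if "d \<in> D" for d using that by (auto simp: D_def)
  have "D \<noteq> {}" by (auto simp: D_def)
  show thesis
  proof (rule that[of "Min D / (2 * pi)"])
    show "Min D / (2 * pi) > 0" using pos fin \<open>D \<noteq> {}\<close> by simp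
    fix x y assume xy: "circle_pt x \<in> A" "circle_pt y \<in> A" "x \<noteq> y"
    show "Min D / (2 * pi) \<le> \<bar>x - y\<bar>"
    proof (cases "circle_pt x = circle_pt y")
      case True
      then have "\<bar>x - y\<bar> \<ge> 1" using xy circle_pt_eqD[of x y] by force
      moreover have "Min D \<le> 1" using fin by (intro Min_le) (auto simp: D_def)
      moreover have "2 * pi \<ge> 1" using pi_ge_two by linarith
      ultimately have "Min D / (2 * pi) \<le> 1 / 1" by (intro frac_le) auto
      then show ?thesis using \<open>\<bar>x - y\<bar> \<ge> 1\<close> by linarith
    next
      case False
      then have "dist (circle_pt x) (circle_pt y) \<in> D" using xy by (auto simp: D_def)
      then have "Min D \<le> dist (circle_pt x) (circle_pt y)" using fin by simp
      also have "\<dots> \<le> 2 * pi * \<bar>x - y\<bar>" by (rule dist_circle_pt_le)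
      finally show ?thesis by (simp add: field_simps)
    qed
  qed
qed

section \<open>One-sided affine germs\<close>

text \<open>
  The side \<open>e\<close> is \<open>1\<close> or \<open>-1\<close>: to the right or to the left of \<open>z\<close>, the map \<open>f\<close> is affine with
  slope \<open>s\<close> and one-sided limit \<open>w\<close>. The value \<open>f z\<close> itself is not constrained.
\<close>

definition affine_germ :: "(complex \<Rightarrow> complex) \<Rightarrow> complex \<Rightarrow> real \<Rightarrow> complex \<Rightarrow> real \<Rightarrow> bool" where
  "affine_germ f z e w s \<longleftrightarrow>
     (\<exists>\<delta>>0. \<forall>u. 0 < u \<longrightarrow> u < \<delta> \<longrightarrow> f (z * circle_pt (e * u)) = w * circle_pt (s * (e * u)))"

lemma affine_germ_tendsto:
  assumes "affine_germ f z e w s"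
  shows "((\<lambda>u. f (z * circle_pt (e * u))) \<longlongrightarrow> w) (at_right 0)"
proof -
  obtain \<delta> where \<delta>: "\<delta> > 0"
    "\<And>u. 0 < u \<Longrightarrow> u < \<delta> \<Longrightarrow> f (z * circle_pt (e * u)) = w * circle_pt (s * (e * u))"
    using assms by (auto simp: affine_germ_def)
  have "((\<lambda>u. w * circle_pt (s * (e * u))) \<longlongrightarrow> w * circle_pt (s * (e * 0))) (at_right 0)"
    by (intro tendsto_intros)
  moreover have "\<forall>\<^sub>F u in at_right 0. f (z * circle_pt (e * u)) = w * circle_pt (s * (e * u))"
    unfolding eventually_at_right_field using \<delta> by auto
  ultimately show ?thesis
    by (simp add: tendsto_cong)
qed

lemma affine_germ_unique:
  assumes "affine_germ f z e w s" "affine_germ f z e w' s'" "w \<noteq> 0" "e \<noteq> 0"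
  shows "w' = w" "s' = s"
proof -
  show w: "w' = w"
    using affine_germ_tendsto[OF assms(1)] affine_germ_tendsto[OF assms(2)]
    by (intro tendsto_unique[of "at_right 0"]) auto
  obtain \<delta> \<delta>' where \<delta>: "\<delta> > 0" "\<delta>' > 0"
    "\<And>u. 0 < u \<Longrightarrow> u < \<delta> \<Longrightarrow> f (z * circle_pt (e * u)) = w * circle_pt (s * (e * u))"
    "\<And>u. 0 < u \<Longrightarrow> u < \<delta>' \<Longrightarrow> f (z * circle_pt (e * u)) = w' * circle_pt (s' * (e * u))"
    using assms by (auto simp: affine_germ_def)
  show "s' = s"
  proof (rule ccontr)
    assume ne: "s' \<noteq> s"
    define d where "d = \<bar>s' * e - s * e\<bar>"
    have d: "d > 0" using ne assms by (simp add: d_def)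
    define u where "u = min (min \<delta> \<delta>' / 2) (1 / (2 * d))"
    have u: "0 < u" "u < \<delta>" "u < \<delta>'" "u \<le> 1 / (2 * d)"
      using \<delta> d by (auto simp: u_def min_def)
    have "circle_pt (s' * (e * u)) = circle_pt (s * (e * u))"
      using \<delta>(3)[OF u(1,2)] \<delta>(4)[OF u(1,3)] w assms(3) by auto
    moreover have eq: "\<bar>s' * (e * u) - s * (e * u)\<bar> = d * u"
      using u by (simp add: d_def abs_mult flip: mult.assoc left_diff_distrib)
    moreover have "d * u < 1" using u(4) d by (simp add: field_simps)
    ultimately have "d * u = 0"
      using circle_pt_eqD by fastforce
    then show False using d u by simp
  qed
qed

text \<open>
  A negative slope exchanges the sides, whence the side \<open>e * sgn s\<close> for the second germ.
\<close>

lemma affine_germ_compose: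
  assumes f: "affine_germ f z e w s" and g: "affine_germ g w (e * sgn s) w' s'" and "s \<noteq> 0"
  shows "affine_germ (g \<circ> f) z e w' (s' * s)"
proof -
  obtain \<delta> \<delta>' where \<delta>: "\<delta> > 0" "\<delta>' > 0"
    "\<And>u. 0 < u \<Longrightarrow> u < \<delta> \<Longrightarrow> f (z * circle_pt (e * u)) = w * circle_pt (s * (e * u))"
    "\<And>u. 0 < u \<Longrightarrow> u < \<delta>' \<Longrightarrow> g (w * circle_pt (e * sgn s * u)) = w' * circle_pt (s' * (e * sgn s * u))"
    using f g by (auto simp: affine_germ_def)
  have "(g \<circ> f) (z * circle_pt (e * u)) = w' * circle_pt (s' * s * (e * u))"
    if u: "0 < u" "u < min \<delta> (\<delta>' / \<bar>s\<bar>)" for u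
  proof -
    have eq: "e * sgn s * (\<bar>s\<bar> * u) = s * (e * u)"
      using mult_sgn_abs[of s] by (metis mult.assoc mult.commute)
    have "\<bar>s\<bar> * u < \<delta>'" "0 < \<bar>s\<bar> * u" using u \<open>s \<noteq> 0\<close> by (auto simp: field_simps)
    then show ?thesis
      using \<delta>(3)[of u] \<delta>(4)[of "\<bar>s\<bar> * u"] u unfolding eq by (simp add: mult.assoc)
  qed
  moreover have "min \<delta> (\<delta>' / \<bar>s\<bar>) > 0" using \<delta> \<open>s \<noteq> 0\<close> by simp
  ultimately show ?thesis unfolding affine_germ_def by blast
qed

lemma circle_has_deriv_unique:
  assumes "circle_has_deriv f s z" "f z \<noteq> 0"
  shows "circle_deriv f z = s"
  unfolding circle_deriv_def
proof (rule the_equality)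
  fix s' assume "circle_has_deriv f s' z"
  then have "2 * pi * \<i> * s' * f z = 2 * pi * \<i> * s * f z"
    using assms unfolding circle_has_deriv_def by (metis vector_derivative_unique_at)
  then show "s' = s" using assms by simp
qed (rule assms)

lemma circle_has_deriv_affine:
  assumes "\<delta> > 0" "\<And>u. \<bar>u\<bar> < \<delta> \<Longrightarrow> f (z * circle_pt u) = w * circle_pt (s * u)"
  shows "circle_has_deriv f s z"
proof -
  have fz: "f z = w" using assms(2)[of 0] assms(1) by simp
  have "((\<lambda>u. w * circle_pt (s * u)) has_vector_derivative w * (2 * pi * \<i> * s * circle_pt (s * 0))) (at 0)"
    by (intro has_vector_derivative_mult_right circle_pt_has_vector_derivative)
  then have "((\<lambda>u. w * circle_pt (s * u)) has_vector_derivative 2 * pi * \<i> * s * f z) (at 0)"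
    by (simp add: fz algebra_simps)
  then show ?thesis
    unfolding circle_has_deriv_def
    by (rule has_vector_derivative_transform_within_open[of _ _ _ "{-\<delta><..<\<delta>}"])
      (use assms in \<open>auto simp: abs_less_iff\<close>)
qed

lemma affine_germ_circle_deriv:
  assumes "affine_germ f z e w s" "w \<noteq> 0" "e \<in> {1,-1}"
  shows "\<exists>\<delta>>0. \<forall>u. 0 < u \<longrightarrow> u < \<delta> \<longrightarrow>
           circle_has_deriv f s (z * circle_pt (e * u)) \<and> circle_deriv f (z * circle_pt (e * u)) = s"
proof -
  obtain \<delta> where \<delta>: "\<delta> > 0"
    "\<And>u. 0 < u \<Longrightarrow> u < \<delta> \<Longrightarrow> f (z * circle_pt (e * u)) = w * circle_pt (s * (e * u))"
    using assms by (auto simp: affine_germ_def)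
  have "circle_has_deriv f s (z * circle_pt (e * u)) \<and> circle_deriv f (z * circle_pt (e * u)) = s"
    if u: "0 < u" "u < \<delta>" for u
  proof -
    have D: "circle_has_deriv f s (z * circle_pt (e * u))"
    proof (rule circle_has_deriv_affine[where w = "w * circle_pt (s * (e * u))"])
      show "min u (\<delta> - u) > 0" using u by auto
      fix v assume v: "\<bar>v\<bar> < min u (\<delta> - u)"
      have e: "e * (u + e * v) = e * u + v" using assms(3) by (auto simp: algebra_simps)
      have "f (z * circle_pt (e * (u + e * v))) = w * circle_pt (s * (e * (u + e * v)))"
        using v assms(3) by (intro \<delta>(2)) (auto simp: abs_less_iff)
      then show "f (z * circle_pt (e * u) * circle_pt v) = w * circle_pt (s * (e * u)) * circle_pt (s * v)"
        unfolding e by (simp add: circle_pt_add mult.assoc distrib_left)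
    qed
    moreover have "f (z * circle_pt (e * u)) \<noteq> 0" using \<delta>(2)[OF u] assms(2) by simp
    ultimately show ?thesis using circle_has_deriv_unique by blast
  qed
  then show ?thesis using \<delta>(1) by blast
qed

lemma filterlim_circle_right:
  "filterlim f F (circle_at_right c) \<longleftrightarrow> filterlim (\<lambda>u. f (c * circle_pt (1 * u))) F (at_right 0)"
  by (simp add: circle_at_right_def filterlim_filtermap)

lemma filterlim_circle_left:
  "filterlim f F (circle_at_left c) \<longleftrightarrow> filterlim (\<lambda>u. f (c * circle_pt (-1 * u))) F (at_right 0)"
  by (simp add: circle_at_left_def filterlim_filtermap at_left_minus[of 0])

lemma affine_germ_deriv_tendsto:
  assumes "affine_germ f z e w s" "w \<noteq> 0" "e \<in> {1,-1}"
  shows "((\<lambda>u. circle_deriv f (z * circle_pt (e * u))) \<longlongrightarrow> s) (at_right 0)"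
proof (rule tendsto_eventually)
  show "\<forall>\<^sub>F u in at_right 0. circle_deriv f (z * circle_pt (e * u)) = s"
    using affine_germ_circle_deriv[OF assms] unfolding eventually_at_right_field by auto
qed

lemma one_sided_orbit_eq:
  assumes "w \<noteq> 0"
  shows "affine_germ (T ^^ k) c 1 w s \<Longrightarrow> upper_orbit T k c = w \<and> upper_deriv T k c = s"
    and "affine_germ (T ^^ k) c (-1) w s \<Longrightarrow> lower_orbit T k c = w \<and> lower_deriv T k c = s"
proof -
  have nb: "circle_at_right c \<noteq> bot" "circle_at_left c \<noteq> bot"
    by (auto simp: circle_at_right_def circle_at_left_def filtermap_bot_iff)
  show "upper_orbit T k c = w \<and> upper_deriv T k c = s" if "affine_germ (T ^^ k) c 1 w s"
    using affine_germ_tendsto[OF that] affine_germ_deriv_tendsto[OF that assms] nb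
    unfolding upper_orbit_def upper_deriv_def
    by (intro conjI tendsto_Lim) (auto simp: filterlim_circle_right)
  show "lower_orbit T k c = w \<and> lower_deriv T k c = s" if "affine_germ (T ^^ k) c (-1) w s"
    using affine_germ_tendsto[OF that] affine_germ_deriv_tendsto[OF that assms] nb
    unfolding lower_orbit_def lower_deriv_def
    by (intro conjI tendsto_Lim) (auto simp: filterlim_circle_left)
qed

text \<open>
  Differentiability is two-sided: it includes continuity along the circle, so both germs start at
  \<open>f z\<close>, and both have the derivative as slope.
\<close>

lemma differentiable_glues_germs:
  assumes D: "circle_has_deriv f d z" and g: "affine_germ f z e w s" and "w \<noteq> 0" and e: "e \<in> {1,-1}"
  shows "w = f z" "s = d"
proof -
  have vd: "((\<lambda>u. f (z * circle_pt u)) has_vector_derivative (2 * pi * \<i> * d * f z)) (at 0)"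
    using D by (simp add: circle_has_deriv_def)
  then have "isCont (\<lambda>u. f (z * circle_pt u)) 0"
    by (rule has_vector_derivative_continuous)
  moreover have "((\<lambda>u. e * u) \<longlongrightarrow> 0) (at_right (0::real))"
    by (auto intro!: tendsto_eq_intros)
  ultimately have "((\<lambda>u. f (z * circle_pt (e * u))) \<longlongrightarrow> f (z * circle_pt 0)) (at_right 0)"
    by (rule isCont_tendsto_compose)
  then show w: "w = f z"
    using affine_germ_tendsto[OF g] by (intro tendsto_unique[of "at_right (0::real)"]) auto
  obtain \<delta> where \<delta>: "\<delta> > 0"
    "\<And>u. 0 < u \<Longrightarrow> u < \<delta> \<Longrightarrow> f (z * circle_pt (e * u)) = w * circle_pt (s * (e * u))"
    using g by (auto simp: affine_germ_def)
  have "((\<lambda>u. e * u) has_vector_derivative e) (at 0 within {0..<\<delta>})"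
    by (auto intro!: derivative_eq_intros)
  then have "((\<lambda>u. f (z * circle_pt u)) \<circ> (\<lambda>u. e * u) has_vector_derivative e *\<^sub>R (2 * pi * \<i> * d * f z)) (at 0 within {0..<\<delta>})"
    by (rule vector_diff_chain_within) (use vd in \<open>auto intro: has_vector_derivative_at_within\<close>)
  then have 1: "((\<lambda>u. f (z * circle_pt (e * u))) has_vector_derivative e *\<^sub>R (2 * pi * \<i> * d * f z)) (at 0 within {0..<\<delta>})"
    by (simp add: o_def)
  have "((\<lambda>u. w * circle_pt (s * e * u)) has_vector_derivative w * (2 * pi * \<i> * (s * e) * circle_pt (s * e * 0))) (at 0 within {0..<\<delta>})"
    by (rule has_vector_derivative_mult_right) (metis circle_pt_has_vector_derivative of_real_mult)
  then have 2: "((\<lambda>u. f (z * circle_pt (e * u))) has_vector_derivative w * (2 * pi * \<i> * (s * e) * circle_pt (s * e * 0))) (at 0 within {0..<\<delta>})"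
  proof (rule has_vector_derivative_transform[rotated 2])
    show "f (z * circle_pt (e * x)) = w * circle_pt (s * e * x)" if "x \<in> {0..<\<delta>}" for x
      using \<delta>(2)[of x] that w by (cases "x = 0") (auto simp: mult.assoc)
  qed (use \<delta> in auto)
  have "at 0 within {0..<\<delta>} = at_right 0"
    by (rule at_within_nhd[where S = "{-\<delta><..<\<delta>}"]) (use \<delta> in auto)
  then have "at 0 within {0..<\<delta>} \<noteq> bot" by simp
  then have "e *\<^sub>R (2 * pi * \<i> * d * f z) = w * (2 * pi * \<i> * (s * e) * circle_pt (s * e * 0))"
    using 1 2 by (rule vector_derivative_unique_within)
  then show "s = d" using e w \<open>w \<noteq> 0\<close> by auto
qed

section \<open>Finite subdivisions of the unit interval\<close>

text \<open>
  The right end of the cell that starts at \<open>t\<close>; the last cell ends at \<open>1\<close>, the angle \<open>0\<close> seen from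
  the left.
\<close>

definition next_pt :: "real set \<Rightarrow> real \<Rightarrow> real" where
  "next_pt B t = Min (insert 1 {y \<in> B. t < y})"

context
  fixes B :: "real set"
  assumes fin: "finite B" and sub: "B \<subseteq> {0..<1}" and zero: "0 \<in> B"
begin

lemma next_pt_props:
  assumes "t \<in> B"
  shows "t < next_pt B t" "next_pt B t \<le> 1" "next_pt B t \<in> insert 1 B"
    and "y \<in> B \<Longrightarrow> t < y \<Longrightarrow> next_pt B t \<le> y"
proof -
  let ?S = "insert 1 {y \<in> B. t < y}"
  have f: "finite ?S" using fin by simp
  have "next_pt B t \<in> ?S" unfolding next_pt_def using f by (intro Min_in) auto
  then show "t < next_pt B t" "next_pt B t \<in> insert 1 B" using assms sub by auto
  show "next_pt B t \<le> 1" "y \<in> B \<Longrightarrow> t < y \<Longrightarrow> next_pt B t \<le> y"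
    unfolding next_pt_def using f by (auto intro!: Min_le)
qed

lemma ex_cell:
  assumes "0 \<le> y" "y < 1"
  obtains t where "t \<in> B" "t \<le> y" "y < next_pt B t"
proof -
  let ?S = "{b \<in> B. b \<le> y}"
  have f: "finite ?S" "?S \<noteq> {}" using fin zero assms by auto
  define t where "t = Max ?S"
  have t: "t \<in> B" "t \<le> y" using Max_in[OF f] by (auto simp: t_def)
  have "y < next_pt B t"
  proof (rule ccontr)
    assume "\<not> y < next_pt B t"
    moreover from this have "next_pt B t \<in> B" using next_pt_props(3)[OF t(1)] assms by auto
    ultimately have "next_pt B t \<le> t" unfolding t_def using f by (intro Max_ge) auto
    then show False using next_pt_props(1)[OF t(1)] by simp
  qed
  then show thesis using t that by blast
qed

lemma bij_betw_next_pt: "bij_betw (next_pt B) B (insert 1 (B - {0}))"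
proof (rule bij_betw_imageI)
  have "next_pt B s \<noteq> next_pt B t" if "s \<in> B" "t \<in> B" "s < t" for s t
    using next_pt_props(4)[of s t] next_pt_props(1)[of t] that by auto
  then show "inj_on (next_pt B) B"
    by (metis inj_onI linorder_neq_iff)
  show "next_pt B ` B = insert 1 (B - {0})"
  proof
    show "next_pt B ` B \<subseteq> insert 1 (B - {0})"
      using next_pt_props(1,3) sub by (fastforce simp: subset_eq)
    show "insert 1 (B - {0}) \<subseteq> next_pt B ` B"
    proof
      fix y assume y: "y \<in> insert 1 (B - {0})"
      let ?S = "{b \<in> B. b < y}"
      have "0 < y" using y sub by (auto simp: order_less_le)
      then have f: "finite ?S" "?S \<noteq> {}" using fin zero by auto
      define t where "t = Max ?S"
      have t: "t \<in> B" "t < y" using Max_in[OF f] by (auto simp: t_def)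
      have "next_pt B t \<le> y" using y t next_pt_props(2,4)[OF t(1)] by auto
      moreover have "\<not> next_pt B t < y"
      proof
        assume less: "next_pt B t < y"
        then have "next_pt B t \<in> B" using next_pt_props(2,3)[OF t(1)] y sub by force
        then have "next_pt B t \<le> t" using less f unfolding t_def by (intro Max_ge) auto
        then show False using next_pt_props(1)[OF t(1)] by simp
      qed
      ultimately show "y \<in> next_pt B ` B" using t by force
    qed
  qed
qed

text \<open>
  The right ends of the cells are their left ends, with \<open>1\<close> in the place of \<open>0\<close>.
\<close>

lemma sum_next_pt:
  fixes g :: "real \<Rightarrow> 'a :: ab_group_add"
  assumes "g 1 = g 0"
  shows "(\<Sum>t\<in>B. g (next_pt B t)) = (\<Sum>t\<in>B. g t)"
proof -
  have "1 \<notin> B" using sub by auto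
  have "(\<Sum>t\<in>B. g (next_pt B t)) = (\<Sum>y\<in>insert 1 (B - {0}). g y)"
    by (rule sum.reindex_bij_betw[OF bij_betw_next_pt])
  also have "\<dots> = g 0 + (\<Sum>y\<in>B - {0}. g y)"
    using fin \<open>1 \<notin> B\<close> assms by simp
  also have "\<dots> = (\<Sum>t\<in>B. g t)"
    using fin zero by (metis sum.remove)
  finally show ?thesis .
qed

lemma sum_next_pt_diff: "(\<Sum>t\<in>B. next_pt B t - t) = 1"
proof -
  have "1 \<notin> B" using sub by auto
  have "(\<Sum>t\<in>B. next_pt B t) = (\<Sum>y\<in>insert 1 (B - {0}). y)"
    by (rule sum.reindex_bij_betw[OF bij_betw_next_pt, of "\<lambda>y. y"])
  also have "\<dots> = 1 + (\<Sum>y\<in>B. y)"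
    using fin zero \<open>1 \<notin> B\<close> by (simp add: sum_diff1)
  finally show ?thesis by (simp add: sum_subtractf)
qed

lemma disjoint_cells: "disjoint_family_on (\<lambda>t. {t..<next_pt B t}) B"
  unfolding disjoint_family_on_def
proof (intro ballI impI)
  fix s t assume st: "s \<in> B" "t \<in> B" "s \<noteq> t"
  then consider "s < t" | "t < s" by linarith
  then show "{s..<next_pt B s} \<inter> {t..<next_pt B t} = {}"
    using next_pt_props(4)[OF st(1), of t] next_pt_props(4)[OF st(2), of s] st by cases force+
qed

lemma measure_cells:
  assumes [measurable]: "M \<in> sets lborel"
  shows "measure lborel (M \<inter> {0..<1}) = (\<Sum>t\<in>B. measure lborel (M \<inter> {t<..<next_pt B t}))"
proof -
  have fm: "emeasure lborel (M \<inter> {a<..<b}) < \<infinity>" for a b :: real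
  proof -
    have "emeasure lborel (M \<inter> {a<..<b}) \<le> emeasure lborel {a..b}"
      by (intro emeasure_mono) auto
    also have "\<dots> < \<infinity>" by (rule emeasure_lborel_Icc_eq[THEN ord_eq_less_trans]) auto
    finally show ?thesis .
  qed
  have eq: "M \<inter> {0..<1} - B = (\<Union>t\<in>B. M \<inter> {t<..<next_pt B t})"
  proof (intro equalityI subsetI)
    fix y assume y: "y \<in> M \<inter> {0..<1} - B"
    then obtain t where "t \<in> B" "t \<le> y" "y < next_pt B t" using ex_cell[of y] by auto
    moreover from this have "t < y" using y by (cases "t = y") auto
    ultimately show "y \<in> (\<Union>t\<in>B. M \<inter> {t<..<next_pt B t})" using y by auto
  next
    fix y assume "y \<in> (\<Union>t\<in>B. M \<inter> {t<..<next_pt B t})"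
    then obtain t where t: "t \<in> B" "y \<in> M" "t < y" "y < next_pt B t" by auto
    then show "y \<in> M \<inter> {0..<1} - B"
      using next_pt_props(2,4)[OF t(1)] sub by force
  qed
  have "measure lborel (M \<inter> {0..<1}) = measure lborel (M \<inter> {0..<1} - B)"
    using fin by (intro measure_Diff_null_set[symmetric]) (auto intro: finite_imp_null_set_lborel)
  also have "\<dots> = (\<Sum>t\<in>B. measure lborel (M \<inter> {t<..<next_pt B t}))"
    unfolding eq
  proof (rule measure_finite_Union)
    show "disjoint_family_on (\<lambda>t. M \<inter> {t<..<next_pt B t}) B"
      using disjoint_cells unfolding disjoint_family_on_def by fastforce
  qed (use fin fm in \<open>auto simp: less_top\<close>)
  finally show ?thesis .
qed

end

text \<open>
  Each interval of length \<open>\<eta>\<close> of a grid that starts at \<open>a\<close> contains at most one point of \<open>K\<close>.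
\<close>

lemma separated_set_card:
  fixes K :: "real set"
  assumes "\<eta> > 0" "K \<subseteq> {a<..<b}" "\<And>x y. x \<in> K \<Longrightarrow> y \<in> K \<Longrightarrow> x \<noteq> y \<Longrightarrow> \<eta> \<le> \<bar>x - y\<bar>"
    and "a \<le> b"
  shows "finite K" "real (card K) \<le> 1 + (b - a) / \<eta>"
proof -
  define f where "f x = \<lfloor>(x - a) / \<eta>\<rfloor>" for x
  have inj: "inj_on f K"
  proof (rule inj_onI, rule ccontr)
    fix x y assume xy: "x \<in> K" "y \<in> K" "f x = f y" "x \<noteq> y"
    have "\<bar>(x - a) / \<eta> - (y - a) / \<eta>\<bar> < 1" using xy(3) unfolding f_def by linarith
    then have "\<bar>x - y\<bar> < \<eta>" using \<open>\<eta> > 0\<close> by (simp add: abs_divide flip: diff_divide_distrib)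
    then show False using assms(3)[OF xy(1,2,4)] by simp
  qed
  have im: "f ` K \<subseteq> {0..\<lfloor>(b - a) / \<eta>\<rfloor>}"
  proof (rule image_subsetI)
    fix x assume "x \<in> K"
    then have "a < x" "x < b" using assms(2) by auto
    then have "0 \<le> (x - a) / \<eta>" "(x - a) / \<eta> \<le> (b - a) / \<eta>"
      using \<open>\<eta> > 0\<close> by (auto intro!: divide_right_mono)
    then show "f x \<in> {0..\<lfloor>(b - a) / \<eta>\<rfloor>}" unfolding f_def by (auto intro: floor_mono)
  qed
  then show "finite K" using inj by (meson finite_atLeastAtMost_int finite_imageD finite_subset)
  have "card K = card (f ` K)" using inj by (simp add: card_image)
  also have "\<dots> \<le> card {0..\<lfloor>(b - a) / \<eta>\<rfloor>}" using im by (intro card_mono) auto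
  also have "\<dots> = nat (\<lfloor>(b - a) / \<eta>\<rfloor> + 1)" by simp
  finally have "real (card K) \<le> real (nat (\<lfloor>(b - a) / \<eta>\<rfloor> + 1))" by simp
  also have "\<dots> = of_int \<lfloor>(b - a) / \<eta>\<rfloor> + 1" using assms by simp
  also have "\<dots> \<le> (b - a) / \<eta> + 1" by linarith
  finally show "real (card K) \<le> 1 + (b - a) / \<eta>" by simp
qed

section \<open>Distribution functions of periodic sets\<close>

text \<open>
  The distribution function of Lebesgue measure restricted to \<open>P\<close>, normalised to vanish at \<open>0\<close>.
\<close>

definition set_cdf :: "real set \<Rightarrow> real \<Rightarrow> real" where
  "set_cdf P x = (if 0 \<le> x then measure lborel (P \<inter> {0..<x}) else - measure lborel (P \<inter> {x..<0}))"

lemma emeasure_Int_Ico_finite: "emeasure lborel (P \<inter> {a..<b::real}) \<noteq> \<infinity>"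
proof -
  have "emeasure lborel (P \<inter> {a..<b}) \<le> emeasure lborel {a..b}"
    by (intro emeasure_mono) auto
  also have "\<dots> < \<infinity>" by (rule emeasure_lborel_Icc_eq[THEN ord_eq_less_trans]) auto
  finally show ?thesis by simp
qed

lemma set_cdf_diff:
  assumes P: "P \<in> sets borel" and "x \<le> y"
  shows "set_cdf P y - set_cdf P x = measure lborel (P \<inter> {x..<y})"
proof -
  have split: "measure lborel (P \<inter> {a..<c}) = measure lborel (P \<inter> {a..<b}) + measure lborel (P \<inter> {b..<c})"
    if "a \<le> b" "b \<le> c" for a b c
  proof -
    have "P \<inter> {a..<c} = (P \<inter> {a..<b}) \<union> (P \<inter> {b..<c})" using that by auto
    also have "measure lborel \<dots> = measure lborel (P \<inter> {a..<b}) + measure lborel (P \<inter> {b..<c})"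
      using emeasure_Int_Ico_finite P by (intro measure_Union) (auto simp: less_top)
    finally show ?thesis .
  qed
  show ?thesis
    using split[of 0 x y] split[of x 0 y] split[of x y 0] \<open>x \<le> y\<close> by (auto simp: set_cdf_def)
qed

lemma measure_lborel_affine:
  assumes P: "P \<in> sets borel" and "s \<noteq> 0"
  shows "measure lborel {t::real. s * t + b \<in> P} = measure lborel P / \<bar>s\<bar>"
proof -
  have "emeasure lborel P = \<bar>s\<bar> * (\<integral>\<^sup>+t. indicator P (b + s * t) \<partial>lborel)"
    using P nn_integral_real_affine[of "indicator P" s b] \<open>s \<noteq> 0\<close> by (simp add: nn_integral_indicator)
  also have "(\<integral>\<^sup>+t. indicator P (b + s * t) \<partial>lborel) = (\<integral>\<^sup>+t. indicator {t. s * t + b \<in> P} t \<partial>lborel)"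
    by (auto intro!: nn_integral_cong simp: indicator_def add.commute)
  also have "\<dots> = emeasure lborel {t. s * t + b \<in> P}"
  proof -
    have "(\<lambda>t. s * t + b) -` P \<inter> space borel \<in> sets borel"
      by (intro measurable_sets[OF _ P]) simp
    then show ?thesis by (simp add: vimage_def)
  qed
  finally have "measure lborel P = \<bar>s\<bar> * measure lborel {t. s * t + b \<in> P}"
    by (simp add: measure_def enn2real_mult)
  then show ?thesis using \<open>s \<noteq> 0\<close> by simp
qed

lemma measure_affine_preimage:
  assumes P: "P \<in> sets borel" and "s \<noteq> 0" "u < v"
  shows "measure lborel {t \<in> {u<..<v}. s * t + b \<in> P} = (set_cdf P (s * v + b) - set_cdf P (s * u + b)) / s"
proof (cases "s > 0")
  case True
  have "{t \<in> {u<..<v}. s * t + b \<in> P} = {t. s * t + b \<in> P \<inter> {s * u + b<..<s * v + b}}"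
    using True by auto
  then have "measure lborel {t \<in> {u<..<v}. s * t + b \<in> P} = measure lborel (P \<inter> {s * u + b<..<s * v + b}) / s"
    using measure_lborel_affine[of "P \<inter> {s * u + b<..<s * v + b}" s b] P True by simp
  also have "measure lborel (P \<inter> {s * u + b<..<s * v + b}) = measure lborel (P \<inter> {s * u + b..<s * v + b} - {s * u + b})"
    by (rule arg_cong[where f = "measure lborel"]) auto
  also have "\<dots> = measure lborel (P \<inter> {s * u + b..<s * v + b})"
    using P by (intro measure_Diff_null_set) auto
  finally show ?thesis using set_cdf_diff[OF P, of "s * u + b" "s * v + b"] True \<open>u < v\<close> by simp
next
  case False
  then have s: "s < 0" using \<open>s \<noteq> 0\<close> by simp
  have "{t \<in> {u<..<v}. s * t + b \<in> P} = {t. s * t + b \<in> P \<inter> {s * v + b<..<s * u + b}}"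
    using s by auto
  then have "measure lborel {t \<in> {u<..<v}. s * t + b \<in> P} = measure lborel (P \<inter> {s * v + b<..<s * u + b}) / - s"
    using measure_lborel_affine[of "P \<inter> {s * v + b<..<s * u + b}" s b] P s by simp
  also have "measure lborel (P \<inter> {s * v + b<..<s * u + b}) = measure lborel (P \<inter> {s * v + b..<s * u + b} - {s * v + b})"
    by (rule arg_cong[where f = "measure lborel"]) auto
  also have "\<dots> = measure lborel (P \<inter> {s * v + b..<s * u + b})"
    using P by (intro measure_Diff_null_set) auto
  finally show ?thesis using set_cdf_diff[OF P, of "s * v + b" "s * u + b"] s \<open>u < v\<close>
    by (simp add: field_simps)
qed

lemma set_cdf_add_int:
  assumes P: "P \<in> sets borel" and per: "\<And>x. x + 1 \<in> P \<longleftrightarrow> x \<in> P"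
  shows "set_cdf P (x + of_int k) = set_cdf P x + of_int k * set_cdf P 1"
proof -
  have shift: "measure lborel (P \<inter> {x + 1..<y + 1}) = measure lborel (P \<inter> {x..<y})" for x y
  proof -
    have "P \<inter> {x..<y} = {t. 1 * t + 1 \<in> P \<inter> {x + 1..<y + 1}}" using per by auto
    then show ?thesis using measure_lborel_affine[of "P \<inter> {x + 1..<y + 1}" 1 1] P by simp
  qed
  have step: "set_cdf P (x + 1) = set_cdf P x + set_cdf P 1" for x
  proof (cases "0 \<le> x")
    case True
    then show ?thesis
      using set_cdf_diff[OF P, of 1 "x + 1"] set_cdf_diff[OF P, of 0 x] shift[of 0 x]
      by (simp add: set_cdf_def)
  next
    case False
    then show ?thesis
      using set_cdf_diff[OF P, of "x + 1" 1] set_cdf_diff[OF P, of x 0] shift[of x 0]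
      by (simp add: set_cdf_def)
  qed
  have nat: "set_cdf P (x + of_nat n) = set_cdf P x + of_nat n * set_cdf P 1" for x n
  proof (induction n)
    case (Suc n)
    then show ?case using step[of "x + of_nat n"] by (simp add: algebra_simps)
  qed simp
  show ?thesis
  proof (cases "k \<ge> 0")
    case True
    then show ?thesis using nat[of x "nat k"] by simp
  next
    case False
    then show ?thesis using nat[of "x + of_int k" "nat (- k)"] by (simp add: algebra_simps)
  qed
qed

section \<open>The germ dynamics of a piecewise affine map\<close>

lemma affine_germ_of_interval:
  assumes f: "\<And>t. u < t \<Longrightarrow> t < v \<Longrightarrow> f (circle_pt t) = circle_pt (s * t + b)"
    and t: "e = 1 \<and> u \<le> t \<and> t < v \<or> e = -1 \<and> u < t \<and> t \<le> v"
  shows "affine_germ f (circle_pt t) e (circle_pt (s * t + b)) s"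
  unfolding affine_germ_def
proof (intro exI conjI allI impI)
  show "(if e = 1 then v - t else t - u) > 0" using t by auto
  fix r assume r: "0 < r" "r < (if e = 1 then v - t else t - u)"
  then have "f (circle_pt (t + e * r)) = circle_pt (s * (t + e * r) + b)"
    using t by (intro f) (auto split: if_splits)
  also have "s * (t + e * r) + b = (s * t + b) + s * (e * r)" by (simp add: algebra_simps)
  finally show "f (circle_pt t * circle_pt (e * r)) = circle_pt (s * t + b) * circle_pt (s * (e * r))"
    by (simp add: circle_pt_add)
qed

text \<open>
  An affine map of slope \<open>s\<close> shrinks the separation \<open>\<eta>\<close> of the target angles to
  \<open>\<eta> / \<bar>s\<bar>\<close>.
\<close>

lemma card_affine_preimage:
  assumes f: "\<And>t. u < t \<Longrightarrow> t < v \<Longrightarrow> f (circle_pt t) = circle_pt (s * t + b)" and "s \<noteq> 0" "u < v"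
    and "\<eta> > 0" and sep: "\<And>x y. circle_pt x \<in> A \<Longrightarrow> circle_pt y \<in> A \<Longrightarrow> x \<noteq> y \<Longrightarrow> \<eta> \<le> \<bar>x - y\<bar>"
  shows "finite {t \<in> {u<..<v}. f (circle_pt t) \<in> A}" (is "finite ?K")
    and "real (card {t \<in> {u<..<v}. f (circle_pt t) \<in> A}) \<le> 1 + (v - u) * \<bar>s\<bar> / \<eta>"
proof -
  have K: "\<eta> / \<bar>s\<bar> \<le> \<bar>x - y\<bar>" if "x \<in> ?K" "y \<in> ?K" "x \<noteq> y" for x y
  proof -
    have "\<eta> \<le> \<bar>(s * x + b) - (s * y + b)\<bar>"
      using that f \<open>s \<noteq> 0\<close> by (intro sep) auto
    also have "\<dots> = \<bar>s\<bar> * \<bar>x - y\<bar>" by (simp add: abs_mult flip: right_diff_distrib)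
    finally show ?thesis using \<open>s \<noteq> 0\<close> by (simp add: field_simps)
  qed
  have "?K \<subseteq> {u<..<v}" "\<eta> / \<bar>s\<bar> > 0" "u \<le> v"
    using \<open>s \<noteq> 0\<close> \<open>\<eta> > 0\<close> \<open>u < v\<close> by auto
  then have "finite ?K" "real (card ?K) \<le> 1 + (v - u) / (\<eta> / \<bar>s\<bar>)"
    using separated_set_card[of "\<eta> / \<bar>s\<bar>" ?K u v] K by blast+
  then show "finite ?K" "real (card ?K) \<le> 1 + (v - u) * \<bar>s\<bar> / \<eta>" by auto
qed

abbreviation germs :: "(complex \<times> real) set" where
  "germs \<equiv> S1 \<times> {1, -1}"

text \<open>
  Piecewise affinity and eventual expansion in working form. The finite set \<open>A\<close> cuts the circle into arcs of affinity;
  \<open>1 \<in> A\<close> makes the angle \<open>0\<close> a subdivision point, so that each cell is an interval of angles in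
  \<open>[0,1]\<close>. All slopes are at least \<open>\<sigma>\<close> in modulus, and those of the \<open>m\<close>-th iterate at least \<open>\<Lambda>\<close>.
\<close>

locale affine_circle_map =
  fixes T :: "complex \<Rightarrow> complex" and A :: "complex set" and \<sigma> \<Lambda> :: real and m :: nat
  assumes T_S1: "T \<in> S1 \<rightarrow> S1"
    and finite_A: "finite A" and one_in_A: "1 \<in> A"
    and \<sigma>_pos: "\<sigma> > 0"
    and affine: "u < v \<Longrightarrow> (\<And>t. u < t \<Longrightarrow> t < v \<Longrightarrow> circle_pt t \<notin> A) \<Longrightarrow>
       \<exists>s b. \<sigma> \<le> \<bar>s\<bar> \<and> (\<forall>t. u < t \<longrightarrow> t < v \<longrightarrow> T (circle_pt t) = circle_pt (s * t + b))"
    and m_pos: "m > 0" and \<Lambda>_gt_1: "\<Lambda> > 1"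
    and expanding: "z \<in> S1 \<Longrightarrow> e \<in> {1, -1} \<Longrightarrow> w \<in> S1 \<Longrightarrow> affine_germ (T ^^ m) z e w s \<Longrightarrow> \<Lambda> \<le> \<bar>s\<bar>"
begin

lemma T_in_S1: "z \<in> S1 \<Longrightarrow> T z \<in> S1"
  using T_S1 by auto

lemma iterate_in_S1: "z \<in> S1 \<Longrightarrow> (T ^^ n) z \<in> S1"
  by (induction n) (use T_in_S1 in auto)

lemma ex_germ:
  assumes "g \<in> germs"
  shows "\<exists>p. fst p \<in> S1 \<and> \<sigma> \<le> \<bar>snd p\<bar> \<and> affine_germ T (fst g) (snd g) (fst p) (snd p)"
proof -
  obtain z e where g: "g = (z, e)" "z \<in> S1" "e = 1 \<or> e = -1" using assms by auto
  obtain t where t: "circle_pt t = z" using circle_ptE g(2) by metis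
  obtain \<delta> where \<delta>: "\<delta> > 0" "\<And>x. 0 < \<bar>x - t\<bar> \<Longrightarrow> \<bar>x - t\<bar> < \<delta> \<Longrightarrow> circle_pt x \<notin> A"
    using finite_angles_isolated[OF finite_A, of t] by blast
  define u v where "u = (if e = 1 then t else t - \<delta>)" and "v = (if e = 1 then t + \<delta> else t)"
  have "u < v" using \<delta> by (auto simp: u_def v_def)
  moreover have "circle_pt x \<notin> A" if "u < x" "x < v" for x
    using that \<delta> by (auto simp: u_def v_def split: if_splits)
  ultimately obtain s b where sb: "\<sigma> \<le> \<bar>s\<bar>"
    "\<And>x. u < x \<Longrightarrow> x < v \<Longrightarrow> T (circle_pt x) = circle_pt (s * x + b)"
    using affine by metis
  have "affine_germ T (circle_pt t) e (circle_pt (s * t + b)) s"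
    using sb(2) \<delta>(1) g(3) by (intro affine_germ_of_interval[of u v]) (auto simp: u_def v_def)
  then show ?thesis
    using sb(1) g t by (intro exI[of _ "(circle_pt (s * t + b), s)"]) auto
qed

text \<open>
  The one-sided limit and the slope of \<open>T\<close> at a germ (point and side). They are unique by
  \<open>affine_germ_unique\<close>. The map on germs that they induce makes every germ have a
  well-defined orbit, whatever break points the orbit hits.
\<close>

definition germ_data :: "complex \<times> real \<Rightarrow> complex \<times> real" where
  "germ_data g = (SOME p. fst p \<in> S1 \<and> \<sigma> \<le> \<bar>snd p\<bar> \<and> affine_germ T (fst g) (snd g) (fst p) (snd p))"

definition germ_map :: "complex \<times> real \<Rightarrow> complex \<times> real" where
  "germ_map g = (fst (germ_data g), snd g * sgn (snd (germ_data g)))"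

definition slope :: "nat \<Rightarrow> complex \<times> real \<Rightarrow> real" where
  "slope n g = (\<Prod>i<n. snd (germ_data ((germ_map ^^ i) g)))"

definition weight :: "nat \<Rightarrow> complex \<times> real \<Rightarrow> real" where
  "weight n g = 1 / \<bar>slope n g\<bar>"

lemma germ_data:
  assumes "g \<in> germs"
  shows "fst (germ_data g) \<in> S1" "\<sigma> \<le> \<bar>snd (germ_data g)\<bar>"
    "affine_germ T (fst g) (snd g) (fst (germ_data g)) (snd (germ_data g))"
  unfolding germ_data_def using someI_ex[OF ex_germ[OF assms]] by blast+

lemma germ_map_in_germs: "g \<in> germs \<Longrightarrow> germ_map g \<in> germs"
  using germ_data[of g] \<sigma>_pos by (auto simp: germ_map_def sgn_if)

lemma germ_iterate_in_germs: "g \<in> germs \<Longrightarrow> (germ_map ^^ n) g \<in> germs"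
  by (induction n) (simp_all only: funpow.simps id_apply o_apply germ_map_in_germs)

lemma slope_nonzero: "slope n g \<noteq> 0" if "g \<in> germs"
proof -
  have "snd (germ_data ((germ_map ^^ i) g)) \<noteq> 0" for i
    using germ_data(2)[OF germ_iterate_in_germs[OF that, of i]] \<sigma>_pos by auto
  then show ?thesis by (simp add: slope_def)
qed

lemma slope_add: "slope (j + k) g = slope j g * slope k ((germ_map ^^ j) g)"
proof (induction k)
  case (Suc k)
  have "(germ_map ^^ (j + k)) g = (germ_map ^^ k) ((germ_map ^^ j) g)"
    by (simp add: add.commute[of j k] funpow_add)
  then show ?case using Suc by (simp add: slope_def)
qed (simp add: slope_def)

lemma weight_add: "weight (j + k) g = weight j g * weight k ((germ_map ^^ j) g)"
  by (simp add: weight_def slope_add abs_mult)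

lemma weight_0 [simp]: "weight 0 g = 1"
  by (simp add: weight_def slope_def)

lemma weight_nonneg: "weight n g \<ge> 0"
  by (simp add: weight_def)

text \<open>
  The orbit of a germ \<open>(z, e)\<close> under \<open>germ_map\<close> is the one-sided orbit of \<open>z\<close>, and the side follows
  the sign of the derivative.
\<close>

lemma germ_iterate:
  assumes "g \<in> germs"
  shows "affine_germ (T ^^ n) (fst g) (snd g) (fst ((germ_map ^^ n) g)) (slope n g) \<and>
         snd ((germ_map ^^ n) g) = snd g * sgn (slope n g)"
proof (induction n)
  case 0
  show ?case by (auto simp: affine_germ_def slope_def intro!: exI[of _ 1])
next
  case (Suc n)
  let ?h = "(germ_map ^^ n) g"
  have h: "?h \<in> germs" using assms by (rule germ_iterate_in_germs)
  have sl: "slope (Suc n) g = snd (germ_data ?h) * slope n g" by (simp add: slope_def mult.commute)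
  have "affine_germ (T \<circ> (T ^^ n)) (fst g) (snd g) (fst (germ_data ?h)) (snd (germ_data ?h) * slope n g)"
    using Suc germ_data(3)[OF h] slope_nonzero[OF assms]
    by (intro affine_germ_compose[of _ _ _ "fst ?h"]) auto
  moreover have "fst ((germ_map ^^ Suc n) g) = fst (germ_data ?h)"
    and "snd ((germ_map ^^ Suc n) g) = snd ?h * sgn (snd (germ_data ?h))"
    by (simp_all add: germ_map_def[of ?h])
  ultimately show ?case
    using Suc by (simp add: sl sgn_mult mult_ac o_def)
qed

lemma germ_iterate_eqI:
  assumes "(z, e) \<in> germs" "affine_germ (T ^^ n) z e w s" "w \<in> S1"
  shows "(germ_map ^^ n) (z, e) = (w, e * sgn s)" "slope n (z, e) = s"
proof -
  have *: "affine_germ (T ^^ n) z e (fst ((germ_map ^^ n) (z,e))) (slope n (z,e))"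
    "snd ((germ_map ^^ n) (z,e)) = e * sgn (slope n (z,e))"
    using germ_iterate[OF assms(1), of n] by auto
  have "w \<noteq> 0" "e \<noteq> 0" using assms by auto
  then have "fst ((germ_map ^^ n) (z,e)) = w" "slope n (z,e) = s"
    using affine_germ_unique[OF assms(2) *(1)] by auto
  then show "(germ_map ^^ n) (z, e) = (w, e * sgn s)" "slope n (z, e) = s"
    using *(2) by (auto simp: prod_eq_iff)
qed

text \<open>
  Blocks of \<open>m\<close> steps contract weights by \<open>1 / \<Lambda>\<close>; the fewer than \<open>m\<close> remaining steps cost a bounded
  factor, as all slopes are at least \<open>\<sigma>\<close> in modulus.
\<close>

lemma weight_geometric:
  "\<exists>C \<theta>. 0 < \<theta> \<and> \<theta> < 1 \<and> 0 < C \<and> (\<forall>n. \<forall>g\<in>germs. weight n g \<le> C * \<theta> ^ n)"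
proof -
  define \<theta> where "\<theta> = root m (1 / \<Lambda>)"
  have \<theta>: "0 < \<theta>" "\<theta> < 1" "\<theta> ^ m = 1 / \<Lambda>"
    using m_pos \<Lambda>_gt_1 by (auto simp: \<theta>_def)
  \<comment> \<open>A single step multiplies weights by at most \<open>1 / \<sigma> \<le> b * \<theta>\<close>.\<close>
  define b where "b = max 1 (1 / (\<sigma> * \<theta>))"
  define C where "C = b ^ m"
  have b: "b \<ge> 1" "1 / \<sigma> \<le> b * \<theta>" using \<theta> \<sigma>_pos by (auto simp: b_def field_simps max_def)
  have small: "weight n g \<le> (b * \<theta>) ^ n" if "g \<in> germs" for n g
    using that
  proof (induction n arbitrary: g)
    case (Suc n)
    have "weight 1 g \<le> 1 / \<sigma>"
      using germ_data(2)[OF Suc.prems] \<sigma>_pos by (simp add: weight_def slope_def frac_le)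
    then have "weight 1 g * weight n (germ_map g) \<le> (b * \<theta>) * (b * \<theta>) ^ n"
      using Suc.IH[OF germ_map_in_germs[OF Suc.prems]] b weight_nonneg \<theta> by (intro mult_mono) auto
    then show ?case using weight_add[of 1 n g] by simp
  qed simp
  have "weight n g \<le> C * \<theta> ^ n" if "g \<in> germs" for n g
    using that
  proof (induction n arbitrary: g rule: less_induct)
    case (less n)
    show ?case
    proof (cases "n < m")
      case True
      have "b ^ n \<le> C" unfolding C_def using b True by (intro power_increasing) auto
      then have "b ^ n * \<theta> ^ n \<le> C * \<theta> ^ n" using \<theta> by (intro mult_right_mono) auto
      then show ?thesis using small[OF less.prems, of n] by (simp add: power_mult_distrib)
    next
      case False
      let ?h = "(germ_map ^^ m) g"
      have h: "?h \<in> germs" using germ_iterate_in_germs[OF less.prems] .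
      have "\<Lambda> \<le> \<bar>slope m g\<bar>"
        using germ_iterate[OF less.prems, of m] less.prems h
        by (intro expanding[of "fst g" "snd g" "fst ?h"]) (auto simp: mem_Times_iff)
      then have "weight m g \<le> \<theta> ^ m"
        using \<theta> \<Lambda>_gt_1 by (simp add: weight_def frac_le)
      moreover have "weight (n - m) ?h \<le> C * \<theta> ^ (n - m)"
        using less.IH[OF _ h] m_pos False by simp
      ultimately have "weight m g * weight (n - m) ?h \<le> \<theta> ^ m * (C * \<theta> ^ (n - m))"
        using weight_nonneg \<theta>(1) by (intro mult_mono zero_le_power) auto
      also have "\<theta> ^ m * (C * \<theta> ^ (n - m)) = C * \<theta> ^ n"
        using False by (simp add: mult.left_commute flip: power_add)
      finally show ?thesis using weight_add[of m "n - m" g] False by simp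
    qed
  qed
  moreover have "C > 0" using b by (simp add: C_def)
  ultimately show ?thesis using \<theta> by blast
qed

text \<open>
  Including the time \<open>k = n\<close> makes even \<open>T^(n+1)\<close> affine on the cells, and gives
  \<open>breaks (n + q) = breaks n \<union> T^-n (breaks q)\<close> on the circle.
\<close>

definition breaks :: "nat \<Rightarrow> complex set" where
  "breaks n = {z \<in> S1. \<exists>k\<le>n. (T ^^ k) z \<in> A}"

definition break_angles :: "nat \<Rightarrow> real set" where
  "break_angles n = {t \<in> {0..<1}. circle_pt t \<in> breaks n}"

lemma breaks_mono: "n \<le> n' \<Longrightarrow> breaks n \<subseteq> breaks n'"
  unfolding breaks_def by (blast intro: order_trans)

lemma affine_iterate:
  assumes "u < v" "\<And>t. u < t \<Longrightarrow> t < v \<Longrightarrow> circle_pt t \<notin> breaks n" "k \<le> Suc n"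
  shows "\<exists>s b. s \<noteq> 0 \<and> (\<forall>t. u < t \<longrightarrow> t < v \<longrightarrow> (T ^^ k) (circle_pt t) = circle_pt (s * t + b))"
  using assms(3)
proof (induction k)
  case 0
  show ?case by (intro exI[of _ 1] exI[of _ 0]) auto
next
  case (Suc j)
  then obtain s b where s: "s \<noteq> 0"
    and sb: "\<And>t. u < t \<Longrightarrow> t < v \<Longrightarrow> (T ^^ j) (circle_pt t) = circle_pt (s * t + b)" by auto
  define u' v' where "u' = min (s * u + b) (s * v + b)" and "v' = max (s * u + b) (s * v + b)"
  have in': "u' < s * t + b" "s * t + b < v'" if "u < t" "t < v" for t
    using that s \<open>u < v\<close> by (auto simp: u'_def v'_def min_less_iff_disj less_max_iff_disj neq_iff)
  have avoid: "circle_pt x \<notin> A" if x: "u' < x" "x < v'" for x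
  proof -
    define t where "t = (x - b) / s"
    have xt: "x = s * t + b" using s by (simp add: t_def)
    have t: "u < t \<and> t < v"
      using x s \<open>u < v\<close> unfolding xt by (cases "s > 0") (auto simp: u'_def v'_def min_def max_def split: if_splits)
    then have "(T ^^ j) (circle_pt t) \<notin> A"
      using assms(2)[of t] Suc.prems by (auto simp: breaks_def)
    then show ?thesis using sb[of t] t xt by simp
  qed
  have "u' < v'" using in'[of "(u + v) / 2"] \<open>u < v\<close> by auto
  then obtain s' b' where s': "\<sigma> \<le> \<bar>s'\<bar>"
    "\<And>x. u' < x \<Longrightarrow> x < v' \<Longrightarrow> T (circle_pt x) = circle_pt (s' * x + b')"
    using affine[of u' v'] avoid by blast
  show ?case
  proof (intro exI conjI allI impI)
    show "s' * s \<noteq> 0" using s s' \<sigma>_pos by auto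
    fix t assume t: "u < t" "t < v"
    show "(T ^^ Suc j) (circle_pt t) = circle_pt (s' * s * t + (s' * b + b'))"
      using sb[OF t] s'(2)[OF in'[OF t]] by (simp add: algebra_simps)
  qed
qed

definition affine_cell :: "nat \<Rightarrow> real \<Rightarrow> real \<Rightarrow> real \<Rightarrow> real \<Rightarrow> bool" where
  "affine_cell k u v s b \<longleftrightarrow> s \<noteq> 0 \<and>
     (\<forall>t\<in>{u<..<v}. (T ^^ k) (circle_pt t) = circle_pt (s * t + b)) \<and>
     (\<forall>t\<in>{u..<v}. slope k (circle_pt t, 1) = s \<and> (germ_map ^^ k) (circle_pt t, 1) = (circle_pt (s * t + b), sgn s)) \<and>
     (\<forall>t\<in>{u<..v}. slope k (circle_pt t, -1) = s \<and> (germ_map ^^ k) (circle_pt t, -1) = (circle_pt (s * t + b), - sgn s))"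

lemma affine_cellD:
  assumes "affine_cell k u v s b"
  shows "s \<noteq> 0" "u < t \<Longrightarrow> t < v \<Longrightarrow> (T ^^ k) (circle_pt t) = circle_pt (s * t + b)"
    and "u \<le> t \<Longrightarrow> t < v \<Longrightarrow> slope k (circle_pt t, 1) = s"
    and "u \<le> t \<Longrightarrow> t < v \<Longrightarrow> (germ_map ^^ k) (circle_pt t, 1) = (circle_pt (s * t + b), sgn s)"
    and "u < t \<Longrightarrow> t \<le> v \<Longrightarrow> slope k (circle_pt t, -1) = s"
    and "u < t \<Longrightarrow> t \<le> v \<Longrightarrow> (germ_map ^^ k) (circle_pt t, -1) = (circle_pt (s * t + b), - sgn s)"
  using assms by (auto simp: affine_cell_def)

text \<open>
  One formula serves the interior of a cell and the two germs at its ends that point inwards; the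
  latter is what lets sums over cells be regrouped into sums over end points.
\<close>

lemma ex_affine_cell:
  assumes "u < v" "\<And>t. u < t \<Longrightarrow> t < v \<Longrightarrow> circle_pt t \<notin> breaks n" "k \<le> Suc n"
  obtains s b where "affine_cell k u v s b"
proof -
  obtain s b where sb: "s \<noteq> 0" "\<And>t. u < t \<Longrightarrow> t < v \<Longrightarrow> (T ^^ k) (circle_pt t) = circle_pt (s * t + b)"
    using affine_iterate[OF assms] by blast
  have germ: "slope k (circle_pt t, e) = s \<and> (germ_map ^^ k) (circle_pt t, e) = (circle_pt (s * t + b), e * sgn s)"
    if te: "e = 1 \<and> u \<le> t \<and> t < v \<or> e = -1 \<and> u < t \<and> t \<le> v" for t e
  proof -
    have "affine_germ (T ^^ k) (circle_pt t) e (circle_pt (s * t + b)) s"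
      using sb(2) te by (rule affine_germ_of_interval)
    then show ?thesis
      using te by (intro conjI germ_iterate_eqI) auto
  qed
  have "affine_cell k u v s b"
    using sb germ[of 1] germ[of "-1"] unfolding affine_cell_def by auto
  then show thesis by (rule that)
qed

lemma break_angles_0: "0 \<in> break_angles n"
  using one_in_A by (auto simp: break_angles_def breaks_def)

lemma break_angles_subset: "break_angles n \<subseteq> {0..<1}"
  by (auto simp: break_angles_def)

lemma cell_avoids_if_finite:
  assumes "finite (break_angles n)" "t \<in> break_angles n" "t < x" "x < next_pt (break_angles n) t"
  shows "circle_pt x \<notin> breaks n"
proof
  assume *: "circle_pt x \<in> breaks n"
  note np = next_pt_props[OF assms(1) break_angles_subset break_angles_0 assms(2)]
  have "x \<in> break_angles n"
    using * np(2) assms break_angles_subset[of n] by (auto simp: break_angles_def)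
  then show False using np(4)[of x] assms by auto
qed

text \<open>
  On a cell the next iterate is affine with non-zero slope, so it meets the finite set \<open>A\<close> finitely
  often.
\<close>

lemma finite_break_angles: "finite (break_angles n)"
proof (induction n)
  case 0
  have "finite (circle_pt -` A \<inter> {0..<1})"
    by (rule finite_vimage_IntI[OF finite_A inj_on_circle_pt])
  then show ?case by (rule rev_finite_subset) (auto simp: break_angles_def breaks_def)
next
  case (Suc n)
  note next_pt_fact = next_pt_props[OF Suc break_angles_subset break_angles_0]
  obtain \<eta> where \<eta>: "\<eta> > 0" "\<And>x y. circle_pt x \<in> A \<Longrightarrow> circle_pt y \<in> A \<Longrightarrow> x \<noteq> y \<Longrightarrow> \<eta> \<le> \<bar>x - y\<bar>"
    using finite_angles_separated[OF finite_A] by blast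
  define K where "K t = {x \<in> {t<..<next_pt (break_angles n) t}. (T ^^ Suc n) (circle_pt x) \<in> A}" for t
  have "finite (K t)" if t: "t \<in> break_angles n" for t
  proof -
    obtain s b where "s \<noteq> 0" "\<And>x. t < x \<Longrightarrow> x < next_pt (break_angles n) t \<Longrightarrow>
        (T ^^ Suc n) (circle_pt x) = circle_pt (s * x + b)"
      using affine_iterate[OF next_pt_fact(1)[OF t] cell_avoids_if_finite[OF Suc t], of "Suc n"] by auto
    then show ?thesis unfolding K_def
      using next_pt_fact(1)[OF t] \<eta> by (intro card_affine_preimage(1)[of t _ _ s b \<eta>]) auto
  qed
  then have "finite (break_angles n \<union> (\<Union>t\<in>break_angles n. K t))" using Suc by auto
  moreover have "break_angles (Suc n) \<subseteq> break_angles n \<union> (\<Union>t\<in>break_angles n. K t)"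
  proof
    fix x assume x: "x \<in> break_angles (Suc n)"
    then obtain t where t: "t \<in> break_angles n" "t \<le> x" "x < next_pt (break_angles n) t"
      using ex_cell[OF Suc break_angles_subset break_angles_0, of x] by (auto simp: break_angles_def)
    show "x \<in> break_angles n \<union> (\<Union>t\<in>break_angles n. K t)"
    proof (cases "x \<in> break_angles n")
      case False
      then have "t < x" using t by (cases "t = x") auto
      have "\<not> (\<exists>k\<le>n. (T ^^ k) (circle_pt x) \<in> A)" "\<exists>k\<le>Suc n. (T ^^ k) (circle_pt x) \<in> A"
        using x False by (auto simp: break_angles_def breaks_def)
      then have "(T ^^ Suc n) (circle_pt x) \<in> A" by (metis le_Suc_eq)
      then have "x \<in> K t" using t \<open>t < x\<close> by (simp add: K_def)
      then show ?thesis using t by blast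
    qed auto
  qed
  ultimately show ?case by (rule rev_finite_subset)
qed

lemmas cell_props = next_pt_props[OF finite_break_angles break_angles_subset break_angles_0]
lemmas cell_avoids_breaks = cell_avoids_if_finite[OF finite_break_angles]
lemmas sum_break_angles_next = sum_next_pt[OF finite_break_angles break_angles_subset break_angles_0]

lemma finite_breaks: "finite (breaks n)"
proof -
  have "breaks n \<subseteq> circle_pt ` break_angles n"
  proof
    fix z assume z: "z \<in> breaks n"
    then obtain t where "0 \<le> t" "t < 1" "circle_pt t = z"
      using circle_ptE[of z] by (auto simp: breaks_def)
    then show "z \<in> circle_pt ` break_angles n" using z by (force simp: break_angles_def)
  qed
  then show ?thesis using finite_break_angles finite_surj by blast
qed

section \<open>A Lasota--Yorke estimate\<close>

definition total_weight :: "nat \<Rightarrow> real" where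
  "total_weight n = (\<Sum>t\<in>break_angles n. weight n (circle_pt t, 1))"

text \<open>
  The slope is the same at the two ends of a cell.
\<close>

lemma total_weight_left: "(\<Sum>t\<in>break_angles n. weight n (circle_pt t, -1)) = total_weight n"
proof -
  let ?N = "next_pt (break_angles n)"
  have "(\<Sum>t\<in>break_angles n. weight n (circle_pt t, -1)) = (\<Sum>t\<in>break_angles n. weight n (circle_pt (?N t), -1))"
    by (rule sum_break_angles_next[symmetric]) simp
  also have "\<dots> = total_weight n"
    unfolding total_weight_def
  proof (rule sum.cong)
    fix t assume t: "t \<in> break_angles n"
    obtain s b where cell: "affine_cell n t (?N t) s b"
      using ex_affine_cell[OF cell_props(1)[OF t] cell_avoids_breaks[OF t] le_SucI[OF order_refl]] by blast
    show "weight n (circle_pt (?N t), -1) = weight n (circle_pt t, 1)"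
      using cell_props(1)[OF t] affine_cellD(3,5)[OF cell] by (simp add: weight_def)
  qed simp
  finally show ?thesis .
qed

text \<open>
  The new break points inside a cell of \<open>T^n\<close> are preimages of \<open>breaks q\<close> under an affine map of slope \<open>s\<close>. There
  are at most \<open>1 + length * \<bar>s\<bar> / \<eta>\<close> of them, and each, like the left end of the cell,
  has weight \<open>1 / \<bar>s\<bar>\<close> under \<open>T^n\<close>. So the cell contributes at most \<open>2 / \<bar>s\<bar> + length / \<eta>\<close> before the factor
  \<open>1/4\<close> gained from the last \<open>q\<close> steps; the first term gives half of the old total weight, and the lengths add up to \<open>1\<close>.
\<close>

lemma total_weight_recursion:
  assumes q: "\<And>g. g \<in> germs \<Longrightarrow> weight q g \<le> 1 / 4"
    and "\<eta> > 0" and sep: "\<And>x y. circle_pt x \<in> breaks q \<Longrightarrow> circle_pt y \<in> breaks q \<Longrightarrow> x \<noteq> y \<Longrightarrow> \<eta> \<le> \<bar>x - y\<bar>"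
  shows "total_weight (n + q) \<le> total_weight n / 2 + 1 / (4 * \<eta>)"
proof -
  let ?B = "break_angles n" and ?B' = "break_angles (n + q)"
  let ?N = "next_pt ?B"
  let ?w = "\<lambda>x. weight n (circle_pt x, 1)"
  have "total_weight (n + q) \<le> (\<Sum>x\<in>?B'. ?w x * (1 / 4))"
    unfolding total_weight_def weight_add
    by (intro sum_mono mult_left_mono q germ_iterate_in_germs weight_nonneg) auto
  also have "\<dots> = (\<Sum>x\<in>?B'. ?w x) / 4" by (simp add: sum_divide_distrib)
  also have "(\<Sum>x\<in>?B'. ?w x) = (\<Sum>x\<in>(\<Union>t\<in>?B. ?B' \<inter> {t..<?N t}). ?w x)"
  proof (rule sum.cong)
    show "?B' = (\<Union>t\<in>?B. ?B' \<inter> {t..<?N t})"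
    proof (intro equalityI subsetI)
      fix x assume x: "x \<in> ?B'"
      then have "0 \<le> x" "x < 1" using break_angles_subset[of "n + q"] by auto
      then obtain t where "t \<in> ?B" "t \<le> x" "x < ?N t"
        using ex_cell[OF finite_break_angles break_angles_subset break_angles_0, of x n] by blast
      then show "x \<in> (\<Union>t\<in>?B. ?B' \<inter> {t..<?N t})" using x by auto
    qed auto
  qed simp
  also have "\<dots> = (\<Sum>t\<in>?B. \<Sum>x\<in>?B' \<inter> {t..<?N t}. ?w x)"
  proof (intro sum.UNION_disjoint ballI impI)
    fix t t' assume "t \<in> ?B" "t' \<in> ?B" "t \<noteq> t'"
    then have "{t..<?N t} \<inter> {t'..<?N t'} = {}"
      using disjoint_cells[OF finite_break_angles break_angles_subset break_angles_0, of n]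
      unfolding disjoint_family_on_def by blast
    then show "?B' \<inter> {t..<?N t} \<inter> (?B' \<inter> {t'..<?N t'}) = {}" by blast
  qed (auto intro: finite_break_angles)
  also have "\<dots> \<le> (\<Sum>t\<in>?B. 2 * ?w t + (?N t - t) / \<eta>)"
  proof (rule sum_mono)
    fix t assume t: "t \<in> ?B"
    have lt: "t < ?N t" using cell_props(1)[OF t] .
    obtain s b where cell: "affine_cell n t (?N t) s b"
      using ex_affine_cell[OF lt cell_avoids_breaks[OF t] le_SucI[OF order_refl]] by blast
    note s = affine_cellD(1)[OF cell] and aff = affine_cellD(2)[OF cell]
    have w: "?w x = 1 / \<bar>s\<bar>" if "t \<le> x" "x < ?N t" for x
      using affine_cellD(3)[OF cell] that by (simp add: weight_def)
    define K where "K = {x \<in> {t<..<?N t}. (T ^^ n) (circle_pt x) \<in> breaks q}"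
    have K: "finite K" "real (card K) \<le> 1 + (?N t - t) * \<bar>s\<bar> / \<eta>"
      unfolding K_def using s aff sep \<open>\<eta> > 0\<close> lt by (intro card_affine_preimage[of t _ _ s b]; auto)+
    have sub: "?B' \<inter> {t..<?N t} \<subseteq> insert t K"
    proof
      fix x assume x: "x \<in> ?B' \<inter> {t..<?N t}"
      show "x \<in> insert t K"
      proof (cases "x = t")
        case False
        then have "t < x" "x < ?N t" using x by auto
        then have notin: "circle_pt x \<notin> breaks n" using cell_avoids_breaks[OF t] by blast
        obtain k where k: "k \<le> n + q" "(T ^^ k) (circle_pt x) \<in> A"
          using x by (auto simp: break_angles_def breaks_def)
        have "circle_pt x \<in> breaks n" if "k \<le> n"
          using that k unfolding breaks_def by auto
        then have "k > n" using notin by linarith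
        then have "(T ^^ k) (circle_pt x) = (T ^^ (k - n)) ((T ^^ n) (circle_pt x))"
          by (simp flip: funpow_add[THEN fun_cong, unfolded o_def])
        then have "(T ^^ n) (circle_pt x) \<in> breaks q"
          using k \<open>k > n\<close> iterate_in_S1[of "circle_pt x" n]
          by (auto simp: breaks_def intro!: exI[of _ "k - n"])
        then show ?thesis using \<open>t < x\<close> \<open>x < ?N t\<close> by (simp add: K_def)
      qed simp
    qed
    have "(\<Sum>x\<in>?B' \<inter> {t..<?N t}. ?w x) = real (card (?B' \<inter> {t..<?N t})) * (1 / \<bar>s\<bar>)"
      using w by simp
    also have "card (?B' \<inter> {t..<?N t}) \<le> card (insert t K)"
      using sub K by (intro card_mono) auto
    also have "card (insert t K) \<le> 1 + card K" using K by (simp add: card_insert_if)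
    finally have "(\<Sum>x\<in>?B' \<inter> {t..<?N t}. ?w x) \<le> real (1 + card K) * (1 / \<bar>s\<bar>)"
      by (simp add: divide_right_mono)
    also have "\<dots> \<le> (2 + (?N t - t) * \<bar>s\<bar> / \<eta>) * (1 / \<bar>s\<bar>)"
      using K(2) by (intro mult_right_mono) auto
    also have "\<dots> = 2 * ?w t + (?N t - t) / \<eta>"
      using s w[of t] lt \<open>\<eta> > 0\<close> by (simp add: field_simps)
    finally show "(\<Sum>x\<in>?B' \<inter> {t..<?N t}. ?w x) \<le> 2 * ?w t + (?N t - t) / \<eta>" .
  qed
  also have "\<dots> = 2 * total_weight n + 1 / \<eta>"
    using sum_next_pt_diff[OF finite_break_angles break_angles_subset break_angles_0, of n]
    by (simp add: sum.distrib total_weight_def flip: sum_distrib_left sum_divide_distrib)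
  finally show ?thesis by (simp add: field_simps)
qed

lemma total_weight_nonneg: "0 \<le> total_weight n"
  by (simp add: total_weight_def sum_nonneg weight_nonneg)

lemma total_weight_bounded:
  obtains Z where "\<And>n. total_weight n \<le> Z"
proof -
  obtain C \<theta> where \<theta>: "0 < \<theta>" "\<theta> < 1" "C > 0" and C: "\<forall>n. \<forall>g\<in>germs. weight n g \<le> C * \<theta> ^ n"
    using weight_geometric by blast
  have "(\<lambda>n. C * \<theta> ^ Suc n) \<longlonglongrightarrow> C * 0"
    using \<theta> by (intro tendsto_intros LIMSEQ_Suc LIMSEQ_power_zero) auto
  then have "\<forall>\<^sub>F n in sequentially. C * \<theta> ^ Suc n < 1 / 4"
    by (rule order_tendstoD) simp
  then obtain q' where "C * \<theta> ^ Suc q' < 1 / 4" by (auto simp: eventually_sequentially)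
  define q where "q = Suc q'"
  have q: "weight q g \<le> 1 / 4" if "g \<in> germs" for g
    using C[rule_format, OF that, of q] \<open>C * \<theta> ^ Suc q' < 1 / 4\<close> by (simp add: q_def)
  obtain \<eta> where \<eta>: "\<eta> > 0" "\<And>x y. circle_pt x \<in> breaks q \<Longrightarrow> circle_pt y \<in> breaks q \<Longrightarrow> x \<noteq> y \<Longrightarrow> \<eta> \<le> \<bar>x - y\<bar>"
    using finite_angles_separated[OF finite_breaks] by blast
  define Z where "Z = Max (insert (1 / (2 * \<eta>)) (total_weight ` {..<q}))"
  have Z: "1 / (2 * \<eta>) \<le> Z" "n < q \<Longrightarrow> total_weight n \<le> Z" for n by (auto simp: Z_def)
  have "total_weight n \<le> Z" for n
  proof (induction n rule: less_induct)
    case (less n)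
    show ?case
    proof (cases "n < q")
      case False
      then have "total_weight n \<le> total_weight (n - q) / 2 + 1 / (4 * \<eta>)"
        using total_weight_recursion[OF q \<eta>, of "n - q"] by simp
      moreover have "total_weight (n - q) \<le> Z" using False by (intro less.IH) (simp add: q_def)
      moreover have "1 / (4 * \<eta>) = (1 / (2 * \<eta>)) / 2" by simp
      ultimately show ?thesis using Z(1) by linarith
    qed (rule Z(2))
  qed
  then show thesis using that by blast
qed

end

section \<open>Resolvents and the matching condition\<close>

text \<open>
  Functions on germs that are odd under exchange of the two sides of a point have jump \<open>0\<close> there.
\<close>

definition jump :: "(complex \<times> real \<Rightarrow> real) \<Rightarrow> complex \<Rightarrow> real" where
  "jump f z = f (z, 1) + f (z, -1)"

lemma sup_bound_nonneg:
  fixes \<Phi> :: "complex \<Rightarrow> real"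
  assumes "\<forall>z\<in>S1. \<bar>\<Phi> z\<bar> \<le> M"
  shows "0 \<le> M"
proof -
  have "\<bar>\<Phi> 1\<bar> \<le> M" by (rule bspec[OF assms]) simp
  then show ?thesis by linarith
qed

context affine_circle_map
begin

text \<open>
  The \<open>n\<close>-th power of the weighted composition operator \<open>f \<mapsto> (\<lambda>g. f (germ_map g) / \<bar>slope 1 g\<bar>)\<close>, applied to the
  odd function \<open>(z, e) \<mapsto> e * \<Phi> z\<close> on germs. Since \<open>e\<close> is multiplied by the sign of the slope along the orbit, this
  is \<open>e * \<Phi> (T^n (z^e)) / (T^n)' (z^e)\<close>.
\<close>

definition pull :: "(complex \<Rightarrow> real) \<Rightarrow> nat \<Rightarrow> complex \<times> real \<Rightarrow> real" where
  "pull \<Phi> n g = weight n g * (snd ((germ_map ^^ n) g) * \<Phi> (fst ((germ_map ^^ n) g)))"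

definition resolvent :: "(complex \<Rightarrow> real) \<Rightarrow> complex \<times> real \<Rightarrow> real" where
  "resolvent \<Phi> g = (\<Sum>n. pull \<Phi> n g)"

lemma abs_pull_le:
  assumes "g \<in> germs" "\<forall>z\<in>S1. \<bar>\<Phi> z\<bar> \<le> M"
  shows "\<bar>pull \<Phi> n g\<bar> \<le> M * weight n g"
proof -
  have h: "(germ_map ^^ n) g \<in> germs" using assms by (intro germ_iterate_in_germs)
  then have "\<bar>snd ((germ_map ^^ n) g)\<bar> = 1" by auto
  moreover have "\<bar>\<Phi> (fst ((germ_map ^^ n) g))\<bar> \<le> M"
    using h assms(2) by (auto simp: mem_Times_iff)
  ultimately show ?thesis
    using mult_left_mono[OF _ weight_nonneg[of n g]]
    by (simp add: pull_def abs_mult weight_nonneg mult.commute[of M])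
qed

lemma pull_add: "pull \<Phi> (n + N) g = weight N g * pull \<Phi> n ((germ_map ^^ N) g)"
proof -
  have "(germ_map ^^ (n + N)) g = (germ_map ^^ n) ((germ_map ^^ N) g)"
    by (simp add: funpow_add)
  moreover have "weight (n + N) g = weight N g * weight n ((germ_map ^^ N) g)"
    by (subst add.commute) (rule weight_add)
  ultimately show ?thesis by (simp add: pull_def)
qed

lemma resolvent_bound:
  "\<exists>K\<ge>0. \<forall>\<Phi> M g. g \<in> germs \<longrightarrow> (\<forall>z\<in>S1. \<bar>\<Phi> z\<bar> \<le> M) \<longrightarrow>
     summable (\<lambda>n. pull \<Phi> n g) \<and> \<bar>resolvent \<Phi> g\<bar> \<le> K * M"
proof -
  obtain C \<theta> where \<theta>: "0 < \<theta>" "\<theta> < 1" "C > 0" and C: "\<forall>n. \<forall>g\<in>germs. weight n g \<le> C * \<theta> ^ n"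
    using weight_geometric by blast
  have "summable (\<lambda>n. pull \<Phi> n g) \<and> \<bar>resolvent \<Phi> g\<bar> \<le> C / (1 - \<theta>) * M"
    if g: "g \<in> germs" and \<Phi>: "\<forall>z\<in>S1. \<bar>\<Phi> z\<bar> \<le> M" for \<Phi> M g
  proof -
    have M: "M \<ge> 0" using sup_bound_nonneg[OF \<Phi>] .
    have le: "norm (pull \<Phi> n g) \<le> (M * C) * \<theta> ^ n" for n
    proof -
      have "\<bar>pull \<Phi> n g\<bar> \<le> M * weight n g" using abs_pull_le[OF g \<Phi>] .
      also have "\<dots> \<le> M * (C * \<theta> ^ n)" using C g M by (intro mult_left_mono) auto
      finally show ?thesis by (simp add: mult.assoc)
    qed
    have sm: "summable (\<lambda>n. (M * C) * \<theta> ^ n)" using \<theta> by (intro summable_mult summable_geometric) auto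
    have "summable (\<lambda>n. pull \<Phi> n g)" by (rule summable_comparison_test'[OF sm, of 0]) (use le in auto)
    moreover have "\<bar>resolvent \<Phi> g\<bar> \<le> (\<Sum>n. (M * C) * \<theta> ^ n)"
      unfolding resolvent_def real_norm_def[symmetric]
      by (rule norm_suminf_le[OF le sm])
    moreover have "(\<Sum>n. (M * C) * \<theta> ^ n) = C / (1 - \<theta>) * M"
      using \<theta> by (subst suminf_mult) (auto simp: suminf_geometric intro: summable_geometric)
    ultimately show ?thesis by simp
  qed
  moreover have "C / (1 - \<theta>) \<ge> 0" using \<theta> by simp
  ultimately show ?thesis by (intro exI[of _ "C / (1 - \<theta>)"] conjI allI impI) simp_all
qed

lemma summable_pull: "g \<in> germs \<Longrightarrow> \<forall>z\<in>S1. \<bar>\<Phi> z\<bar> \<le> M \<Longrightarrow> summable (\<lambda>n. pull \<Phi> n g)"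
  using resolvent_bound by blast

lemma resolvent_split:
  assumes "g \<in> germs" "\<forall>z\<in>S1. \<bar>\<Phi> z\<bar> \<le> M"
  shows "resolvent \<Phi> g = (\<Sum>n<N. pull \<Phi> n g) + weight N g * resolvent \<Phi> ((germ_map ^^ N) g)"
proof -
  have "resolvent \<Phi> g = (\<Sum>n. pull \<Phi> (n + N) g) + (\<Sum>n<N. pull \<Phi> n g)"
    unfolding resolvent_def by (rule suminf_split_initial_segment[OF summable_pull[OF assms]])
  also have "(\<Sum>n. pull \<Phi> (n + N) g) = weight N g * resolvent \<Phi> ((germ_map ^^ N) g)"
    unfolding pull_add resolvent_def
    by (rule suminf_mult[OF summable_pull[OF germ_iterate_in_germs[OF assms(1)] assms(2)]])
  finally show ?thesis by simp
qed

text \<open>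
  Linearity of the resolvent, for the function that arises from \<open>\<Phi>\<close> by setting its values on \<open>P\<close>
  to \<open>0\<close>.
\<close>

lemma resolvent_point_decomposition:
  assumes g: "g \<in> germs" and \<Phi>: "\<forall>z\<in>S1. \<bar>\<Phi> z\<bar> \<le> M" and "finite P"
  shows "resolvent (\<lambda>z. \<Phi> z - (\<Sum>p\<in>P. \<Phi> p * indicator {p} z)) g =
         resolvent \<Phi> g - (\<Sum>p\<in>P. \<Phi> p * resolvent (indicator {p}) g)"
proof -
  have ind: "summable (\<lambda>n. pull (indicator {p}) n g)" for p
    by (rule summable_pull[OF g, of _ 1]) (auto simp: indicator_def)
  have "pull (\<lambda>z. \<Phi> z - (\<Sum>p\<in>P. \<Phi> p * indicator {p} z)) n g =
        pull \<Phi> n g - (\<Sum>p\<in>P. \<Phi> p * pull (indicator {p}) n g)" for n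
    by (simp add: pull_def right_diff_distrib sum_distrib_left mult_ac)
  then have "resolvent (\<lambda>z. \<Phi> z - (\<Sum>p\<in>P. \<Phi> p * indicator {p} z)) g =
        (\<Sum>n. pull \<Phi> n g - (\<Sum>p\<in>P. \<Phi> p * pull (indicator {p}) n g))"
    by (simp add: resolvent_def)
  also have "\<dots> = resolvent \<Phi> g - (\<Sum>n. \<Sum>p\<in>P. \<Phi> p * pull (indicator {p}) n g)"
    unfolding resolvent_def using summable_pull[OF g \<Phi>] ind
    by (intro suminf_diff[symmetric] summable_sum summable_mult) auto
  also have "(\<Sum>n. \<Sum>p\<in>P. \<Phi> p * pull (indicator {p}) n g) = (\<Sum>p\<in>P. \<Sum>n. \<Phi> p * pull (indicator {p}) n g)"
    using ind by (intro suminf_sum summable_mult) auto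
  also have "\<dots> = (\<Sum>p\<in>P. \<Phi> p * resolvent (indicator {p}) g)"
    unfolding resolvent_def using ind by (intro sum.cong refl suminf_mult)
  finally show ?thesis .
qed

lemma one_sided_orbits:
  assumes "c \<in> S1"
  shows "upper_orbit T k c = fst ((germ_map ^^ k) (c, 1))" "upper_deriv T k c = slope k (c, 1)"
    and "lower_orbit T k c = fst ((germ_map ^^ k) (c, -1))" "lower_deriv T k c = slope k (c, -1)"
proof -
  have g: "(c, 1) \<in> germs" "(c, -1) \<in> germs" using assms by auto
  have nz: "fst ((germ_map ^^ k) (c, e)) \<noteq> 0" if "(c, e) \<in> germs" for e
    using germ_iterate_in_germs[OF that, of k] by (auto simp: mem_Times_iff)
  show "upper_orbit T k c = fst ((germ_map ^^ k) (c, 1))" "upper_deriv T k c = slope k (c, 1)"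
    using one_sided_orbit_eq(1)[OF nz[OF g(1)]] germ_iterate[OF g(1), of k] by auto
  show "lower_orbit T k c = fst ((germ_map ^^ k) (c, -1))" "lower_deriv T k c = slope k (c, -1)"
    using one_sided_orbit_eq(2)[OF nz[OF g(2)]] germ_iterate[OF g(2), of k] by auto
qed

text \<open>
  If the germs to the right and to the left of \<open>z\<close> meet after \<open>kp\<close> and \<open>km\<close> steps with equal slopes,
  they arrive on opposite sides, so the tails of the two resolvent series combine to a jump at the meeting
  point. Of the initial segments only the terms of index \<open>0\<close> survive, \<open>\<Phi> z\<close> and \<open>- \<Phi> z\<close>, and they
  cancel.
\<close>

lemma jump_resolvent_transport:
  assumes z: "z \<in> S1" and \<Phi>: "\<forall>z\<in>S1. \<bar>\<Phi> z\<bar> \<le> M"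
    and zero: "\<And>j. 1 \<le> j \<Longrightarrow> j < kp \<Longrightarrow> \<Phi> (fst ((germ_map ^^ j) (z, 1))) = 0"
      "\<And>j. 1 \<le> j \<Longrightarrow> j < km \<Longrightarrow> \<Phi> (fst ((germ_map ^^ j) (z, -1))) = 0"
    and pos: "kp \<ge> 1" "km \<ge> 1"
    and meet: "fst ((germ_map ^^ km) (z, -1)) = fst ((germ_map ^^ kp) (z, 1))"
      "slope km (z, -1) = slope kp (z, 1)"
  shows "jump (resolvent \<Phi>) z = weight kp (z, 1) * jump (resolvent \<Phi>) (fst ((germ_map ^^ kp) (z, 1)))"
    and "jump (resolvent \<Phi>) z = weight km (z, -1) * jump (resolvent \<Phi>) (fst ((germ_map ^^ km) (z, -1)))"
proof -
  have g: "(z, 1) \<in> germs" "(z, -1) \<in> germs" using z by auto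
  define s where "s = slope kp (z, 1)"
  define w where "w = fst ((germ_map ^^ kp) (z, 1))"
  have "s \<noteq> 0" using slope_nonzero[OF g(1)] by (simp add: s_def)
  have e: "(germ_map ^^ kp) (z, 1) = (w, sgn s)" "(germ_map ^^ km) (z, -1) = (w, - sgn s)"
    using germ_iterate[OF g(1), of kp] germ_iterate[OF g(2), of km] meet
    by (auto simp: s_def w_def prod_eq_iff)
  have 1: "(\<Sum>n<kp. pull \<Phi> n (z, 1)) = \<Phi> z"
  proof -
    have "(\<Sum>n<kp. pull \<Phi> n (z, 1)) = (\<Sum>n\<in>{0}. pull \<Phi> n (z, 1))"
      using pos zero by (intro sum.mono_neutral_right) (auto simp: pull_def Suc_le_eq)
    then show ?thesis by (simp add: pull_def)
  qed
  have 2: "(\<Sum>n<km. pull \<Phi> n (z, -1)) = - \<Phi> z"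
  proof -
    have "(\<Sum>n<km. pull \<Phi> n (z, -1)) = (\<Sum>n\<in>{0}. pull \<Phi> n (z, -1))"
      using pos zero by (intro sum.mono_neutral_right) (auto simp: pull_def Suc_le_eq)
    then show ?thesis by (simp add: pull_def)
  qed
  have w: "weight km (z, -1) = weight kp (z, 1)" using meet by (simp add: weight_def)
  have "jump (resolvent \<Phi>) z = weight kp (z, 1) * resolvent \<Phi> (w, sgn s) + weight km (z, -1) * resolvent \<Phi> (w, - sgn s)"
    using resolvent_split[OF g(1) \<Phi>, of kp] resolvent_split[OF g(2) \<Phi>, of km]
    by (simp add: jump_def 1 2 e)
  also have "\<dots> = weight kp (z, 1) * jump (resolvent \<Phi>) w"
    using \<open>s \<noteq> 0\<close> by (cases "s > 0") (auto simp: jump_def w distrib_left)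
  finally show "jump (resolvent \<Phi>) z = weight kp (z, 1) * jump (resolvent \<Phi>) (fst ((germ_map ^^ kp) (z, 1)))"
    "jump (resolvent \<Phi>) z = weight km (z, -1) * jump (resolvent \<Phi>) (fst ((germ_map ^^ km) (z, -1)))"
    using w meet by (simp_all add: w_def)
qed

lemma germs_glue_off_discontinuities:
  assumes "z \<in> S1" "z \<notin> discontinuities T"
  shows "fst ((germ_map ^^ 1) (z, -1)) = fst ((germ_map ^^ 1) (z, 1))" "slope 1 (z, -1) = slope 1 (z, 1)"
proof -
  have g: "(z, 1) \<in> germs" "(z, -1) \<in> germs" using assms by auto
  obtain d where d: "circle_has_deriv T d z"
    using assms by (auto simp: discontinuities_def circle_differentiable_def)
  have *: "fst (germ_data (z, e)) = T z \<and> snd (germ_data (z, e)) = d" if "(z, e) \<in> germs" for e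
  proof -
    have "affine_germ T z e (fst (germ_data (z, e))) (snd (germ_data (z, e)))"
      using germ_data(3)[OF that] by simp
    moreover have "fst (germ_data (z, e)) \<noteq> 0" "e \<in> {1, -1}" using germ_data(1)[OF that] that by auto
    ultimately show ?thesis using differentiable_glues_germs[OF d] by blast
  qed
  show "fst ((germ_map ^^ 1) (z, -1)) = fst ((germ_map ^^ 1) (z, 1))" "slope 1 (z, -1) = slope 1 (z, 1)"
    using *[OF g(1)] *[OF g(2)] by (simp_all add: germ_map_def slope_def)
qed

text \<open>
  The meeting times are \<open>\<kappa>p z\<close> and \<open>\<kappa>m z\<close> at a discontinuity, where the intermediate points lie in the
  prematching set, and \<open>1\<close> and \<open>1\<close> at any other point.
\<close>

lemma jump_resolvent_recurrence:
  assumes "matching T \<kappa>m \<kappa>p" and \<Phi>: "\<forall>z\<in>S1. \<bar>\<Phi> z\<bar> \<le> M"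
    and zero: "\<And>p. p \<in> prematching_set T \<kappa>m \<kappa>p \<Longrightarrow> \<Phi> p = 0"
    and g: "(z, e) \<in> germs"
  shows "\<exists>k\<ge>1. jump (resolvent \<Phi>) z = weight k (z, e) * jump (resolvent \<Phi>) (fst ((germ_map ^^ k) (z, e)))"
proof (cases "z \<in> discontinuities T")
  case True
  then have z: "z \<in> S1" by (simp add: discontinuities_def)
  have PM: "\<Phi> (fst ((germ_map ^^ j) (z, 1))) = 0" if "1 \<le> j" "j < \<kappa>p z" for j
  proof (rule zero)
    have "upper_orbit T j z \<in> prematching_set T \<kappa>m \<kappa>p"
      unfolding prematching_set_def using that by (intro UN_I[OF True] UnI2 UN_I[of j]) auto
    then show "fst ((germ_map ^^ j) (z, 1)) \<in> prematching_set T \<kappa>m \<kappa>p"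
      by (simp add: one_sided_orbits[OF z])
  qed
  have PM': "\<Phi> (fst ((germ_map ^^ j) (z, -1))) = 0" if "1 \<le> j" "j < \<kappa>m z" for j
  proof (rule zero)
    have "lower_orbit T j z \<in> prematching_set T \<kappa>m \<kappa>p"
      unfolding prematching_set_def using that by (intro UN_I[OF True] UnI1 UN_I[of j]) auto
    then show "fst ((germ_map ^^ j) (z, -1)) \<in> prematching_set T \<kappa>m \<kappa>p"
      by (simp add: one_sided_orbits[OF z])
  qed
  have m: "\<kappa>m z \<ge> 1" "\<kappa>p z \<ge> 1" "fst ((germ_map ^^ \<kappa>m z) (z, -1)) = fst ((germ_map ^^ \<kappa>p z) (z, 1))"
    "slope (\<kappa>m z) (z, -1) = slope (\<kappa>p z) (z, 1)"
    using assms(1) True z by (auto simp: matching_def one_sided_orbits)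
  show ?thesis
    using jump_resolvent_transport[OF z \<Phi> PM PM' m(2,1,3,4)] g m(1,2) by blast
next
  case False
  have z: "z \<in> S1" using g by auto
  show ?thesis
    using jump_resolvent_transport[OF z \<Phi>, of 1 1] germs_glue_off_discontinuities[OF z False] g by fastforce
qed

text \<open>
  Iterating the recurrence along the orbit of one germ writes the jump as a bounded quantity times a
  weight of arbitrarily high order.
\<close>

lemma jump_resolvent_eq_0:
  assumes "matching T \<kappa>m \<kappa>p" and \<Phi>: "\<forall>z\<in>S1. \<bar>\<Phi> z\<bar> \<le> M"
    and zero: "\<And>p. p \<in> prematching_set T \<kappa>m \<kappa>p \<Longrightarrow> \<Phi> p = 0"
    and z: "z \<in> S1"
  shows "jump (resolvent \<Phi>) z = 0"
proof -
  have far: "\<exists>k\<ge>N. jump (resolvent \<Phi>) (fst g) = weight k g * jump (resolvent \<Phi>) (fst ((germ_map ^^ k) g))"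
    if "g \<in> germs" for N g
  proof (induction N)
    case 0
    show ?case by (intro exI[of _ 0]) auto
  next
    case (Suc N)
    then obtain k where k: "k \<ge> N"
      "jump (resolvent \<Phi>) (fst g) = weight k g * jump (resolvent \<Phi>) (fst ((germ_map ^^ k) g))" by blast
    let ?h = "(germ_map ^^ k) g"
    have h: "?h \<in> germs" using germ_iterate_in_germs[OF that] .
    then obtain l where l: "l \<ge> 1"
      "jump (resolvent \<Phi>) (fst ?h) = weight l ?h * jump (resolvent \<Phi>) (fst ((germ_map ^^ l) ?h))"
      using jump_resolvent_recurrence[OF assms(1) \<Phi> zero, of "fst ?h" "snd ?h"] by auto
    have "(germ_map ^^ (k + l)) g = (germ_map ^^ l) ?h"
      by (subst add.commute) (simp add: funpow_add)
    then have "jump (resolvent \<Phi>) (fst g) = weight (k + l) g * jump (resolvent \<Phi>) (fst ((germ_map ^^ (k + l)) g))"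
      using k(2) l(2) by (simp add: weight_add)
    then show ?case using k(1) l(1) by (intro exI[of _ "k + l"]) auto
  qed
  obtain K where K: "K \<ge> 0" "\<forall>\<Phi> M g. g \<in> germs \<longrightarrow> (\<forall>z\<in>S1. \<bar>\<Phi> z\<bar> \<le> M) \<longrightarrow>
     summable (\<lambda>n. pull \<Phi> n g) \<and> \<bar>resolvent \<Phi> g\<bar> \<le> K * M"
    using resolvent_bound by blast
  have jb: "\<bar>jump (resolvent \<Phi>) w\<bar> \<le> 2 * (K * M)" if "w \<in> S1" for w
  proof -
    have "\<bar>resolvent \<Phi> (w, 1)\<bar> \<le> K * M" "\<bar>resolvent \<Phi> (w, -1)\<bar> \<le> K * M"
      using K(2) \<Phi> that by auto
    then show ?thesis by (simp add: jump_def abs_le_iff)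
  qed
  obtain C \<theta> where \<theta>: "0 < \<theta>" "\<theta> < 1" "C > 0" and C: "\<forall>n. \<forall>g\<in>germs. weight n g \<le> C * \<theta> ^ n"
    using weight_geometric by blast
  have M: "M \<ge> 0" using sup_bound_nonneg[OF \<Phi>] .
  have g: "(z, 1) \<in> germs" using z by auto
  have le: "\<bar>jump (resolvent \<Phi>) z\<bar> \<le> C * \<theta> ^ N * (2 * (K * M))" for N
  proof -
    obtain k where k: "k \<ge> N"
      "jump (resolvent \<Phi>) z = weight k (z, 1) * jump (resolvent \<Phi>) (fst ((germ_map ^^ k) (z, 1)))"
      using far[OF g, of N] by auto
    have "fst ((germ_map ^^ k) (z, 1)) \<in> S1"
      using germ_iterate_in_germs[OF g, of k] by (simp only: mem_Times_iff)
    then have "\<bar>jump (resolvent \<Phi>) z\<bar> \<le> weight k (z, 1) * (2 * (K * M))"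
      unfolding k(2) using jb by (simp only: abs_mult abs_of_nonneg[OF weight_nonneg]) (intro mult_left_mono weight_nonneg)
    also have "weight k (z, 1) \<le> C * \<theta> ^ k" using C g by blast
    also have "C * \<theta> ^ k \<le> C * \<theta> ^ N" using \<theta> k(1) by (intro mult_left_mono power_decreasing) auto
    finally show ?thesis using K(1) M by (simp add: mult_right_mono)
  qed
  have "(\<lambda>N. C * \<theta> ^ N * (2 * (K * M))) \<longlonglongrightarrow> C * 0 * (2 * (K * M))"
    using \<theta> by (intro tendsto_intros LIMSEQ_power_zero) auto
  then have "\<bar>jump (resolvent \<Phi>) z\<bar> \<le> C * 0 * (2 * (K * M))"
    using le by (intro LIMSEQ_le_const) auto
  then show ?thesis by simp
qed

text \<open>
  The jump is a linear functional of \<open>\<Phi>\<close> that vanishes when \<open>\<Phi>\<close> vanishes on the finite prematching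
  set, hence a combination of the point evaluations there; the coefficients are the jumps for the
  indicators of points.
\<close>

lemma jump_resolvent_on_prematching_set:
  assumes "matching T \<kappa>m \<kappa>p" and \<Phi>: "\<forall>z\<in>S1. \<bar>\<Phi> z\<bar> \<le> M"
    and fin: "finite (prematching_set T \<kappa>m \<kappa>p)" and z: "z \<in> S1"
  shows "jump (resolvent \<Phi>) z =
         (\<Sum>p\<in>prematching_set T \<kappa>m \<kappa>p. \<Phi> p * jump (resolvent (indicator {p})) z)"
proof -
  let ?P = "prematching_set T \<kappa>m \<kappa>p"
  define \<Psi> where "\<Psi> = (\<lambda>z. \<Phi> z - (\<Sum>p\<in>?P. \<Phi> p * indicator {p} z))"
  have \<Psi>: "\<Psi> w = (if w \<in> ?P then 0 else \<Phi> w)" for w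
    using fin by (simp add: \<Psi>_def indicator_def if_distrib[of "\<lambda>x. _ * x"] sum.delta cong: if_cong)
  have M: "M \<ge> 0" using sup_bound_nonneg[OF \<Phi>] .
  have "jump (resolvent \<Psi>) z = 0"
    by (rule jump_resolvent_eq_0[OF assms(1), of _ M]) (use \<Psi> \<Phi> M z in auto)
  moreover have "resolvent \<Psi> g = resolvent \<Phi> g - (\<Sum>p\<in>?P. \<Phi> p * resolvent (indicator {p}) g)"
    if "g \<in> germs" for g
    unfolding \<Psi>_def by (rule resolvent_point_decomposition[OF that \<Phi> fin])
  ultimately show ?thesis
    using z by (simp add: jump_def sum.distrib distrib_left)
qed

text \<open>
  The difference between \<open>\<lambda> E\<close> and \<open>\<lambda> (T^-n E)\<close>, when \<open>\<Phi>\<close> is the primitive of \<open>1\<^sub>E - \<lambda> E\<close>; see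
  \<open>measure_iterate_vimage\<close> below.
\<close>

definition defect :: "(complex \<Rightarrow> real) \<Rightarrow> nat \<Rightarrow> real" where
  "defect \<Phi> n = (\<Sum>t\<in>break_angles n. jump (pull \<Phi> n) (circle_pt t))"

definition resolvent_defect :: "(complex \<Rightarrow> real) \<Rightarrow> nat \<Rightarrow> real" where
  "resolvent_defect \<Phi> n = (\<Sum>t\<in>break_angles n. jump (resolvent \<Phi>) (circle_pt t))"

lemma jump_pull_eq_0:
  assumes "circle_pt t \<notin> breaks n"
  shows "jump (pull \<Phi> n) (circle_pt t) = 0"
proof -
  obtain \<delta> where \<delta>: "\<delta> > 0" "\<And>x. 0 < \<bar>x - t\<bar> \<Longrightarrow> \<bar>x - t\<bar> < \<delta> \<Longrightarrow> circle_pt x \<notin> breaks n"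
    using finite_angles_isolated[OF finite_breaks, of t] by blast
  have "circle_pt x \<notin> breaks n" if "t - \<delta> < x" "x < t + \<delta>" for x
    using \<delta>(2)[of x] assms that by (cases "x = t") auto
  moreover have "t - \<delta> < t + \<delta>" using \<delta>(1) by simp
  ultimately obtain s b where "affine_cell n (t - \<delta>) (t + \<delta>) s b"
    by (metis ex_affine_cell le_SucI order_refl)
  from affine_cellD(3-6)[OF this, of t] show ?thesis
    using \<delta>(1) by (simp add: jump_def pull_def weight_def)
qed

text \<open>
  Away from the break points the two germs of \<open>T^n\<close> at a point are glued, and their contributions
  cancel. So the defects of all \<open>n \<le> N\<close> can be summed over the same points.
\<close>

lemma defect_superset:
  assumes "n \<le> N"
  shows "defect \<Phi> n = (\<Sum>t\<in>break_angles N. jump (pull \<Phi> n) (circle_pt t))"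
  unfolding defect_def
  by (rule sum.mono_neutral_left[OF finite_break_angles])
    (use breaks_mono[OF assms] jump_pull_eq_0 in \<open>auto simp: break_angles_def\<close>)

lemma abs_sum_jump_le:
  assumes "\<And>g. g \<in> germs \<Longrightarrow> \<bar>f g\<bar> \<le> M * weight n g"
  shows "\<bar>\<Sum>t\<in>break_angles n. jump f (circle_pt t)\<bar> \<le> 2 * M * total_weight n"
proof -
  have "\<bar>\<Sum>t\<in>break_angles n. jump f (circle_pt t)\<bar> \<le> (\<Sum>t\<in>break_angles n. \<bar>jump f (circle_pt t)\<bar>)"
    by (rule sum_abs)
  also have "\<dots> \<le> (\<Sum>t\<in>break_angles n. M * weight n (circle_pt t, 1) + M * weight n (circle_pt t, -1))"
  proof (rule sum_mono)
    fix t
    have "\<bar>f (circle_pt t, 1)\<bar> \<le> M * weight n (circle_pt t, 1)" "\<bar>f (circle_pt t, -1)\<bar> \<le> M * weight n (circle_pt t, -1)"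
      by (rule assms; simp)+
    then show "\<bar>jump f (circle_pt t)\<bar> \<le> M * weight n (circle_pt t, 1) + M * weight n (circle_pt t, -1)"
      unfolding jump_def by linarith
  qed
  also have "\<dots> = 2 * M * total_weight n"
    using total_weight_left[of n] by (simp add: sum.distrib total_weight_def flip: sum_distrib_left)
  finally show ?thesis .
qed

text \<open>
  Summed over \<open>n < N\<close>, the terms of each germ give the resolvent minus its tail, and the tail is
  \<open>weight N\<close> times a bounded function on germs; the sum of these weights over the break points is bounded.
\<close>

lemma defect_cesaro:
  "\<exists>K\<ge>0. \<forall>\<Phi> M N. (\<forall>z\<in>S1. \<bar>\<Phi> z\<bar> \<le> M) \<longrightarrow>
      \<bar>defect \<Phi> N\<bar> \<le> K * M \<and> \<bar>(\<Sum>n<N. defect \<Phi> n) - resolvent_defect \<Phi> N\<bar> \<le> K * M"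
proof -
  obtain Z where Z: "\<And>n. total_weight n \<le> Z" using total_weight_bounded by blast
  have "Z \<ge> 0" using Z[of 0] total_weight_nonneg[of 0] by linarith
  obtain K where K: "K \<ge> 0" "\<forall>\<Phi> M g. g \<in> germs \<longrightarrow> (\<forall>z\<in>S1. \<bar>\<Phi> z\<bar> \<le> M) \<longrightarrow>
     summable (\<lambda>n. pull \<Phi> n g) \<and> \<bar>resolvent \<Phi> g\<bar> \<le> K * M"
    using resolvent_bound by blast
  have "\<bar>defect \<Phi> N\<bar> \<le> (2 * Z * (1 + K)) * M \<and>
        \<bar>(\<Sum>n<N. defect \<Phi> n) - resolvent_defect \<Phi> N\<bar> \<le> (2 * Z * (1 + K)) * M"
    if \<Phi>: "\<forall>z\<in>S1. \<bar>\<Phi> z\<bar> \<le> M" for \<Phi> M N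
  proof
    have M: "M \<ge> 0" using sup_bound_nonneg[OF \<Phi>] .
    have up: "2 * a * total_weight N \<le> (2 * Z * (1 + K)) * M" if "a = M \<or> a = K * M" for a
    proof -
      have "2 * a * total_weight N \<le> 2 * a * Z"
        using that M K(1) by (intro mult_left_mono Z) auto
      moreover have "a * Z \<le> (1 + K) * M * Z"
        using that M K(1) \<open>Z \<ge> 0\<close> by (intro mult_right_mono) (auto simp: algebra_simps)
      moreover have "2 * a * Z = 2 * (a * Z)" "(2 * Z * (1 + K)) * M = 2 * ((1 + K) * M * Z)"
        by (simp_all add: algebra_simps)
      ultimately show ?thesis by linarith
    qed
    have "\<bar>defect \<Phi> N\<bar> \<le> 2 * M * total_weight N"
      unfolding defect_def by (intro abs_sum_jump_le abs_pull_le \<Phi>)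
    then show "\<bar>defect \<Phi> N\<bar> \<le> (2 * Z * (1 + K)) * M" using up[of M] by linarith
    let ?r = "\<lambda>g. weight N g * resolvent \<Phi> ((germ_map ^^ N) g)"
    have "(\<Sum>n<N. defect \<Phi> n) = (\<Sum>n<N. \<Sum>t\<in>break_angles N. jump (pull \<Phi> n) (circle_pt t))"
      by (intro sum.cong defect_superset) auto
    also have "\<dots> = (\<Sum>t\<in>break_angles N. \<Sum>n<N. jump (pull \<Phi> n) (circle_pt t))"
      by (rule sum.swap)
    also have "\<dots> = (\<Sum>t\<in>break_angles N. jump (resolvent \<Phi>) (circle_pt t) - jump ?r (circle_pt t))"
    proof (rule sum.cong)
      fix t
      have "(circle_pt t, 1) \<in> germs" "(circle_pt t, -1) \<in> germs" by auto
      from this[THEN resolvent_split[OF _ \<Phi>, of _ N]]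
      show "(\<Sum>n<N. jump (pull \<Phi> n) (circle_pt t)) = jump (resolvent \<Phi>) (circle_pt t) - jump ?r (circle_pt t)"
        by (simp add: jump_def sum.distrib)
    qed simp
    also have "\<dots> = resolvent_defect \<Phi> N - (\<Sum>t\<in>break_angles N. jump ?r (circle_pt t))"
      by (simp add: sum_subtractf resolvent_defect_def)
    finally have "\<bar>(\<Sum>n<N. defect \<Phi> n) - resolvent_defect \<Phi> N\<bar> = \<bar>\<Sum>t\<in>break_angles N. jump ?r (circle_pt t)\<bar>"
      by simp
    also have "\<dots> \<le> 2 * (K * M) * total_weight N"
    proof (rule abs_sum_jump_le)
      fix g assume "g \<in> germs"
      then have "\<bar>resolvent \<Phi> ((germ_map ^^ N) g)\<bar> \<le> K * M"
        using K(2) \<Phi> germ_iterate_in_germs by blast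
      then show "\<bar>?r g\<bar> \<le> K * M * weight N g"
        using mult_left_mono[OF _ weight_nonneg[of N g]] by (simp add: abs_mult weight_nonneg mult.commute[of _ "weight N g"])
    qed
    finally show "\<bar>(\<Sum>n<N. defect \<Phi> n) - resolvent_defect \<Phi> N\<bar> \<le> (2 * Z * (1 + K)) * M"
      using up[of "K * M"] by linarith
  qed
  moreover have "2 * Z * (1 + K) \<ge> 0" using \<open>Z \<ge> 0\<close> K(1) by simp
  ultimately show ?thesis by (intro exI[of _ "2 * Z * (1 + K)"] conjI allI impI) simp_all
qed

text \<open>
  Moving the contribution of the left germ at each right end of a cell into that cell turns the sum over
  break points into a sum over cells.
\<close>

lemma defect_cells:
  assumes "\<And>t. t \<in> break_angles n \<Longrightarrow> affine_cell n t (next_pt (break_angles n) t) (s t) (b t)"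
  shows "defect \<Phi> n = - (\<Sum>t\<in>break_angles n.
     (\<Phi> (circle_pt (s t * next_pt (break_angles n) t + b t)) - \<Phi> (circle_pt (s t * t + b t))) / s t)"
proof -
  let ?N = "next_pt (break_angles n)"
  have "defect \<Phi> n = (\<Sum>t\<in>break_angles n. pull \<Phi> n (circle_pt t, 1)) + (\<Sum>t\<in>break_angles n. pull \<Phi> n (circle_pt t, -1))"
    by (simp add: defect_def jump_def sum.distrib)
  also have "(\<Sum>t\<in>break_angles n. pull \<Phi> n (circle_pt t, -1)) = (\<Sum>t\<in>break_angles n. pull \<Phi> n (circle_pt (?N t), -1))"
    by (rule sum_break_angles_next[symmetric]) simp
  also have "(\<Sum>t\<in>break_angles n. pull \<Phi> n (circle_pt t, 1)) + \<dots> =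
      (\<Sum>t\<in>break_angles n. pull \<Phi> n (circle_pt t, 1) + pull \<Phi> n (circle_pt (?N t), -1))"
    by (simp add: sum.distrib)
  also have "\<dots> = (\<Sum>t\<in>break_angles n. - ((\<Phi> (circle_pt (s t * ?N t + b t)) - \<Phi> (circle_pt (s t * t + b t))) / s t))"
  proof (rule sum.cong)
    fix t assume t: "t \<in> break_angles n"
    note c = affine_cellD[OF assms[OF t]]
    have sg: "sgn (s t) / \<bar>s t\<bar> = 1 / s t" using c(1) by (cases "s t > 0") auto
    have "pull \<Phi> n (circle_pt t, 1) = (sgn (s t) / \<bar>s t\<bar>) * \<Phi> (circle_pt (s t * t + b t))"
      using c(3,4)[of t] cell_props(1)[OF t] by (simp add: pull_def weight_def)
    moreover have "pull \<Phi> n (circle_pt (?N t), -1) = - (sgn (s t) / \<bar>s t\<bar>) * \<Phi> (circle_pt (s t * ?N t + b t))"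
      using c(5,6)[of "?N t"] cell_props(1)[OF t] by (simp add: pull_def weight_def)
    ultimately show "pull \<Phi> n (circle_pt t, 1) + pull \<Phi> n (circle_pt (?N t), -1) =
        - ((\<Phi> (circle_pt (s t * ?N t + b t)) - \<Phi> (circle_pt (s t * t + b t))) / s t)"
      unfolding sg by (simp add: diff_divide_distrib)
  qed simp
  finally show ?thesis by (simp add: sum_negf)
qed

lemma ex_cell_data:
  obtains s b where "\<And>t. t \<in> break_angles n \<Longrightarrow> affine_cell n t (next_pt (break_angles n) t) (s t) (b t)"
proof -
  have "\<exists>p. affine_cell n t (next_pt (break_angles n) t) (fst p) (snd p)" if t: "t \<in> break_angles n" for t
    using ex_affine_cell[OF cell_props(1)[OF t] cell_avoids_breaks[OF t] le_SucI[OF order_refl]]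
    by (metis fst_conv snd_conv)
  then obtain p where "\<And>t. t \<in> break_angles n \<Longrightarrow> affine_cell n t (next_pt (break_angles n) t) (fst (p t)) (snd (p t))"
    by metis
  then show thesis by (rule that)
qed

lemma defect_const: "defect (\<lambda>_. c) n = 0"
proof -
  obtain s b where "\<And>t. t \<in> break_angles n \<Longrightarrow> affine_cell n t (next_pt (break_angles n) t) (s t) (b t)"
    using ex_cell_data[of n] by blast
  from defect_cells[OF this] show ?thesis by simp
qed

end

section \<open>Lebesgue measure of preimages\<close>

abbreviation circle_borel :: "complex measure" where
  "circle_borel \<equiv> restrict_space borel S1"

lemma circle_pt_borel [measurable]: "circle_pt \<in> borel_measurable borel"
  by (intro borel_measurable_continuous_onI continuous_on_circle_pt continuous_on_id)

lemma circle_pt_measurable: "circle_pt \<in> measurable (restrict_space lborel {0..<1}) circle_borel"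
  by (intro measurable_restrict_space2 measurable_restrict_space1) (auto simp: measurable_lborel1)

lemma sets_circle_lebesgue [simp, measurable_cong]: "sets circle_lebesgue = sets circle_borel"
  by (simp add: circle_lebesgue_def)

lemma space_circle_lebesgue [simp]: "space circle_lebesgue = S1"
  by (simp add: circle_lebesgue_def space_restrict_space)

lemma sets_circle_borelD:
  assumes "E \<in> sets circle_borel"
  shows "E \<subseteq> S1" "E \<in> sets borel"
proof -
  show "E \<subseteq> S1" using sets.sets_into_space[OF assms] by (simp add: space_restrict_space)
  have "S1 \<in> sets borel" by simp
  then show "E \<in> sets borel" using assms sets_restrict_space_iff[of S1 borel E] by simp
qed

lemma angles_borel: "E \<in> sets circle_borel \<Longrightarrow> {t. circle_pt t \<in> E} \<in> sets borel"
  using measurable_sets[OF circle_pt_borel sets_circle_borelD(2)] by (simp add: vimage_def)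

lemma emeasure_circle_lebesgue:
  assumes E: "E \<in> sets circle_borel"
  shows "emeasure circle_lebesgue E = emeasure lborel ({t. circle_pt t \<in> E} \<inter> {0..<1})"
proof -
  have "emeasure circle_lebesgue E =
      emeasure (restrict_space lborel {0..<1}) (circle_pt -` E \<inter> space (restrict_space lborel {0..<1}))"
    unfolding circle_lebesgue_def by (rule emeasure_distr[OF circle_pt_measurable E])
  also have "circle_pt -` E \<inter> space (restrict_space lborel {0..<1}) = {t. circle_pt t \<in> E} \<inter> {0..<1}"
    by (auto simp: space_restrict_space)
  also have "emeasure (restrict_space lborel {0..<1}) \<dots> = emeasure lborel \<dots>"
    by (rule emeasure_restrict_space) auto
  finally show ?thesis .
qed

lemma measure_circle_lebesgue:
  "E \<in> sets circle_borel \<Longrightarrow> measure circle_lebesgue E = measure lborel ({t. circle_pt t \<in> E} \<inter> {0..<1})"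
  by (simp add: measure_def emeasure_circle_lebesgue)

lemma prob_space_circle_lebesgue: "prob_space circle_lebesgue"
proof
  have "S1 \<in> sets circle_borel" using sets.top[of circle_borel] by (simp add: space_restrict_space)
  then show "emeasure circle_lebesgue (space circle_lebesgue) = 1"
    by (simp add: emeasure_circle_lebesgue)
qed

interpretation circle: prob_space circle_lebesgue
  by (rule prob_space_circle_lebesgue)

definition angle :: "complex \<Rightarrow> real" where
  "angle z = (SOME t. 0 \<le> t \<and> t < 1 \<and> circle_pt t = z)"

lemma angle:
  assumes "z \<in> S1"
  shows "0 \<le> angle z" "angle z < 1" "circle_pt (angle z) = z"
proof -
  have "\<exists>t. 0 \<le> t \<and> t < 1 \<and> circle_pt t = z" using circle_ptE[OF assms] by metis
  from someI_ex[OF this] show "0 \<le> angle z" "angle z < 1" "circle_pt (angle z) = z"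
    unfolding angle_def by blast+
qed

lemma angle_circle_pt: "0 \<le> t \<Longrightarrow> t < 1 \<Longrightarrow> angle (circle_pt t) = t"
  using angle[of "circle_pt t"] by (intro circle_pt_eqD) auto

text \<open>
  The arc from \<open>1\<close> to \<open>z\<close> in the positive direction, without \<open>z\<close>.
\<close>

definition arc_below :: "complex \<Rightarrow> complex set" where
  "arc_below z = {w \<in> S1. angle w < angle z}"

lemma circle_pt_in_arc_below: "0 \<le> t \<Longrightarrow> t < 1 \<Longrightarrow> circle_pt t \<in> arc_below z \<longleftrightarrow> t < angle z"
  by (simp add: arc_below_def angle_circle_pt)

lemma arc_below_borel: "z \<in> S1 \<Longrightarrow> arc_below z \<in> sets circle_borel"
proof -
  assume z: "z \<in> S1"
  have "arc_below z = circle_pt ` {0..angle z} - {z}"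
  proof (intro equalityI subsetI)
    fix w assume w: "w \<in> arc_below z"
    then have "w \<in> S1" "angle w < angle z" by (auto simp: arc_below_def)
    then show "w \<in> circle_pt ` {0..angle z} - {z}"
      using angle[of w] by (auto intro!: image_eqI[of w circle_pt "angle w"])
  next
    fix w assume "w \<in> circle_pt ` {0..angle z} - {z}"
    then obtain t where t: "0 \<le> t" "t \<le> angle z" "w = circle_pt t" "w \<noteq> z" by auto
    then have "t < angle z" using angle(3)[OF z] by (cases "t = angle z") auto
    then show "w \<in> arc_below z" using t angle(2)[OF z] by (simp add: circle_pt_in_arc_below)
  qed
  moreover have "compact (circle_pt ` {0..angle z})"
    by (intro compact_continuous_image continuous_on_circle_pt continuous_on_id compact_Icc)
  ultimately have "arc_below z \<in> sets borel" by (auto intro: borel_compact)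
  then show ?thesis by (subst sets_restrict_space_iff) (auto simp: arc_below_def)
qed

text \<open>
  A primitive of \<open>1\<^sub>E - \<lambda> E\<close>. As this function has mean \<open>0\<close>, the primitive is well defined on the
  circle and not only on the line.
\<close>

definition arc_primitive :: "complex set \<Rightarrow> complex \<Rightarrow> real" where
  "arc_primitive E z = measure circle_lebesgue (E \<inter> arc_below z) - angle z * measure circle_lebesgue E"

lemma measure_circle_arc_below:
  assumes E: "E \<in> sets circle_borel" and z: "z \<in> S1"
  shows "measure circle_lebesgue (E \<inter> arc_below z) = set_cdf {t. circle_pt t \<in> E} (angle z)"
proof -
  have "{t. circle_pt t \<in> E \<inter> arc_below z} \<inter> {0..<1} = {t. circle_pt t \<in> E} \<inter> {0..<angle z}"
    using angle[OF z] by (auto simp: circle_pt_in_arc_below)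
  then show ?thesis
    using E arc_below_borel[OF z] angle(1)[OF z] by (simp add: measure_circle_lebesgue sets.Int set_cdf_def)
qed

lemma arc_primitive_circle_pt:
  assumes E: "E \<in> sets circle_borel"
  shows "set_cdf {t. circle_pt t \<in> E} x = arc_primitive E (circle_pt x) + x * measure circle_lebesgue E"
proof -
  let ?P = "{t. circle_pt t \<in> E}"
  have P: "?P \<in> sets borel" using angles_borel[OF E] .
  have m: "measure circle_lebesgue E = set_cdf ?P 1"
    by (simp add: measure_circle_lebesgue[OF E] set_cdf_def)
  have "circle_pt (angle (circle_pt x)) = circle_pt x" by (intro angle) simp
  then obtain k where "x - angle (circle_pt x) = of_int k"
    by (metis Ints_cases circle_pt_eq_iff)
  then have x: "x = angle (circle_pt x) + of_int k" by simp
  have "set_cdf ?P x = set_cdf ?P (angle (circle_pt x)) + of_int k * set_cdf ?P 1"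
    by (subst x) (rule set_cdf_add_int[OF P], simp)
  moreover have "of_int k = x - angle (circle_pt x)" using x by linarith
  ultimately show ?thesis
    using measure_circle_arc_below[OF E, of "circle_pt x"] by (simp add: arc_primitive_def m algebra_simps)
qed

lemma arc_primitive_bound:
  assumes "z \<in> S1"
  shows "\<bar>arc_primitive E z\<bar> \<le> 1"
proof -
  have "0 \<le> measure circle_lebesgue (E \<inter> arc_below z)" "measure circle_lebesgue (E \<inter> arc_below z) \<le> 1" by auto
  moreover have "0 \<le> angle z * measure circle_lebesgue E" "angle z * measure circle_lebesgue E \<le> 1"
    using angle[OF assms] by (auto intro: mult_le_one)
  ultimately show ?thesis unfolding arc_primitive_def by linarith
qed

context affine_circle_map
begin

lemma locally_affine:
  assumes "z \<in> S1" "z \<notin> A"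
  shows "\<exists>\<delta>>0. \<exists>w\<in>S1. \<exists>s. \<forall>u. \<bar>u\<bar> < \<delta> \<longrightarrow> T (z * circle_pt u) = w * circle_pt (s * u)"
proof -
  obtain t where t: "circle_pt t = z" using circle_ptE assms(1) by metis
  obtain \<delta> where \<delta>: "\<delta> > 0" "\<And>x. 0 < \<bar>x - t\<bar> \<Longrightarrow> \<bar>x - t\<bar> < \<delta> \<Longrightarrow> circle_pt x \<notin> A"
    using finite_angles_isolated[OF finite_A, of t] by blast
  have "circle_pt x \<notin> A" if "t - \<delta> < x" "x < t + \<delta>" for x
    using \<delta>(2)[of x] assms(2) t that by (cases "x = t") auto
  moreover have "t - \<delta> < t + \<delta>" using \<delta>(1) by simp
  ultimately obtain s b where sb: "\<And>x. t - \<delta> < x \<Longrightarrow> x < t + \<delta> \<Longrightarrow> T (circle_pt x) = circle_pt (s * x + b)"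
    using affine by meson
  have "T (z * circle_pt u) = circle_pt (s * t + b) * circle_pt (s * u)" if "\<bar>u\<bar> < \<delta>" for u
  proof -
    have "T (circle_pt (t + u)) = circle_pt (s * (t + u) + b)" using that by (intro sb) auto
    also have "s * (t + u) + b = (s * t + b) + s * u" by (simp add: algebra_simps)
    finally show ?thesis by (simp add: circle_pt_add t)
  qed
  then show ?thesis using \<delta>(1) circle_pt_in_S1 by blast
qed

lemma continuous_off_A:
  assumes "z \<in> S1" "z \<notin> A"
  shows "continuous (at z within S1) T"
proof -
  obtain \<delta> w s where \<delta>: "\<delta> > 0" "w \<in> S1" "\<And>u. \<bar>u\<bar> < \<delta> \<Longrightarrow> T (z * circle_pt u) = w * circle_pt (s * u)"
    using locally_affine[OF assms] by blast
  show ?thesis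
    unfolding continuous_within_eps_delta
  proof (intro allI impI)
    fix e :: real assume "e > 0"
    define \<delta>' where "\<delta>' = min \<delta> (e / (2 * pi * \<bar>s\<bar> + 1))"
    have pos: "2 * pi * \<bar>s\<bar> + 1 > 0" by (intro add_nonneg_pos) auto
    then have "\<delta>' > 0" using \<delta> \<open>e > 0\<close> by (simp add: \<delta>'_def)
    then obtain d where d: "d > 0" "\<And>y. y \<in> S1 \<Longrightarrow> dist y z < d \<Longrightarrow> \<exists>u. \<bar>u\<bar> < \<delta>' \<and> y = z * circle_pt u"
      using circle_pt_local_surj[OF assms(1)] by blast
    have "dist (T y) (T z) < e" if y: "y \<in> S1" "dist y z < d" for y
    proof -
      obtain u where u: "\<bar>u\<bar> < \<delta>'" "y = z * circle_pt u" using d(2)[OF y] by blast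
      have T: "T y = w * circle_pt (s * u)" "T z = w * circle_pt 0"
        using \<delta>(3)[of u] \<delta>(3)[of 0] u \<delta>(1) by (auto simp: \<delta>'_def)
      have "dist (T y) (T z) = norm (w * (circle_pt (s * u) - circle_pt 0))"
        unfolding T dist_norm by (simp only: right_diff_distrib)
      also have "\<dots> = dist (circle_pt (s * u)) (circle_pt 0)"
        using \<delta>(2) by (simp add: norm_mult dist_norm)
      also have "\<dots> \<le> 2 * pi * \<bar>s * u - 0\<bar>" by (rule dist_circle_pt_le)
      also have "\<dots> \<le> (2 * pi * \<bar>s\<bar> + 1) * \<bar>u\<bar>" by (simp add: abs_mult algebra_simps)
      also have "\<dots> < e" using u(1) pos by (simp add: \<delta>'_def field_simps)
      finally show ?thesis .
    qed
    then show "\<exists>d>0. \<forall>y\<in>S1. dist y z < d \<longrightarrow> dist (T y) (T z) < e" using d(1) by blast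
  qed
qed

text \<open>
  Off \<open>A\<close> the map is affine on both sides, hence continuous and differentiable with locally constant
  derivative. In particular the discontinuities, and with them the prematching set, are finite.
\<close>

lemma discontinuities_subset: "discontinuities T \<subseteq> A"
proof
  fix z assume z: "z \<in> discontinuities T"
  then have "z \<in> S1" by (simp add: discontinuities_def)
  show "z \<in> A"
  proof (rule ccontr)
    assume "z \<notin> A"
    obtain \<delta> w s where \<delta>: "\<delta> > 0" "w \<in> S1" "\<And>u. \<bar>u\<bar> < \<delta> \<Longrightarrow> T (z * circle_pt u) = w * circle_pt (s * u)"
      using locally_affine[OF \<open>z \<in> S1\<close> \<open>z \<notin> A\<close>] by blast
    have D: "circle_has_deriv T s (z * circle_pt v)" if v: "\<bar>v\<bar> < \<delta>" for v
    proof (rule circle_has_deriv_affine[of "\<delta> - \<bar>v\<bar>"])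
      fix u assume "\<bar>u\<bar> < \<delta> - \<bar>v\<bar>"
      then show "T (z * circle_pt v * circle_pt u) = w * circle_pt (s * v) * circle_pt (s * u)"
        using \<delta>(3)[of "v + u"] by (simp add: circle_pt_add distrib_left mult.assoc)
    qed (use v in auto)
    have deriv: "circle_deriv T (z * circle_pt v) = s" if v: "\<bar>v\<bar> < \<delta>" for v
      using D[OF v] by (rule circle_has_deriv_unique) (use \<delta>(3)[OF v] \<delta>(2) in auto)
    have "circle_differentiable T z"
      using D[of 0] \<delta>(1) by (auto simp: circle_differentiable_def)
    moreover have "continuous (at z within S1) (circle_deriv T)"
    proof -
      obtain d where d: "d > 0" "\<And>y. y \<in> S1 \<Longrightarrow> dist y z < d \<Longrightarrow> \<exists>u. \<bar>u\<bar> < \<delta> \<and> y = z * circle_pt u"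
        using circle_pt_local_surj[OF \<open>z \<in> S1\<close> \<delta>(1)] by blast
      have c: "circle_deriv T y = s" if "y \<in> S1" "dist y z < d" for y
        using d(2)[OF that] deriv by blast
      have "circle_deriv T y = circle_deriv T z" if "y \<in> S1" "dist y z < d" for y
        using c[OF that] c[of z] \<open>z \<in> S1\<close> d(1) by simp
      then show ?thesis
        unfolding continuous_within_eps_delta using d(1) by (metis dist_self)
    qed
    ultimately show False
      using z continuous_off_A[OF \<open>z \<in> S1\<close> \<open>z \<notin> A\<close>] by (simp add: discontinuities_def)
  qed
qed

lemma finite_prematching_set: "finite (prematching_set T \<kappa>m \<kappa>p)"
  unfolding prematching_set_def using finite_subset[OF discontinuities_subset finite_A] by auto

lemma prematching_set_subset: "prematching_set T \<kappa>m \<kappa>p \<subseteq> S1"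
proof
  fix p assume "p \<in> prematching_set T \<kappa>m \<kappa>p"
  then obtain c j where c: "c \<in> discontinuities T" and p: "p = lower_orbit T j c \<or> p = upper_orbit T j c"
    by (auto simp: prematching_set_def)
  have "c \<in> S1" using c by (simp add: discontinuities_def)
  then have "fst ((germ_map ^^ j) (c, e)) \<in> S1" if "e = 1 \<or> e = -1" for e
    using germ_iterate_in_germs[of "(c, e)" j] that by (simp only: mem_Times_iff) auto
  then show "p \<in> S1" using p one_sided_orbits[OF \<open>c \<in> S1\<close>] by auto
qed

text \<open>
  The map is continuous off a finite set, on which its values do not matter for measurability.
\<close>

lemma T_measurable: "T \<in> measurable circle_borel circle_borel"
proof (rule measurable_restrict_space2)
  show "T \<in> space circle_borel \<rightarrow> S1"
    using T_in_S1 by (auto simp: space_restrict_space)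
  show "T \<in> borel_measurable circle_borel"
  proof (rule measurable_piecewise_restrict[where C = "insert (S1 - A) ((\<lambda>a. {a}) ` A)"])
    show "countable (insert (S1 - A) ((\<lambda>a. {a}) ` A))"
      using finite_A by (intro countable_finite) auto
    have S1: "S1 \<in> sets circle_borel" using sets.top[of circle_borel] by (simp add: space_restrict_space)
    have fin: "F \<inter> S1 \<in> sets circle_borel" if "finite F" for F :: "complex set"
      using that by (subst sets_restrict_space_iff) (auto intro: borel_closed finite_imp_closed)
    show "\<Omega> \<inter> space circle_borel \<in> sets circle_borel" if \<Omega>: "\<Omega> \<in> insert (S1 - A) ((\<lambda>a. {a}) ` A)" for \<Omega>
    proof (cases "\<Omega> = S1 - A")
      case True
      then have "\<Omega> \<inter> space circle_borel = S1 - A \<inter> S1" by (auto simp: space_restrict_space)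
      then show ?thesis using S1 fin[OF finite_A] by auto
    next
      case False
      then have "finite \<Omega>" using \<Omega> by auto
      then show ?thesis using fin by (simp add: space_restrict_space)
    qed
    show "space circle_borel \<subseteq> \<Union> (insert (S1 - A) ((\<lambda>a. {a}) ` A))"
      by (auto simp: space_restrict_space)
    show "T \<in> borel_measurable (restrict_space circle_borel \<Omega>)" if \<Omega>: "\<Omega> \<in> insert (S1 - A) ((\<lambda>a. {a}) ` A)" for \<Omega>
    proof (cases "\<Omega> = S1 - A")
      case True
      have "continuous_on (S1 - A) T"
        using continuous_off_A unfolding continuous_on_eq_continuous_within
        by (blast intro: continuous_within_subset)
      moreover have "restrict_space circle_borel \<Omega> = restrict_space borel (S1 - A)"
      proof -
        have "S1 - A \<in> sets borel"
          using finite_A by (intro sets.Diff borel_closed closed_sphere finite_imp_closed)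
        then show ?thesis
          unfolding True by (subst restrict_restrict_space) (auto simp: inf.absorb2)
      qed
      ultimately show ?thesis using borel_measurable_continuous_on_restrict by simp
    next
      case False
      then obtain a where a: "\<Omega> = {a}" using \<Omega> by auto
      have "(\<lambda>_. T a) \<in> borel_measurable (restrict_space circle_borel \<Omega>)" by simp
      then show ?thesis
        by (rule measurable_cong[THEN iffD1, rotated]) (auto simp: space_restrict_space a)
    qed
  qed
qed

lemma iterate_measurable: "T ^^ n \<in> measurable circle_borel circle_borel"
  using measurable_compose_n[OF T_measurable] .

lemma iterate_vimage_borel: "E \<in> sets circle_borel \<Longrightarrow> (T ^^ n) -` E \<inter> S1 \<in> sets circle_borel"
  using measurable_sets[OF iterate_measurable, of E n] by (simp add: space_restrict_space)

text \<open>
  The change of variables on a cell expresses the measure as a difference of distribution functions; their linear parts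
  add up to \<open>\<lambda> E\<close>, their periodic parts to the defect.
\<close>

lemma measure_iterate_vimage:
  assumes E: "E \<in> sets circle_borel"
  shows "measure circle_lebesgue ((T ^^ n) -` E \<inter> S1) =
         measure circle_lebesgue E - defect (arc_primitive E) n"
proof -
  let ?B = "break_angles n"
  let ?N = "next_pt ?B"
  let ?P = "{t. circle_pt t \<in> E}"
  let ?L = "measure circle_lebesgue E"
  obtain s b where cell: "\<And>t. t \<in> ?B \<Longrightarrow> affine_cell n t (?N t) (s t) (b t)"
    using ex_cell_data[of n] by blast
  define M where "M = {t. circle_pt t \<in> (T ^^ n) -` E \<inter> S1}"
  have V: "(T ^^ n) -` E \<inter> S1 \<in> sets circle_borel" by (rule iterate_vimage_borel[OF E])
  have "M \<in> sets lborel" using angles_borel[OF V] by (simp add: M_def)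
  have "measure circle_lebesgue ((T ^^ n) -` E \<inter> S1) = measure lborel (M \<inter> {0..<1})"
    by (simp add: measure_circle_lebesgue[OF V] M_def)
  also have "\<dots> = (\<Sum>t\<in>?B. measure lborel (M \<inter> {t<..<?N t}))"
    by (rule measure_cells[OF finite_break_angles break_angles_subset break_angles_0 \<open>M \<in> sets lborel\<close>])
  also have "\<dots> = (\<Sum>t\<in>?B. (arc_primitive E (circle_pt (s t * ?N t + b t)) -
      arc_primitive E (circle_pt (s t * t + b t))) / s t + (?N t - t) * ?L)"
  proof (rule sum.cong)
    fix t assume t: "t \<in> ?B"
    have s: "s t \<noteq> 0" using affine_cellD(1)[OF cell[OF t]] .
    have "M \<inter> {t<..<?N t} = {x \<in> {t<..<?N t}. s t * x + b t \<in> ?P}"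
      using affine_cellD(2)[OF cell[OF t]] by (auto simp: M_def)
    then have "measure lborel (M \<inter> {t<..<?N t}) = (set_cdf ?P (s t * ?N t + b t) - set_cdf ?P (s t * t + b t)) / s t"
      using measure_affine_preimage[OF angles_borel[OF E] s cell_props(1)[OF t], of "b t"] by simp
    also have "\<dots> = (arc_primitive E (circle_pt (s t * ?N t + b t)) -
        arc_primitive E (circle_pt (s t * t + b t))) / s t + (?N t - t) * ?L"
      unfolding arc_primitive_circle_pt[OF E] using s by (simp add: field_simps)
    finally show "measure lborel (M \<inter> {t<..<?N t}) = (arc_primitive E (circle_pt (s t * ?N t + b t)) -
        arc_primitive E (circle_pt (s t * t + b t))) / s t + (?N t - t) * ?L" .
  qed simp
  also have "\<dots> = ?L - defect (arc_primitive E) n"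
    using sum_next_pt_diff[OF finite_break_angles break_angles_subset break_angles_0, of n]
    by (simp add: defect_cells[OF cell] sum.distrib flip: sum_distrib_right)
  finally show ?thesis .
qed

end

section \<open>Step densities\<close>

lemma convergent_subsequence_finite_family:
  fixes a :: "'i \<Rightarrow> nat \<Rightarrow> real"
  assumes "finite P" "\<And>p n. p \<in> P \<Longrightarrow> \<bar>a p n\<bar> \<le> K"
  shows "\<exists>r l. strict_mono r \<and> (\<forall>p\<in>P. (\<lambda>n. a p (r n)) \<longlonglongrightarrow> l p)"
  using assms
proof (induction P rule: finite_induct)
  case empty
  show ?case by (intro exI[of _ id]) (auto simp: strict_mono_def)
next
  case (insert q P)
  then obtain r l where r: "strict_mono r" "\<forall>p\<in>P. (\<lambda>n. a p (r n)) \<longlonglongrightarrow> l p" by auto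
  have "seq_compact {-K..K}" by (intro compact_imp_seq_compact compact_Icc)
  moreover have "\<forall>n. a q (r n) \<in> {-K..K}" using insert.prems[of q] by (auto simp: abs_le_iff minus_le_iff)
  ultimately obtain x r' where r': "strict_mono r'" "((\<lambda>n. a q (r n)) \<circ> r') \<longlonglongrightarrow> x"
    unfolding seq_compact_def by (auto dest!: spec[of _ "\<lambda>n. a q (r n)"])
  have "(\<lambda>n. a p ((r \<circ> r') n)) \<longlonglongrightarrow> (l(q := x)) p" if "p \<in> insert q P" for p
  proof (cases "p = q")
    case False
    then have "(\<lambda>n. a p (r n)) \<longlonglongrightarrow> l p" using that r(2) by auto
    from LIMSEQ_subseq_LIMSEQ[OF this r'(1)] show ?thesis using False by (simp add: o_def)
  qed (use r'(2) in \<open>simp add: o_def\<close>)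
  then show ?case using strict_mono_o[OF r(1) r'(1)] by blast
qed

text \<open>
  The density of \<open>E \<mapsto> \<lambda> E + \<Sum>p\<in>P. \<alpha> p * arc_primitive E p\<close>, because \<open>arc_primitive E p\<close> is the integral over \<open>E\<close> of
  \<open>indicator (arc_below p) - angle p\<close>.
\<close>

definition step_function :: "complex set \<Rightarrow> (complex \<Rightarrow> real) \<Rightarrow> complex \<Rightarrow> real" where
  "step_function P \<alpha> z = 1 + (\<Sum>p\<in>P. \<alpha> p * (indicator (arc_below p) z - angle p))"

lemma step_function_measurable:
  assumes "P \<subseteq> S1"
  shows "step_function P \<alpha> \<in> borel_measurable circle_lebesgue"
proof -
  have "indicator (arc_below p) \<in> borel_measurable circle_lebesgue" if "p \<in> P" for p
    using arc_below_borel that assms by (intro borel_measurable_indicator) auto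
  then show ?thesis unfolding step_function_def
    by (intro borel_measurable_add borel_measurable_sum borel_measurable_times borel_measurable_diff) auto
qed

lemma step_function_integral:
  assumes "finite P" "P \<subseteq> S1" and E: "E \<in> sets circle_borel"
  shows "integrable circle_lebesgue (\<lambda>z. indicator E z * step_function P \<alpha> z)"
    and "(\<integral>z. indicator E z * step_function P \<alpha> z \<partial>circle_lebesgue) =
         measure circle_lebesgue E + (\<Sum>p\<in>P. \<alpha> p * arc_primitive E p)"
proof -
  have int: "integrable circle_lebesgue (indicator F :: complex \<Rightarrow> real)" if "F \<in> sets circle_borel" for F
    using that by (intro integrable_real_indicator) (auto simp: less_top[symmetric])
  have meas: "(\<integral>z. indicator F z \<partial>circle_lebesgue) = measure circle_lebesgue F" if "F \<in> sets circle_borel" for F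
    using sets_circle_borelD(1)[OF that] by (simp add: Int_absorb2)
  have eq: "(\<lambda>z. indicator E z * step_function P \<alpha> z) =
    (\<lambda>z. indicator E z + (\<Sum>p\<in>P. \<alpha> p * (indicator (E \<inter> arc_below p) z - angle p * indicator E z)))"
    by (auto simp: fun_eq_iff step_function_def indicator_def)
  have EA: "E \<inter> arc_below p \<in> sets circle_borel" if "p \<in> P" for p
    using E arc_below_borel[of p] that assms(2) by (intro sets.Int) auto
  have i: "integrable circle_lebesgue (\<lambda>z. \<alpha> p * (indicator (E \<inter> arc_below p) z - angle p * indicator E z))" if "p \<in> P" for p
    by (intro integrable_mult_right Bochner_Integration.integrable_diff int EA that E)
  show "integrable circle_lebesgue (\<lambda>z. indicator E z * step_function P \<alpha> z)"
    unfolding eq by (intro Bochner_Integration.integrable_add Bochner_Integration.integrable_sum int E i)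
  have "(\<integral>z. \<alpha> p * (indicator (E \<inter> arc_below p) z - angle p * indicator E z) \<partial>circle_lebesgue) = \<alpha> p * arc_primitive E p"
    if "p \<in> P" for p
  proof -
    have "(\<integral>z. indicator (E \<inter> arc_below p) z - angle p * indicator E z \<partial>circle_lebesgue) = arc_primitive E p"
      using int[OF EA[OF that]] int[OF E] meas[OF EA[OF that]] meas[OF E]
      by (subst Bochner_Integration.integral_diff) (auto simp: arc_primitive_def)
    then show ?thesis by simp
  qed
  then show "(\<integral>z. indicator E z * step_function P \<alpha> z \<partial>circle_lebesgue) =
         measure circle_lebesgue E + (\<Sum>p\<in>P. \<alpha> p * arc_primitive E p)"
    unfolding eq using int[OF E] i meas[OF E]
    by (subst Bochner_Integration.integral_add)
      (auto intro!: Bochner_Integration.integrable_sum simp: Bochner_Integration.integral_sum simp del: integral_mult_right_zero)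
qed

text \<open>
  All the arcs begin at the point \<open>1\<close>, where their indicators jump simultaneously by \<open>\<Sum>p\<in>P. \<alpha> p\<close>;
  that this sum vanishes is what makes \<open>1\<close> an ordinary point.
\<close>

lemma step_function_locally_constant:
  assumes "finite P" "P \<subseteq> S1" and sum0: "(\<Sum>p\<in>P. \<alpha> p) = 0" and z: "z \<in> S1 - P"
  shows "\<exists>\<delta>>0. \<forall>u. \<bar>u\<bar> < \<delta> \<longrightarrow> step_function P \<alpha> (z * circle_pt u) = step_function P \<alpha> z"
proof -
  define t where "t = angle z"
  have t: "0 \<le> t" "t < 1" "circle_pt t = z" using angle[of z] z by (auto simp: t_def)
  have p: "0 \<le> angle p" "angle p < 1" "angle p \<noteq> t" if "p \<in> P" for p
    using angle[of p] that assms(2) z t(3) by (auto simp: subset_eq)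
  \<comment> \<open>The distances that a perturbation must not exceed: to the end \<open>1\<close> of the unit interval, to the angles of \<open>P\<close>,
  and, for perturbations that cross angle \<open>0\<close> backwards, from the angles of \<open>P\<close> to \<open>1\<close>.\<close>
  define D where "D = insert 1 (insert (1 - t) ((\<lambda>p. \<bar>angle p - t\<bar>) ` P \<union> (\<lambda>p. 1 - angle p) ` P))"
  have D: "finite D" "D \<noteq> {}" "\<And>d. d \<in> D \<Longrightarrow> d > 0"
    using assms(1) t p by (auto simp: D_def)
  define \<delta> where "\<delta> = (if t = 0 then Min D else min t (Min D))"
  have "\<delta> > 0" using D t by (auto simp: \<delta>_def)
  have MinD: "Min D \<le> d" if "d \<in> D" for d using D that by simp
  have le: "\<delta> \<le> 1" "\<delta> \<le> 1 - t" "p \<in> P \<Longrightarrow> \<delta> \<le> \<bar>angle p - t\<bar>" "p \<in> P \<Longrightarrow> \<delta> \<le> 1 - angle p"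
    "t \<noteq> 0 \<Longrightarrow> \<delta> \<le> t" for p
    using MinD[of 1] MinD[of "1 - t"] MinD[of "\<bar>angle p - t\<bar>"] MinD[of "1 - angle p"]
    by (auto simp: \<delta>_def D_def)
  have form: "step_function P \<alpha> w = 1 - (\<Sum>p\<in>P. \<alpha> p * angle p) + (\<Sum>p\<in>P. \<alpha> p * indicator (arc_below p) w)" for w
    by (simp add: step_function_def right_diff_distrib sum_subtractf)
  have "(\<Sum>p\<in>P. \<alpha> p * indicator (arc_below p) (z * circle_pt u)) = (\<Sum>p\<in>P. \<alpha> p * indicator (arc_below p) z)"
    if u: "\<bar>u\<bar> < \<delta>" for u
  proof (cases "t + u < 0")
    case False
    have "indicator (arc_below p) (z * circle_pt u) = (indicator (arc_below p) z :: real)" if "p \<in> P" for p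
    proof -
      have "circle_pt (t + u) \<in> arc_below p \<longleftrightarrow> circle_pt t \<in> arc_below p"
        using False u le(2) le(3)[OF that] t by (subst (1 2) circle_pt_in_arc_below) auto
      then show ?thesis by (simp add: circle_pt_add t indicator_def)
    qed
    then show ?thesis by simp
  next
    case True
    then have t0: "t = 0" using u le(5) by force
    have "z * circle_pt u = circle_pt (u + 1)" using t(3) by (simp add: t0)
    moreover have "circle_pt (u + 1) \<notin> arc_below p" if "p \<in> P" for p
      using True t0 u le(1) le(4)[OF that] by (subst circle_pt_in_arc_below) auto
    ultimately have "(\<Sum>p\<in>P. \<alpha> p * indicator (arc_below p) (z * circle_pt u)) = 0"
      by simp
    moreover have "z \<in> arc_below p" if "p \<in> P" for p
      unfolding t(3)[symmetric] using p[OF that] t0 by (subst circle_pt_in_arc_below) auto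
    then have "(\<Sum>p\<in>P. \<alpha> p * indicator (arc_below p) z) = (\<Sum>p\<in>P. \<alpha> p)" by simp
    ultimately show ?thesis using sum0 by simp
  qed
  then show ?thesis using \<open>\<delta> > 0\<close> by (auto simp: form)
qed

lemma step_function_constant_on_component:
  assumes "finite P" "P \<subseteq> S1" "(\<Sum>p\<in>P. \<alpha> p) = 0" and I: "I \<in> components (S1 - P)"
  shows "step_function P \<alpha> constant_on I"
proof (rule locally_constant_imp_constant)
  show "connected I" using I by (rule in_components_connected)
  fix z assume z: "z \<in> I"
  then have "z \<in> S1 - P" using in_components_subset[OF I] by blast
  then obtain \<delta> where \<delta>: "\<delta> > 0" "\<And>u. \<bar>u\<bar> < \<delta> \<Longrightarrow> step_function P \<alpha> (z * circle_pt u) = step_function P \<alpha> z"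
    using step_function_locally_constant[OF assms(1-3)] by blast
  have "z \<in> S1" using \<open>z \<in> S1 - P\<close> by blast
  obtain d where d: "d > 0" "\<And>w. w \<in> S1 \<Longrightarrow> dist w z < d \<Longrightarrow> \<exists>u. \<bar>u\<bar> < \<delta> \<and> w = z * circle_pt u"
    using circle_pt_local_surj[OF \<open>z \<in> S1\<close> \<delta>(1)] by blast
  show "\<exists>U. openin (top_of_set I) U \<and> z \<in> U \<and> (\<forall>w\<in>U. step_function P \<alpha> w = step_function P \<alpha> z)"
  proof (intro exI[of _ "I \<inter> ball z d"] conjI ballI)
    fix w assume w: "w \<in> I \<inter> ball z d"
    then have "w \<in> S1" "dist w z < d" using in_components_subset[OF I] by (auto simp: dist_commute)
    then show "step_function P \<alpha> w = step_function P \<alpha> z" using d(2) \<delta>(2) by blast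
  qed (use z d(1) in \<open>auto intro: openin_open_Int\<close>)
qed

section \<open>The limit of the averaged push-forwards\<close>

context affine_circle_map
begin

text \<open>
  The coefficients are the sums of resolvent jumps for the indicators of single points, divided by
  \<open>-N\<close>. They are bounded since all defects are, so they converge along a subsequence. Their limits
  add up to \<open>0\<close> because constant functions have defect \<open>0\<close>.
\<close>

lemma averages_converge:
  assumes "matching T \<kappa>m \<kappa>p"
  defines "P \<equiv> prematching_set T \<kappa>m \<kappa>p"
  shows "\<exists>\<alpha> r. strict_mono r \<and> (\<Sum>p\<in>P. \<alpha> p) = 0 \<and>
     (\<forall>E\<in>sets circle_borel. (\<lambda>k. (\<Sum>n<Suc (r k). measure circle_lebesgue ((T ^^ n) -` E \<inter> S1)) / Suc (r k))
        \<longlonglongrightarrow> measure circle_lebesgue E + (\<Sum>p\<in>P. \<alpha> p * arc_primitive E p))"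
proof -
  have fin: "finite P" "P \<subseteq> S1" unfolding P_def by (rule finite_prematching_set prematching_set_subset)+
  obtain K where "K \<ge> 0" and K: "\<forall>\<Phi> M N. (\<forall>z\<in>S1. \<bar>\<Phi> z\<bar> \<le> M) \<longrightarrow>
      \<bar>defect \<Phi> N\<bar> \<le> K * M \<and> \<bar>(\<Sum>n<N. defect \<Phi> n) - resolvent_defect \<Phi> N\<bar> \<le> K * M"
    using defect_cesaro by blast
  have K1: "\<bar>defect \<Phi> N\<bar> \<le> K" "\<bar>(\<Sum>n<N. defect \<Phi> n) - resolvent_defect \<Phi> N\<bar> \<le> K"
    if "\<forall>z\<in>S1. \<bar>\<Phi> z\<bar> \<le> 1" for \<Phi> N
    using K[rule_format, of \<Phi> 1 N] that by auto
  define a where "a p N = - resolvent_defect (indicator {p}) (Suc N) / Suc N" for p N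
  \<comment> \<open>The same coefficients serve every \<open>\<Phi>\<close>: this is where matching is used.\<close>
  have decomp: "resolvent_defect \<Phi> (Suc N) = - Suc N * (\<Sum>p\<in>P. a p N * \<Phi> p)" if "\<forall>z\<in>S1. \<bar>\<Phi> z\<bar> \<le> 1" for \<Phi> N
  proof -
    have "resolvent_defect \<Phi> (Suc N) =
        (\<Sum>t\<in>break_angles (Suc N). \<Sum>p\<in>P. \<Phi> p * jump (resolvent (indicator {p})) (circle_pt t))"
      unfolding resolvent_defect_def P_def
      by (intro sum.cong refl jump_resolvent_on_prematching_set[OF assms(1) that]) (auto simp: finite_prematching_set)
    also have "\<dots> = (\<Sum>p\<in>P. \<Phi> p * resolvent_defect (indicator {p}) (Suc N))"
      unfolding resolvent_defect_def sum_distrib_left by (rule sum.swap)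
    also have "\<dots> = (\<Sum>p\<in>P. - real (Suc N) * (a p N * \<Phi> p))"
      by (intro sum.cong) (auto simp: a_def field_simps)
    finally show ?thesis by (simp add: sum_distrib_left)
  qed
  have a_bound: "\<bar>a p N\<bar> \<le> 2 * K" for p N
  proof -
    have ind: "\<forall>z\<in>S1. \<bar>indicator {p} z :: real\<bar> \<le> 1" by (auto simp: indicator_def)
    have "\<bar>\<Sum>n<Suc N. defect (indicator {p}) n\<bar> \<le> (\<Sum>n<Suc N. \<bar>defect (indicator {p}) n\<bar>)" by (rule sum_abs)
    also have "\<dots> \<le> (\<Sum>n<Suc N. K)" by (intro sum_mono K1 ind)
    finally have "\<bar>\<Sum>n<Suc N. defect (indicator {p}) n\<bar> \<le> Suc N * K" by simp
    moreover have "K \<le> Suc N * K" using \<open>K \<ge> 0\<close> by (simp add: mult_le_cancel_right1)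
    ultimately have "\<bar>resolvent_defect (indicator {p}) (Suc N)\<bar> \<le> 2 * (Suc N * K)"
      using K1(2)[OF ind, of "Suc N"] by linarith
    then have "\<bar>resolvent_defect (indicator {p}) (Suc N)\<bar> \<le> 2 * K * Suc N"
      by (simp only: mult_ac)
    then show ?thesis by (simp add: a_def abs_divide pos_divide_le_eq del: of_nat_Suc)
  qed
  obtain r \<alpha> where r: "strict_mono r" and \<alpha>: "\<forall>p\<in>P. (\<lambda>k. a p (r k)) \<longlonglongrightarrow> \<alpha> p"
    using convergent_subsequence_finite_family[OF fin(1), of a "2 * K"] a_bound by blast
  have inv: "(\<lambda>k. C / Suc (r k)) \<longlonglongrightarrow> 0" for C :: real
  proof -
    have "(\<lambda>k. C * inverse (real (Suc k))) \<longlonglongrightarrow> C * 0"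
      by (intro tendsto_mult_left LIMSEQ_inverse_real_of_nat)
    from LIMSEQ_subseq_LIMSEQ[OF this r] show ?thesis by (simp add: o_def divide_inverse)
  qed
  have lim: "(\<lambda>k. (\<Sum>n<Suc (r k). defect \<Phi> n) / Suc (r k)) \<longlonglongrightarrow> - (\<Sum>p\<in>P. \<alpha> p * \<Phi> p)"
    if \<Phi>: "\<forall>z\<in>S1. \<bar>\<Phi> z\<bar> \<le> 1" for \<Phi>
  proof -
    have "(\<lambda>k. (\<Sum>n<Suc (r k). defect \<Phi> n) / Suc (r k) - resolvent_defect \<Phi> (Suc (r k)) / Suc (r k)) \<longlonglongrightarrow> 0"
    proof (rule Lim_null_comparison[OF always_eventually inv[of K]], rule allI)
      fix k
      show "norm ((\<Sum>n<Suc (r k). defect \<Phi> n) / Suc (r k) - resolvent_defect \<Phi> (Suc (r k)) / Suc (r k)) \<le> K / Suc (r k)"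
        using K1(2)[OF \<Phi>, of "Suc (r k)"]
        by (simp add: abs_divide divide_right_mono del: of_nat_Suc sum.lessThan_Suc flip: diff_divide_distrib)
    qed
    moreover have "(\<lambda>k. resolvent_defect \<Phi> (Suc (r k)) / Suc (r k)) \<longlonglongrightarrow> - (\<Sum>p\<in>P. \<alpha> p * \<Phi> p)"
    proof -
      have "(\<lambda>k. - (\<Sum>p\<in>P. a p (r k) * \<Phi> p)) \<longlonglongrightarrow> - (\<Sum>p\<in>P. \<alpha> p * \<Phi> p)"
        using \<alpha> by (intro tendsto_intros) auto
      moreover have "resolvent_defect \<Phi> (Suc (r k)) / Suc (r k) = - (\<Sum>p\<in>P. a p (r k) * \<Phi> p)" for k
        using decomp[OF \<Phi>, of "r k"] by (simp del: of_nat_Suc)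
      ultimately show ?thesis by simp
    qed
    ultimately show ?thesis using tendsto_add by fastforce
  qed
  have "(\<lambda>k. (\<Sum>n<Suc (r k). defect (\<lambda>_. 1) n) / Suc (r k)) \<longlonglongrightarrow> - (\<Sum>p\<in>P. \<alpha> p * 1)"
    by (rule lim) auto
  then have "(\<lambda>k. 0) \<longlonglongrightarrow> - (\<Sum>p\<in>P. \<alpha> p)"
    by (simp add: defect_const)
  then have "(\<Sum>p\<in>P. \<alpha> p) = 0"
    by (simp add: LIMSEQ_const_iff)
  moreover have "(\<lambda>k. (\<Sum>n<Suc (r k). measure circle_lebesgue ((T ^^ n) -` E \<inter> S1)) / Suc (r k))
        \<longlonglongrightarrow> measure circle_lebesgue E + (\<Sum>p\<in>P. \<alpha> p * arc_primitive E p)" if E: "E \<in> sets circle_borel" for E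
  proof -
    have "(\<Sum>n<Suc (r k). measure circle_lebesgue ((T ^^ n) -` E \<inter> S1)) / Suc (r k) =
        measure circle_lebesgue E - (\<Sum>n<Suc (r k). defect (arc_primitive E) n) / Suc (r k)" for k
      unfolding measure_iterate_vimage[OF E] sum_subtractf
      by (simp add: diff_divide_distrib del: of_nat_Suc sum.lessThan_Suc)
    moreover have "(\<lambda>k. measure circle_lebesgue E - (\<Sum>n<Suc (r k). defect (arc_primitive E) n) / Suc (r k))
        \<longlonglongrightarrow> measure circle_lebesgue E - - (\<Sum>p\<in>P. \<alpha> p * arc_primitive E p)"
      by (intro tendsto_diff tendsto_const lim) (simp add: arc_primitive_bound)
    ultimately show ?thesis by (simp del: of_nat_Suc sum.lessThan_Suc)
  qed
  ultimately show ?thesis using r by blast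
qed

text \<open>
  The limit of the averages on a Borel set is the integral of the step function over it. Averages on \<open>E\<close> and on its
  preimage differ by a telescoping sum, so they have the same limit. Limits of averages are
  non-negative, so the step function is non-negative almost everywhere and its positive part
  serves as the density.
\<close>

lemma invariant_density:
  assumes "matching T \<kappa>m \<kappa>p"
  shows "\<exists>\<mu> (h :: complex \<Rightarrow> real).
           acip T \<mu> \<and>
           h \<in> borel_measurable circle_lebesgue \<and> (\<forall>z\<in>S1. 0 \<le> h z) \<and>
           \<mu> = density circle_lebesgue (\<lambda>z. ennreal (h z)) \<and>
           (\<forall>I\<in>prematching_partition T \<kappa>m \<kappa>p.
              \<exists>k. AE z in circle_lebesgue. z \<in> I \<longrightarrow> h z = k)"
proof -
  define P where "P = prematching_set T \<kappa>m \<kappa>p"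
  have fin: "finite P" "P \<subseteq> S1" unfolding P_def by (rule finite_prematching_set prematching_set_subset)+
  obtain \<alpha> r where r: "strict_mono r" and \<alpha>0: "(\<Sum>p\<in>P. \<alpha> p) = 0"
    and conv: "\<forall>E\<in>sets circle_borel. (\<lambda>k. (\<Sum>n<Suc (r k). measure circle_lebesgue ((T ^^ n) -` E \<inter> S1)) / Suc (r k))
        \<longlonglongrightarrow> measure circle_lebesgue E + (\<Sum>p\<in>P. \<alpha> p * arc_primitive E p)"
    using averages_converge[OF assms] unfolding P_def by blast
  define avg where "avg E k = (\<Sum>n<Suc (r k). measure circle_lebesgue ((T ^^ n) -` E \<inter> S1)) / Suc (r k)" for E k
  define \<nu> where "\<nu> E = measure circle_lebesgue E + (\<Sum>p\<in>P. \<alpha> p * arc_primitive E p)" for E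
  have conv: "avg E \<longlonglongrightarrow> \<nu> E" if "E \<in> sets circle_borel" for E
    using conv that unfolding avg_def \<nu>_def by blast
  have S1: "S1 \<in> sets circle_borel" using sets.top[of circle_borel] by (simp add: space_restrict_space)
  have \<nu>_nonneg: "0 \<le> \<nu> E" if "E \<in> sets circle_borel" for E
  proof (rule LIMSEQ_le_const[OF conv[OF that]])
    have "0 \<le> avg E k" for k
      by (simp add: avg_def sum_nonneg del: sum.lessThan_Suc of_nat_Suc)
    then show "\<exists>k0. \<forall>k\<ge>k0. 0 \<le> avg E k" by blast
  qed
  have \<nu>_S1: "\<nu> S1 = 1"
  proof -
    have "avg S1 k = 1" for k
    proof -
      have "(T ^^ n) -` S1 \<inter> S1 = S1" for n using iterate_in_S1 by blast
      then have "avg S1 k = (\<Sum>n<Suc (r k). measure circle_lebesgue S1) / Suc (r k)" unfolding avg_def by simp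
      also have "measure circle_lebesgue S1 = 1" using circle.prob_space by simp
      finally show ?thesis by simp
    qed
    then have "avg S1 = (\<lambda>_. 1)" by auto
    then show ?thesis using conv[OF S1] by (simp add: LIMSEQ_const_iff)
  qed
  have \<nu>_inv: "\<nu> (T -` E \<inter> S1) = \<nu> E" if E: "E \<in> sets circle_borel" for E
  proof -
    have TE: "T -` E \<inter> S1 \<in> sets circle_borel" using iterate_vimage_borel[OF E, of 1] by simp
    let ?m = "\<lambda>n. measure circle_lebesgue ((T ^^ n) -` E \<inter> S1)"
    have "(T ^^ n) -` (T -` E \<inter> S1) \<inter> S1 = (T ^^ Suc n) -` E \<inter> S1" for n
      using iterate_in_S1[of _ n] by auto
    then have "avg (T -` E \<inter> S1) k - avg E k = (\<Sum>n<Suc (r k). ?m (Suc n) - ?m n) / Suc (r k)" for k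
      by (simp add: avg_def sum_subtractf diff_divide_distrib del: of_nat_Suc sum.lessThan_Suc funpow.simps)
    moreover have "(\<Sum>n<Suc (r k). ?m (Suc n) - ?m n) = ?m (Suc (r k)) - ?m 0" for k
      by (rule sum_lessThan_telescope)
    ultimately have "avg (T -` E \<inter> S1) k - avg E k = (?m (Suc (r k)) - ?m 0) / Suc (r k)" for k
      by metis
    moreover have "\<bar>?m (Suc (r k)) - ?m 0\<bar> \<le> 1" for k
      using circle.prob_le_1[of "(T ^^ Suc (r k)) -` E \<inter> S1"] circle.prob_le_1[of "(T ^^ 0) -` E \<inter> S1"]
        measure_nonneg[of circle_lebesgue "(T ^^ Suc (r k)) -` E \<inter> S1"] measure_nonneg[of circle_lebesgue "(T ^^ 0) -` E \<inter> S1"]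
      by linarith
    ultimately have bound: "norm (avg (T -` E \<inter> S1) k - avg E k) \<le> inverse (Suc (r k))" for k
      by (simp add: abs_divide divide_right_mono inverse_eq_divide del: of_nat_Suc funpow.simps)
    have "(\<lambda>k. inverse (real (Suc (r k)))) \<longlonglongrightarrow> 0"
      using LIMSEQ_subseq_LIMSEQ[OF LIMSEQ_inverse_real_of_nat r] by (simp only: o_def)
    then have "(\<lambda>k. avg (T -` E \<inter> S1) k - avg E k) \<longlonglongrightarrow> 0"
      by (rule Lim_null_comparison[OF always_eventually, OF allI, OF bound])
    moreover have "(\<lambda>k. avg (T -` E \<inter> S1) k - avg E k) \<longlonglongrightarrow> \<nu> (T -` E \<inter> S1) - \<nu> E"
      by (intro tendsto_diff conv E TE)
    ultimately show ?thesis using LIMSEQ_unique by fastforce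
  qed
  define g where "g = step_function P \<alpha>"
  define h where "h z = max 0 (g z)" for z
  have g_meas [measurable]: "g \<in> borel_measurable circle_lebesgue"
    unfolding g_def by (rule step_function_measurable[OF fin(2)])
  have h_meas [measurable]: "h \<in> borel_measurable circle_lebesgue"
    unfolding h_def by measurable
  have int: "integrable circle_lebesgue (\<lambda>z. indicator E z * g z)"
    "(\<integral>z. indicator E z * g z \<partial>circle_lebesgue) = \<nu> E" if "E \<in> sets circle_borel" for E
    using step_function_integral[OF fin that] by (simp_all add: g_def \<nu>_def)
  have g_nonneg: "AE z in circle_lebesgue. 0 \<le> g z"
  proof -
    define N where "N = {z \<in> space circle_lebesgue. g z < 0}"
    have N: "N \<in> sets circle_borel" unfolding N_def sets_circle_lebesgue[symmetric] by measurable
    have pos: "AE z in circle_lebesgue. 0 \<le> - (indicator N z * g z)"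
      by (rule AE_I2) (auto simp: N_def indicator_def)
    have i: "integrable circle_lebesgue (\<lambda>z. - (indicator N z * g z))"
      using int(1)[OF N] by simp
    have "(\<integral>z. - (indicator N z * g z) \<partial>circle_lebesgue) = - \<nu> N" using int(2)[OF N] by simp
    moreover have "(\<integral>z. - (indicator N z * g z) \<partial>circle_lebesgue) \<ge> 0" by (rule integral_nonneg_AE[OF pos])
    ultimately have "(\<integral>z. - (indicator N z * g z) \<partial>circle_lebesgue) = 0" using \<nu>_nonneg[OF N] by linarith
    then have "AE z in circle_lebesgue. - (indicator N z * g z) = 0"
      using integral_nonneg_eq_0_iff_AE[OF i pos] by simp
    then show ?thesis
      using AE_space by eventually_elim (auto simp: N_def indicator_def split: if_splits)
  qed
  define \<mu> where "\<mu> = density circle_lebesgue (\<lambda>z. ennreal (h z))"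
  have sets_\<mu>: "sets \<mu> = sets circle_borel" by (simp add: \<mu>_def)
  have space_\<mu>: "space \<mu> = S1" by (simp add: \<mu>_def)
  have em: "emeasure \<mu> E = ennreal (\<nu> E)" if E: "E \<in> sets circle_borel" for E
  proof -
    have "emeasure \<mu> E = (\<integral>\<^sup>+z. ennreal (h z) * indicator E z \<partial>circle_lebesgue)"
      unfolding \<mu>_def using E by (intro emeasure_density) auto
    also have "\<dots> = (\<integral>\<^sup>+z. ennreal (indicator E z * g z) \<partial>circle_lebesgue)"
      using g_nonneg by (intro nn_integral_cong_AE) (auto simp: h_def indicator_def elim!: eventually_mono)
    also have "\<dots> = ennreal (\<integral>z. indicator E z * g z \<partial>circle_lebesgue)"
      using g_nonneg by (intro nn_integral_eq_integral int(1)[OF E]) (auto simp: indicator_def elim!: eventually_mono)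
    finally show ?thesis using int(2)[OF E] by simp
  qed
  have T_meas: "T \<in> measurable \<mu> \<mu>"
    using T_measurable measurable_cong_sets[OF sets_\<mu> sets_\<mu>] by simp
  have "acip T \<mu>"
    unfolding acip_def
  proof (intro conjI)
    show "prob_space \<mu>"
      by (rule prob_spaceI) (simp add: space_\<mu> em[OF S1] \<nu>_S1)
    show "sets \<mu> = sets circle_lebesgue" by (simp add: sets_\<mu>)
    show "absolutely_continuous circle_lebesgue \<mu>"
      unfolding \<mu>_def by (rule absolutely_continuousI_density) measurable
    show "T \<in> measurable \<mu> \<mu>" by (rule T_meas)
    show "distr \<mu> \<mu> T = \<mu>"
    proof (rule measure_eqI)
      fix E assume "E \<in> sets (distr \<mu> \<mu> T)"
      then have E: "E \<in> sets circle_borel" by (simp add: sets_\<mu>)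
      have "T -` E \<inter> S1 \<in> sets circle_borel" using iterate_vimage_borel[OF E, of 1] by simp
      then show "emeasure (distr \<mu> \<mu> T) E = emeasure \<mu> E"
        using E by (simp add: emeasure_distr[OF T_meas] sets_\<mu> space_\<mu> em \<nu>_inv)
    qed simp
  qed
  moreover have "\<exists>k. AE z in circle_lebesgue. z \<in> I \<longrightarrow> h z = k" if I: "I \<in> prematching_partition T \<kappa>m \<kappa>p" for I
  proof -
    have "g constant_on I"
      using step_function_constant_on_component[OF fin \<alpha>0] I
      by (simp add: g_def prematching_partition_def P_def)
    then obtain k where "\<forall>z\<in>I. g z = k" by (auto simp: constant_on_def)
    then show ?thesis by (intro exI[of _ "max 0 k"] AE_I2) (simp add: h_def)
  qed
  ultimately show ?thesis
    using h_meas \<mu>_def by (intro exI[of _ \<mu>] exI[of _ h]) (auto simp: h_def)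
qed

end

section \<open>Break points of piecewise affine, eventually expanding maps\<close>

text \<open>
  An interval on which \<open>circle_pt\<close> is injective is bounded, as it contains no two points at distance
  \<open>1\<close>. The empty interval is covered by end points in the wrong order.
\<close>

lemma injective_interval_endpoints:
  assumes "is_interval J" "inj_on circle_pt J"
  obtains c d where "\<And>x. x \<in> J \<Longrightarrow> c \<le> x \<and> x \<le> d" "\<And>x. c < x \<Longrightarrow> x < d \<Longrightarrow> x \<in> J"
proof (cases "J = {}")
  case True
  then show thesis using that[of 1 0] by auto
next
  case False
  then obtain x0 where x0: "x0 \<in> J" by auto
  have J: "y \<in> J" if "x \<in> J" "z \<in> J" "x \<le> y" "y \<le> z" for x y z
    using assms(1) that unfolding is_interval_1 by blast
  have bd: "x0 - 1 \<le> x \<and> x \<le> x0 + 1" if "x \<in> J" for x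
  proof (rule ccontr)
    assume "\<not> (x0 - 1 \<le> x \<and> x \<le> x0 + 1)"
    then consider "x \<le> x0 - 1" | "x0 + 1 \<le> x" by linarith
    then have "x0 - 1 \<in> J \<or> x0 + 1 \<in> J"
      using J[OF that x0, of "x0 - 1"] J[OF x0 that, of "x0 + 1"] by cases auto
    moreover have "circle_pt (x0 - 1) = circle_pt x0" "circle_pt (x0 + 1) = circle_pt x0"
      by (simp_all add: circle_pt_eq_iff)
    ultimately have "x0 - 1 = x0 \<or> x0 + 1 = x0" using x0 assms(2) by (metis inj_onD)
    then show False by simp
  qed
  have ba: "bdd_above J" "bdd_below J" using bd by (auto intro!: bdd_aboveI bdd_belowI)
  show thesis
  proof (rule that[of "Inf J" "Sup J"])
    show "Inf J \<le> x \<and> x \<le> Sup J" if "x \<in> J" for x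
      using that ba by (auto intro: cInf_lower cSup_upper)
    show "x \<in> J" if x: "Inf J < x" "x < Sup J" for x
    proof -
      obtain y z where "y \<in> J" "y < x" "z \<in> J" "x < z"
        using cInf_lessD[OF False x(1)] less_cSupD[OF False x(2)] by blast
      then show ?thesis using J[of y z x] by auto
    qed
  qed
qed

text \<open>
  Take for \<open>A\<close> the end points of all the pieces and the point \<open>1\<close>, and for \<open>F\<close> their slopes. An interval of angles that avoids the end points
  and meets a piece, up to an integer translation, lies in that piece.
\<close>

lemma piecewise_affine_breaks:
  assumes "piecewise_affine T"
  shows "\<exists>A F. finite A \<and> 1 \<in> A \<and> finite F \<and>
     (\<forall>u v. u < v \<longrightarrow> (\<forall>t. u < t \<longrightarrow> t < v \<longrightarrow> circle_pt t \<notin> A) \<longrightarrow>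
        (\<exists>s\<in>F. \<exists>b. \<forall>t. u < t \<longrightarrow> t < v \<longrightarrow> T (circle_pt t) = circle_pt (s * t + b)))"
proof -
  obtain \<P> where \<P>: "finite \<P>" "partition_on S1 \<P>" "\<forall>I\<in>\<P>. affine_on_arc T I"
    using assms by (auto simp: piecewise_affine_def)
  define piece :: "complex set \<Rightarrow> real set \<times> real \<times> real \<times> real \<times> real \<Rightarrow> bool" where
    "piece I q \<longleftrightarrow> (case q of (J, a, b, c, d) \<Rightarrow>
      circle_pt ` J = I \<and> (\<forall>t\<in>J. T (circle_pt t) = circle_pt (a * t + b)) \<and>
      (\<forall>x\<in>J. c \<le> x \<and> x \<le> d) \<and> (\<forall>x. c < x \<longrightarrow> x < d \<longrightarrow> x \<in> J))" for I q
  have "\<exists>q. piece I q" if I: "I \<in> \<P>" for I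
  proof -
    obtain J a b where J: "is_interval J" "bij_betw circle_pt J I" "\<forall>t\<in>J. T (circle_pt t) = circle_pt (a * t + b)"
      using bspec[OF \<P>(3) I] unfolding affine_on_arc_def by blast
    have inj: "inj_on circle_pt J" "circle_pt ` J = I" using J(2) by (auto simp: bij_betw_def)
    obtain c d where cd: "\<And>x. x \<in> J \<Longrightarrow> c \<le> x \<and> x \<le> d" "\<And>x. c < x \<Longrightarrow> x < d \<Longrightarrow> x \<in> J"
      using injective_interval_endpoints[OF J(1) inj(1)] by blast
    have "piece I (J, a, b, c, d)"
      using cd inj(2) J(3) by (simp add: piece_def)
    then show ?thesis by blast
  qed
  then obtain Q where Q: "\<And>I. I \<in> \<P> \<Longrightarrow> piece I (Q I)"
    by metis
  define A where "A = insert 1 (\<Union>I\<in>\<P>. case Q I of (J, a, b, c, d) \<Rightarrow> {circle_pt c, circle_pt d})"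
  define F where "F = (\<lambda>I. case Q I of (J, a, b, c, d) \<Rightarrow> a) ` \<P>"
  have "finite A" "1 \<in> A" "finite F" using \<P>(1) by (simp_all add: A_def F_def split: prod.split)
  moreover have "\<exists>s\<in>F. \<exists>b. \<forall>t. u < t \<longrightarrow> t < v \<longrightarrow> T (circle_pt t) = circle_pt (s * t + b)"
    if uv: "u < v" and avoid: "\<forall>t. u < t \<longrightarrow> t < v \<longrightarrow> circle_pt t \<notin> A" for u v
  proof -
    define t where "t = (u + v) / 2"
    have t: "u < t" "t < v" using uv by (auto simp: t_def)
    obtain I where I: "I \<in> \<P>" "circle_pt t \<in> I"
      using partition_onD1[OF \<P>(2)] circle_pt_in_S1[of t] by blast
    obtain J a b c d where q: "Q I = (J, a, b, c, d)" by (metis prod_cases5)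
    have J: "circle_pt ` J = I" "\<And>t. t \<in> J \<Longrightarrow> T (circle_pt t) = circle_pt (a * t + b)"
      "\<And>x. x \<in> J \<Longrightarrow> c \<le> x \<and> x \<le> d" "\<And>x. c < x \<Longrightarrow> x < d \<Longrightarrow> x \<in> J"
      using Q[OF I(1)] unfolding q piece_def by auto
    have cdA: "circle_pt c \<in> A" "circle_pt d \<in> A"
      using I(1) q unfolding A_def by force+
    obtain x where x: "x \<in> J" "circle_pt x = circle_pt t" using I(2) J(1) by auto
    then obtain k where k: "x = t + of_int k"
      by (metis Ints_cases circle_pt_eq_iff diff_eq_eq add.commute)
    have off: "\<not> (u + of_int k < y \<and> y < v + of_int k)" if "circle_pt y \<in> A" for y
    proof
      assume "u + of_int k < y \<and> y < v + of_int k"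
      then have "circle_pt (y - of_int k) \<notin> A" using avoid by auto
      moreover have "circle_pt (y - of_int k) = circle_pt y" by (simp add: circle_pt_eq_iff)
      ultimately show False using that by simp
    qed
    have "c \<le> u + of_int k" "v + of_int k \<le> d"
      using J(3)[OF x(1)] off[OF cdA(1)] off[OF cdA(2)] t unfolding k by linarith+
    then have inJ: "y + of_int k \<in> J" if "u < y" "y < v" for y using that by (intro J(4)) auto
    have "T (circle_pt y) = circle_pt (a * y + (a * of_int k + b))" if "u < y" "y < v" for y
      using J(2)[OF inJ[OF that]] by (simp add: algebra_simps)
    moreover have "a \<in> F" using I(1) q by (force simp: F_def)
    ultimately show ?thesis by blast
  qed
  ultimately show ?thesis by blast
qed

lemma expanding_derivative_bound:
  assumes "eventually_expanding T"
  obtains m \<Lambda> where "m \<ge> 1" "\<Lambda> > 1"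
    "\<And>z. z \<in> S1 \<Longrightarrow> circle_differentiable (T ^^ m) z \<Longrightarrow> \<Lambda> \<le> \<bar>circle_deriv (T ^^ m) z\<bar>"
proof -
  obtain m where m: "m \<ge> 1"
    "(INF z\<in>{z \<in> S1. circle_differentiable (T ^^ m) z}. \<bar>circle_deriv (T ^^ m) z\<bar>) > 1"
    using assms by (auto simp: eventually_expanding_def)
  show thesis
  proof (rule that[OF m])
    fix z assume "z \<in> S1" "circle_differentiable (T ^^ m) z"
    then show "(INF z\<in>{z \<in> S1. circle_differentiable (T ^^ m) z}. \<bar>circle_deriv (T ^^ m) z\<bar>) \<le> \<bar>circle_deriv (T ^^ m) z\<bar>"
      by (intro cINF_lower bdd_belowI[of _ 0]) auto
  qed
qed

theorem theorem1:
  fixes T :: "complex \<Rightarrow> complex" and \<kappa>m \<kappa>p :: "complex \<Rightarrow> nat"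
  assumes "T \<in> S1 \<rightarrow> S1"
    and "piecewise_affine T"
    and "eventually_expanding T"
    and "matching T \<kappa>m \<kappa>p"
  shows "\<exists>\<mu> (h :: complex \<Rightarrow> real).
           acip T \<mu> \<and>
           h \<in> borel_measurable circle_lebesgue \<and> (\<forall>z\<in>S1. 0 \<le> h z) \<and>
           \<mu> = density circle_lebesgue (\<lambda>z. ennreal (h z)) \<and>
           (\<forall>I\<in>prematching_partition T \<kappa>m \<kappa>p.
              \<exists>k. AE z in circle_lebesgue. z \<in> I \<longrightarrow> h z = k)"
proof -
  obtain A F where A: "finite A" "1 \<in> A" and "finite F"
    and aff: "\<And>u v. u < v \<Longrightarrow> (\<And>t. u < t \<Longrightarrow> t < v \<Longrightarrow> circle_pt t \<notin> A) \<Longrightarrow>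
        \<exists>s\<in>F. \<exists>b. \<forall>t. u < t \<longrightarrow> t < v \<longrightarrow> T (circle_pt t) = circle_pt (s * t + b)"
    using piecewise_affine_breaks[OF assms(2)] by blast
  obtain m \<Lambda> where m: "m \<ge> 1" "\<Lambda> > 1"
    and exp: "\<And>z. z \<in> S1 \<Longrightarrow> circle_differentiable (T ^^ m) z \<Longrightarrow> \<Lambda> \<le> \<bar>circle_deriv (T ^^ m) z\<bar>"
    using expanding_derivative_bound[OF assms(3)] by metis
  \<comment> \<open>Pieces that consist of a single point may have slope \<open>0\<close>; on the other pieces expansion excludes it, see below.\<close>
  define \<sigma> where "\<sigma> = Min (insert 1 (abs ` (F - {0})))"
  have \<sigma>: "\<sigma> > 0" "\<And>s. s \<in> F \<Longrightarrow> s \<noteq> 0 \<Longrightarrow> \<sigma> \<le> \<bar>s\<bar>"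
    using \<open>finite F\<close> by (auto simp: \<sigma>_def)
  have expand: "\<Lambda> \<le> \<bar>s\<bar>" if g: "affine_germ (T ^^ m) z e w s" and z: "z \<in> S1" and e: "e \<in> {1, -1}" and w: "w \<in> S1" for z e w s
  proof -
    have "w \<noteq> 0" using w by auto
    from affine_germ_circle_deriv[OF g this e] obtain \<delta> where \<delta>: "\<delta> > 0"
      "\<forall>u. 0 < u \<longrightarrow> u < \<delta> \<longrightarrow> circle_has_deriv (T ^^ m) s (z * circle_pt (e * u)) \<and> circle_deriv (T ^^ m) (z * circle_pt (e * u)) = s"
      by blast
    then have "circle_has_deriv (T ^^ m) s (z * circle_pt (e * (\<delta> / 2)))" "circle_deriv (T ^^ m) (z * circle_pt (e * (\<delta> / 2))) = s"
      using \<delta>(2)[rule_format, of "\<delta> / 2"] by simp_all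
    moreover have "z * circle_pt (e * (\<delta> / 2)) \<in> S1" using z by (simp add: norm_mult)
    ultimately show ?thesis using exp by (metis circle_differentiable_def)
  qed
  have "affine_circle_map T A \<sigma> \<Lambda> m"
  proof
    fix u v :: real assume uv: "u < v" and avoid: "\<And>t. u < t \<Longrightarrow> t < v \<Longrightarrow> circle_pt t \<notin> A"
    obtain s b where s: "s \<in> F" and sb: "\<And>t. u < t \<Longrightarrow> t < v \<Longrightarrow> T (circle_pt t) = circle_pt (s * t + b)"
      using aff[OF uv avoid] by blast
    \<comment> \<open>With slope \<open>0\<close> the \<open>m\<close>-th iterate would be constant near some point, with derivative \<open>0\<close>.\<close>
    have "s \<noteq> 0"
    proof
      assume "s = 0"
      obtain n where n: "m = Suc n" using m by (cases m) auto
      define w where "w = (T ^^ n) (circle_pt b)"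
      define t where "t = (u + v) / 2"
      have t: "u < t" "t < v" using uv by (auto simp: t_def)
      have "circle_pt b = T (circle_pt t)" using sb[OF t] \<open>s = 0\<close> by simp
      have inS: "(T ^^ k) (circle_pt b) \<in> S1" for k
        by (induction k) (use assms(1) in auto)
      have c: "(T ^^ m) (circle_pt x) = w" if "u < x" "x < v" for x
        using sb[OF that] \<open>s = 0\<close> by (simp add: n w_def funpow_swap1 del: funpow.simps add: funpow_Suc_right)
      have "affine_germ (T ^^ m) (circle_pt t) 1 w 0"
        unfolding affine_germ_def
      proof (intro exI[of _ "v - t"] conjI allI impI)
        fix r assume "0 < r" "r < v - t"
        then show "(T ^^ m) (circle_pt t * circle_pt (1 * r)) = w * circle_pt (0 * (1 * r))"
          using c[of "t + r"] t by (simp add: circle_pt_add)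
      qed (use t in auto)
      then have "\<Lambda> \<le> \<bar>0\<bar>" by (rule expand) (use inS[of n] in \<open>auto simp: w_def\<close>)
      then show False using m by simp
    qed
    then show "\<exists>s b. \<sigma> \<le> \<bar>s\<bar> \<and> (\<forall>t. u < t \<longrightarrow> t < v \<longrightarrow> T (circle_pt t) = circle_pt (s * t + b))"
      using \<sigma>(2)[OF s] sb by blast
  qed (use assms(1) A \<sigma>(1) m expand in auto)
  then interpret affine_circle_map T A \<sigma> \<Lambda> m .
  show ?thesis by (rule invariant_density[OF assms(4)])
qed

end
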